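(* There exists a polynomial $p$ such that the following holds. Let $F=\star_{\alpha\in P}G_\alpha$ be a finitely generated free product of abelian groups with generating set $\Gamma$, let $\Phi$ be a Boolean formula of equations over $F$ with alphabetic constraints, and let $\sigma:\Omega_+\to\Delta^*$ be a solution of $\Phi$ (in reduced words) whose length $N$ is minimal among all solutions. Then there is an SLP $S$ of size at most $p(\|\Phi\|+\log N)$ such that each $X\in\Omega$ is also a variable of $S$ and $\mathrm{eval}(X)=\sigma(X)$ in the group $F$.
   Context: $P$ is a finite index set; each $G_\alpha$ is an abelian group generated by a finite set $\Gamma_\alpha\subseteq G_\alpha\setminus\{1\}$ closed under inverses; $\Gamma=\bigsqcup_\alpha\Gamma_\alpha$ with involution $g\mapsto g^{-1}$. Let $\Delta_\alpha=G_\alpha\setminus\{1\}$, $\Delta=\bigsqcup_\alpha\Delta_\alpha$; a word over $\Delta$ is reduced if no two consecutive letters lie in the same $\Delta_\alpha$, and elements of $F$ are identified with their unique reduced representatives. For $w\in F$: $|w|_\alpha$ is the number of letters of (reduced) $w$ in $\Delta_\alpha$, $\mathrm{alph}(w)=\{\alpha\in P:|w|_\alpha\ge1\}$, $\mathrm{first}(w)$ (resp. $\mathrm{last}(w)$) is the $\alpha$ with the first (resp. last) letter of $w$ in $\Delta_\alpha$. An alphabetic constraint is a set $\{w\in F:\mathrm{alph}(w)=A,\ \mathrm{first}(w)=\beta,\ \mathrm{last}(w)=\gamma\}$ with $A\subseteq P$, $\beta,\gamma\in P$. $\Omega$ is a finite set of variables with fixed-point-free involution, $\Omega=\Omega_+\sqcup\overline{\Omega_+}$.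 A Boolean formula of equations over $F$ with alphabetic constraints has atomic propositions $L=R$ ($L,R\in\Omega^*$) and $X\in\mathcal C$ ($X\in\Omega_+$, $\mathcal C$ an alphabetic constraint). A solution is a map $\sigma:\Omega_+\to\Delta^*$ with reduced values, extended by $\sigma(\bar X)=\sigma(X)^{-1}$, making the formula true when $L=R$ means $\sigma(L)=\sigma(R)$ in $F$ and $X\in\mathcal C$ means $\sigma(X)\in\mathcal C$. Its length is $N=|\Omega|+\sum_{X\in\Omega}|\sigma(X)|_\Gamma$, where $|f|_\Gamma$ is the length of a shortest word over $\Gamma$ representing $f$. $\|\Phi\|=|\Gamma|+\sum_i|L_iR_i|$ over the equations $L_i=R_i$ in $\Phi$. An SLP with constants in $\Gamma$ consists of variables with fixed-point-free involution and partial order $<$, each positive variable $X$ having exactly one rule $X\to a$ ($a\in\Gamma\cup\{1\}$) or $X\to YZ$ with $X<Y,\bar Y,Z,\bar Z$; $\mathrm{eval}(X)=a$ resp. $\mathrm{eval}(Y)\mathrm{eval}(Z)$, $\mathrm{eval}(\bar X)=\overline{\mathrm{eval}(X)}$ (formal inverse); size = number of rules.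
   Formalization: Ω is taken to be the set of variables occurring in the equations of Φ (else n variables occurring only in constraints force size ≥ n while ‖Φ‖ stays constant, so the claim fails); P and the groups G_α are taken with elements in the natural numbers, which is no loss up to isomorphism. *)

theory Defs
  imports "HOL-Algebra.Generated_Groups" "HOL-Computational_Algebra.Polynomial"
begin

(* Letters of Delta: pairs (alpha, g) with alpha an index in P and g a
   non-identity element of G alpha.  Groups G alpha have carrier type nat
   (every finitely generated abelian group is countable). *)
type_synonym letter = "nat \<times> nat"
type_synonym word = "letter list"
(* Variables of Omega / of an SLP: (X, True) is X, (X, False) is bar X. *)
type_synonym var = "nat \<times> bool"

definition is_letter :: "(nat \<Rightarrow> nat monoid) \<Rightarrow> nat set \<Rightarrow> letter \<Rightarrow> bool" where
  "is_letter G P a \<longleftrightarrow> fst a \<in> P \<and> snd a \<in> carrier (G (fst a)) \<and> snd a \<noteq> \<one>\<^bsub>G (fst a)\<^esub>"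

fun reduced :: "word \<Rightarrow> bool" where
  "reduced [] = True"
| "reduced [a] = True"
| "reduced (a # b # w) = (fst a \<noteq> fst b \<and> reduced (b # w))"

definition valid_reduced :: "(nat \<Rightarrow> nat monoid) \<Rightarrow> nat set \<Rightarrow> word \<Rightarrow> bool" where
  "valid_reduced G P w \<longleftrightarrow> (\<forall>a\<in>set w. is_letter G P a) \<and> reduced w"

fun cons_red :: "(nat \<Rightarrow> nat monoid) \<Rightarrow> letter \<Rightarrow> word \<Rightarrow> word" where
  "cons_red G a [] = [a]"
| "cons_red G a (b # w) =
     (if fst a = fst b then
        (if snd a \<otimes>\<^bsub>G (fst a)\<^esub> snd b = \<one>\<^bsub>G (fst a)\<^esub> then w
         else (fst a, snd a \<otimes>\<^bsub>G (fst a)\<^esub> snd b) # w)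
      else a # b # w)"

definition red :: "(nat \<Rightarrow> nat monoid) \<Rightarrow> word \<Rightarrow> word" where
  "red G w = foldr (cons_red G) w []"

definition word_inv :: "(nat \<Rightarrow> nat monoid) \<Rightarrow> word \<Rightarrow> word" where
  "word_inv G w = rev (map (\<lambda>a. (fst a, inv\<^bsub>G (fst a)\<^esub> snd a)) w)"

definition alph :: "word \<Rightarrow> nat set" where
  "alph w = fst ` set w"

type_synonym constr = "nat set \<times> nat \<times> nat"

definition in_constr :: "word \<Rightarrow> constr \<Rightarrow> bool" where
  "in_constr w C \<longleftrightarrow> w \<noteq> [] \<and> alph w = fst C \<and> fst (hd w) = fst (snd C) \<and> fst (last w) = snd (snd C)"

datatype bform =
    Eq "var list" "var list"
  | InC nat constr
  | Neg bform
  | Conj bform bform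
  | Disj bform bform

fun eqvars :: "bform \<Rightarrow> nat set" where
  "eqvars (Eq L R) = fst ` set (L @ R)"
| "eqvars (InC X C) = {}"
| "eqvars (Neg f) = eqvars f"
| "eqvars (Conj f g) = eqvars f \<union> eqvars g"
| "eqvars (Disj f g) = eqvars f \<union> eqvars g"

fun cvars :: "bform \<Rightarrow> nat set" where
  "cvars (Eq L R) = {}"
| "cvars (InC X C) = {X}"
| "cvars (Neg f) = cvars f"
| "cvars (Conj f g) = cvars f \<union> cvars g"
| "cvars (Disj f g) = cvars f \<union> cvars g"

fun eqsize :: "bform \<Rightarrow> nat" where
  "eqsize (Eq L R) = length (L @ R)"
| "eqsize (InC X C) = 0"
| "eqsize (Neg f) = eqsize f"
| "eqsize (Conj f g) = eqsize f + eqsize g"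
| "eqsize (Disj f g) = eqsize f + eqsize g"

definition sig_hat :: "(nat \<Rightarrow> nat monoid) \<Rightarrow> (nat \<Rightarrow> word) \<Rightarrow> var \<Rightarrow> word" where
  "sig_hat G \<sigma> x = (if snd x then \<sigma> (fst x) else word_inv G (\<sigma> (fst x)))"

definition eval_vars :: "(nat \<Rightarrow> nat monoid) \<Rightarrow> (nat \<Rightarrow> word) \<Rightarrow> var list \<Rightarrow> word" where
  "eval_vars G \<sigma> L = red G (concat (map (sig_hat G \<sigma>) L))"

fun holds :: "(nat \<Rightarrow> nat monoid) \<Rightarrow> (nat \<Rightarrow> word) \<Rightarrow> bform \<Rightarrow> bool" where
  "holds G \<sigma> (Eq L R) = (eval_vars G \<sigma> L = eval_vars G \<sigma> R)"
| "holds G \<sigma> (InC X C) = in_constr (\<sigma> X) C"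
| "holds G \<sigma> (Neg f) = (\<not> holds G \<sigma> f)"
| "holds G \<sigma> (Conj f g) = (holds G \<sigma> f \<and> holds G \<sigma> g)"
| "holds G \<sigma> (Disj f g) = (holds G \<sigma> f \<or> holds G \<sigma> g)"

definition is_solution :: "(nat \<Rightarrow> nat monoid) \<Rightarrow> nat set \<Rightarrow> nat set \<Rightarrow> bform \<Rightarrow> (nat \<Rightarrow> word) \<Rightarrow> bool" where
  "is_solution G P \<Omega> \<Phi> \<sigma> \<longleftrightarrow> (\<forall>X\<in>\<Omega>. valid_reduced G P (\<sigma> X)) \<and> holds G \<sigma> \<Phi>"

definition Gam :: "nat set \<Rightarrow> (nat \<Rightarrow> nat set) \<Rightarrow> letter set" where
  "Gam P \<Gamma> = {a. fst a \<in> P \<and> snd a \<in> \<Gamma> (fst a)}"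

definition gamma_len :: "(nat \<Rightarrow> nat monoid) \<Rightarrow> nat set \<Rightarrow> (nat \<Rightarrow> nat set) \<Rightarrow> word \<Rightarrow> nat" where
  "gamma_len G P \<Gamma> f = (LEAST n. \<exists>ws. set ws \<subseteq> Gam P \<Gamma> \<and> length ws = n \<and> red G ws = f)"

definition sol_length :: "(nat \<Rightarrow> nat monoid) \<Rightarrow> nat set \<Rightarrow> (nat \<Rightarrow> nat set) \<Rightarrow> nat set \<Rightarrow> (nat \<Rightarrow> word) \<Rightarrow> nat" where
  "sol_length G P \<Gamma> \<Omega> \<sigma> = card (\<Omega> \<times> (UNIV :: bool set))
     + (\<Sum>x\<in>\<Omega> \<times> (UNIV :: bool set). gamma_len G P \<Gamma> (sig_hat G \<sigma> x))"

definition fnorm :: "nat set \<Rightarrow> (nat \<Rightarrow> nat set) \<Rightarrow> bform \<Rightarrow> nat" where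
  "fnorm P \<Gamma> \<Phi> = card (Gam P \<Gamma>) + eqsize \<Phi>"

datatype slp_rule = RConst letter | ROne | RCat var var

definition slp_wf :: "nat set \<Rightarrow> (nat \<Rightarrow> nat set) \<Rightarrow> nat set \<Rightarrow> (nat \<Rightarrow> slp_rule) \<Rightarrow> (var \<times> var) set \<Rightarrow> bool" where
  "slp_wf P \<Gamma> V rl ord \<longleftrightarrow> finite V \<and> irrefl ord \<and> trans ord
     \<and> (\<forall>X\<in>V. case rl X of
            RConst a \<Rightarrow> a \<in> Gam P \<Gamma>
          | ROne \<Rightarrow> True
          | RCat Y Z \<Rightarrow> fst Y \<in> V \<and> fst Z \<in> V
               \<and> ((X, True), (fst Y, True)) \<in> ord \<and> ((X, True), (fst Y, False)) \<in> ord
               \<and> ((X, True), (fst Z, True)) \<in> ord \<and> ((X, True), (fst Z, False)) \<in> ord)"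

inductive slp_eval :: "(nat \<Rightarrow> nat monoid) \<Rightarrow> nat set \<Rightarrow> (nat \<Rightarrow> slp_rule) \<Rightarrow> var \<Rightarrow> word \<Rightarrow> bool"
  for G V rl where
  "X \<in> V \<Longrightarrow> rl X = RConst a \<Longrightarrow> slp_eval G V rl (X, True) [a]"
| "X \<in> V \<Longrightarrow> rl X = ROne \<Longrightarrow> slp_eval G V rl (X, True) []"
| "X \<in> V \<Longrightarrow> rl X = RCat Y Z \<Longrightarrow> slp_eval G V rl Y u \<Longrightarrow> slp_eval G V rl Z v
     \<Longrightarrow> slp_eval G V rl (X, True) (u @ v)"
| "slp_eval G V rl (X, True) w \<Longrightarrow> slp_eval G V rl (X, False) (word_inv G w)"

end

theory Submission
  imports Defs "HOL-Library.Sublist"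
begin

text \<open>
  Every equation becomes a chain of products of two reduced words. If \<open>z = xy\<close> is one of them, then
  \<open>x = p a q\<close>, \<open>y = q\<^sup>-\<^sup>1 b r\<close>, \<open>z = p c r\<close>, where \<open>a\<close>, \<open>b\<close>, \<open>c\<close> are empty or letters of one factor with
  \<open>ab = c\<close>. A replacement of letters or factors that respects inversion and shape (alphabet, first and
  last type), fixes the letters \<open>a\<close>, \<open>b\<close>, \<open>c\<close> and never crosses the cuts around them maps the minimal
  solution to a solution, so it cannot shorten any variable. This has three consequences.

  (1) Letters that are not their own inverses and do not occur among the \<open>a\<close>, \<open>b\<close>, \<open>c\<close> are generators.

  (2) Let \<open>S\<close> be a nonempty set of self-inverse letters that are not generators and do not occur
  among the \<open>a\<close>, \<open>b\<close>, \<open>c\<close>. If every variable contained an even number of letters from \<open>S\<close>, they could be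
  replaced alternately by a generator and its inverse. By the pigeonhole principle on parity vectors
  there are at most as many such letters as variables.

  (3) Every factor longer than \<open>O(|\<Gamma>|)\<close> has, up to inversion, an occurrence across one of the
  polynomially many cuts.

  By (3), the window of radius \<open>2\<^sup>i\<^sup>+\<^sup>1\<close> around a cut is composed of factors of windows of radius \<open>2\<^sup>i\<close>;
  extracting a factor from a program of depth \<open>d\<close> costs \<open>2d\<close> rules and does not increase the depth.
  After logarithmically many rounds the windows contain the solution. The polynomially many letters
  are compressed by repeated squaring, which is where commutativity enters.
\<close>

subsection \<open>Reduced words\<close>

text \<open>The value of \<open>bar X\<close> is forced by that of \<open>X\<close>, so every
  replacement must commute with inversion. This is the main obstacle. A self-inverse letter cannot
  simply become a generator: in the cyclic group of order 2m generated by 1 and -1, the element m is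
  self-inverse and of length m, while no generator need be self-inverse. Hence the separate parity
  argument for such letters; likewise, a self-inverse factor can only be shortened symmetrically
  around its middle letter. Reducedness and constraints see only the factor of each letter, so
  letters of one factor may be exchanged freely, even non-injectively, as long as the products that
  actually occur still come out right. The constant K: a word of prescribed shape exists with at
  most |\<Gamma>| + 1 letters, and p a p^-1 shrinks this way once p has |\<Gamma>| + 2 letters, that
  is, from length 2 |\<Gamma>| + 5 on. Letters that arise only inside products can be longer than
  those of the solution, but their length is at most N times the size of the formula, so their
  exponents have polynomially many bits.\<close>

lemma reduced_Cons: "reduced (a # w) \<longleftrightarrow> reduced w \<and> (w \<noteq> [] \<longrightarrow> fst a \<noteq> fst (hd w))"
  by (cases w) auto

lemma reduced_append:
  "reduced (u @ v) \<longleftrightarrow> reduced u \<and> reduced v \<and> (u \<noteq> [] \<and> v \<noteq> [] \<longrightarrow> fst (last u) \<noteq> fst (hd v))"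
  by (induction u) (auto simp: reduced_Cons)

lemma valid_reduced_Nil [simp]: "valid_reduced G P []"
  by (simp add: valid_reduced_def)

lemma valid_reduced_Cons:
  "valid_reduced G P (a # w) \<longleftrightarrow>
    is_letter G P a \<and> valid_reduced G P w \<and> (w \<noteq> [] \<longrightarrow> fst a \<noteq> fst (hd w))"
  by (auto simp: valid_reduced_def reduced_Cons)

lemma valid_reduced_append:
  "valid_reduced G P (u @ v) \<longleftrightarrow> valid_reduced G P u \<and> valid_reduced G P v
    \<and> (u \<noteq> [] \<and> v \<noteq> [] \<longrightarrow> fst (last u) \<noteq> fst (hd v))"
  by (auto simp: valid_reduced_def reduced_append)

lemma red_Nil [simp]: "red G [] = []"
  by (simp add: red_def)

lemma red_Cons: "red G (a # w) = cons_red G a (red G w)"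
  by (simp add: red_def)

lemma red_append: "red G (u @ v) = foldr (cons_red G) u (red G v)"
  by (simp add: red_def)

definition letter_inv :: "(nat \<Rightarrow> nat monoid) \<Rightarrow> letter \<Rightarrow> letter" where
  "letter_inv G a = (fst a, inv\<^bsub>G (fst a)\<^esub> snd a)"

lemma fst_letter_inv [simp]: "fst (letter_inv G a) = fst a"
  by (simp add: letter_inv_def)

lemma word_inv_eq: "word_inv G w = rev (map (letter_inv G) w)"
  by (simp add: word_inv_def letter_inv_def)

lemma word_inv_Nil [simp]: "word_inv G [] = []"
  by (simp add: word_inv_eq)

lemma word_inv_eq_Nil [simp]: "word_inv G w = [] \<longleftrightarrow> w = []"
  by (simp add: word_inv_eq)

lemma word_inv_append [simp]: "word_inv G (u @ v) = word_inv G v @ word_inv G u"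
  by (simp add: word_inv_eq)

lemma word_inv_Cons: "word_inv G (a # v) = word_inv G v @ [letter_inv G a]"
  by (simp add: word_inv_eq)

lemma length_word_inv [simp]: "length (word_inv G w) = length w"
  by (simp add: word_inv_eq)

lemma alph_word_inv [simp]: "alph (word_inv G w) = alph w"
  by (auto simp: word_inv_eq alph_def image_image)

lemma hd_word_inv: "w \<noteq> [] \<Longrightarrow> hd (word_inv G w) = letter_inv G (last w)"
  by (simp add: word_inv_eq hd_rev last_map)

lemma last_word_inv: "w \<noteq> [] \<Longrightarrow> last (word_inv G w) = letter_inv G (hd w)"
  by (simp add: word_inv_eq last_rev hd_map)

lemma alph_append [simp]: "alph (u @ v) = alph u \<union> alph v"
  by (auto simp: alph_def)

lemma reduced_word_inv [simp]: "reduced (word_inv G w) \<longleftrightarrow> reduced w"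
proof (induction w)
  case (Cons a w)
  show ?case
  proof (cases "w = []")
    case False
    then show ?thesis
      using Cons by (auto simp: word_inv_Cons reduced_append reduced_Cons last_word_inv)
  qed (simp add: word_inv_Cons)
qed simp

lemma alph_Nil [simp]: "alph [] = {}"
  by (auto simp: alph_def)

text \<open>Two words have the same shape when no alphabetic constraint separates them.\<close>
definition same_shape :: "word \<Rightarrow> word \<Rightarrow> bool" where
  "same_shape u v \<longleftrightarrow> (u = [] \<longleftrightarrow> v = []) \<and> alph u = alph v
     \<and> (u \<noteq> [] \<longrightarrow> fst (hd u) = fst (hd v) \<and> fst (last u) = fst (last v))"

lemma same_shape_refl [simp]: "same_shape u u"
  by (simp add: same_shape_def)

lemma same_shape_append:
  assumes "same_shape u u'" "same_shape v v'" shows "same_shape (u @ v) (u' @ v')"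
proof (cases "u = []")
  case True
  then have "u' = []" using assms(1) by (simp add: same_shape_def)
  with True assms(2) show ?thesis by simp
next
  case False
  then have u: "u' \<noteq> []" "alph u = alph u'" "fst (hd u) = fst (hd u')" "fst (last u) = fst (last u')"
    using assms(1) by (simp_all add: same_shape_def)
  show ?thesis
  proof (cases "v = []")
    case True
    then have "v' = []" using assms(2) by (simp add: same_shape_def)
    with True assms(1) show ?thesis by simp
  next
    case v: False
    then have "v' \<noteq> []" "alph v = alph v'" "fst (last v) = fst (last v')"
      using assms(2) by (simp_all add: same_shape_def)
    with u v False show ?thesis by (simp add: same_shape_def)
  qed
qed

lemma same_shape_word_inv: "same_shape u v \<Longrightarrow> same_shape (word_inv G u) (word_inv G v)"
  by (cases "u = []"; cases "v = []") (simp_all add: same_shape_def hd_word_inv last_word_inv)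

lemma valid_reduced_shape_append:
  assumes "valid_reduced G P (u @ v)" "same_shape u u'" "same_shape v v'"
    "valid_reduced G P u'" "valid_reduced G P v'"
  shows "valid_reduced G P (u' @ v')"
proof (cases "u = [] \<or> v = []")
  case True
  then have "u' = [] \<or> v' = []" using assms(2,3) by (auto simp: same_shape_def)
  then show ?thesis using assms(4,5) by auto
next
  case False
  then have "fst (last u) = fst (last u')" "fst (hd v) = fst (hd v')"
    using assms(2,3) by (simp_all add: same_shape_def)
  then show ?thesis using assms(1,4,5) False by (simp add: valid_reduced_append)
qed

lemma in_constr_same_shape:
  assumes "same_shape u v" shows "in_constr u C \<longleftrightarrow> in_constr v C"
proof (cases "u = []")
  case True
  then have "v = []" using assms by (simp add: same_shape_def)
  with True show ?thesis by simp
next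
  case False
  then show ?thesis using assms by (simp add: same_shape_def in_constr_def)
qed

section \<open>Reduced words as normal forms, with reduction as multiplication\<close>

locale free_product =
  fixes G :: "nat \<Rightarrow> nat monoid" and P :: "nat set" and \<Gamma> :: "nat \<Rightarrow> nat set"
  assumes finite_P: "finite P"
    and comm_group_G: "\<alpha> \<in> P \<Longrightarrow> comm_group (G \<alpha>)"
    and finite_\<Gamma>: "\<alpha> \<in> P \<Longrightarrow> finite (\<Gamma> \<alpha>)"
    and \<Gamma>_sub: "\<alpha> \<in> P \<Longrightarrow> \<Gamma> \<alpha> \<subseteq> carrier (G \<alpha>) - {\<one>\<^bsub>G \<alpha>\<^esub>}"
    and \<Gamma>_inv: "\<alpha> \<in> P \<Longrightarrow> g \<in> \<Gamma> \<alpha> \<Longrightarrow> inv\<^bsub>G \<alpha>\<^esub> g \<in> \<Gamma> \<alpha>"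
    and \<Gamma>_gen: "\<alpha> \<in> P \<Longrightarrow> generate (G \<alpha>) (\<Gamma> \<alpha>) = carrier (G \<alpha>)"
begin

abbreviation letter where "letter a \<equiv> is_letter G P a"
abbreviation vred where "vred w \<equiv> valid_reduced G P w"
abbreviation winv where "winv w \<equiv> word_inv G w"
abbreviation linv where "linv a \<equiv> letter_inv G a"

lemma group_G: "\<alpha> \<in> P \<Longrightarrow> group (G \<alpha>)"
  using comm_group_G comm_group.axioms(2) by blast

lemma vred_letters: "vred w \<Longrightarrow> a \<in> set w \<Longrightarrow> letter a"
  by (simp add: valid_reduced_def)

lemma letter_linv [simp]: "letter a \<Longrightarrow> letter (linv a)"
proof -
  assume a: "letter a"
  then interpret group "G (fst a)" using group_G is_letter_def by blast
  show ?thesis using a by (auto simp: is_letter_def letter_inv_def inv_eq_1_iff)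
qed

lemma linv_linv [simp]: "letter a \<Longrightarrow> linv (linv a) = a"
proof -
  assume a: "letter a"
  then interpret group "G (fst a)" using group_G is_letter_def by blast
  show ?thesis using a by (auto simp: is_letter_def letter_inv_def)
qed

lemma letters_winv: "\<forall>a\<in>set w. letter a \<Longrightarrow> \<forall>a\<in>set (winv w). letter a"
  by (auto simp: word_inv_eq)

lemma winv_winv: "\<forall>a\<in>set w. letter a \<Longrightarrow> winv (winv w) = w"
  by (induction w) (auto simp: word_inv_Cons)

lemma vred_winv [simp]: "vred w \<Longrightarrow> vred (winv w)"
  using letters_winv[of w] by (simp add: valid_reduced_def)

lemma winv_winv_vred [simp]: "vred w \<Longrightarrow> winv (winv w) = w"
  by (intro winv_winv) (simp add: valid_reduced_def)

lemma vred_cons_red: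
  assumes "letter a" "vred w" shows "vred (cons_red G a w)"
proof (cases w)
  case (Cons b v)
  have "fst a \<in> P" using assms(1) by (simp add: is_letter_def)
  then interpret group "G (fst a)" by (rule group_G)
  have "snd a \<otimes>\<^bsub>G (fst a)\<^esub> snd b \<in> carrier (G (fst a))" if "fst a = fst b"
    using that assms Cons by (intro m_closed) (auto simp: valid_reduced_Cons is_letter_def)
  then show ?thesis using assms Cons by (auto simp: valid_reduced_Cons is_letter_def)
qed (use assms in \<open>simp add: valid_reduced_Cons\<close>)

lemma vred_foldr:
  "\<forall>a\<in>set u. letter a \<Longrightarrow> vred z \<Longrightarrow> vred (foldr (cons_red G) u z)"
  by (induction u) (auto intro: vred_cons_red)

lemma vred_red: "\<forall>a\<in>set w. letter a \<Longrightarrow> vred (red G w)"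
  unfolding red_def by (rule vred_foldr) auto

text \<open>Prefixing a letter acts on reduced words like left multiplication, as in van der
  Waerden's normal form argument. If \<open>w\<close> starts in the same factor, the claim is
  associativity there; the cases record which partial products are trivial.\<close>

lemma cons_red_mult:
  assumes "letter a" "letter b" "fst a = fst b" "vred w"
  shows "cons_red G a (cons_red G b w) =
    (if snd a \<otimes>\<^bsub>G (fst a)\<^esub> snd b = \<one>\<^bsub>G (fst a)\<^esub> then w
     else cons_red G (fst a, snd a \<otimes>\<^bsub>G (fst a)\<^esub> snd b) w)"
proof (cases w)
  case Nil
  then show ?thesis using assms by simp
next
  case (Cons c v)
  define H where "H = G (fst a)"
  have P: "fst a \<in> P" using assms(1) by (simp add: is_letter_def)
  then interpret group H unfolding H_def by (rule group_G)
  obtain \<alpha> x where a: "a = (\<alpha>, x)" by (cases a)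
  obtain y where b: "b = (\<alpha>, y)" using assms(3) a by (cases b) auto
  have xy: "x \<in> carrier H" "y \<in> carrier H" "x \<noteq> \<one>\<^bsub>H\<^esub>" "y \<noteq> \<one>\<^bsub>H\<^esub>" and H: "G \<alpha> = H"
    using assms a b by (auto simp: is_letter_def H_def)
  show ?thesis
  proof (cases "fst c = \<alpha>")
    case False
    then show ?thesis using assms Cons a b H by auto
  next
    case True
    then obtain z where c: "c = (\<alpha>, z)" by (cases c) auto
    have z: "z \<in> carrier H" "z \<noteq> \<one>\<^bsub>H\<^esub>" and v: "v \<noteq> [] \<Longrightarrow> fst (hd v) \<noteq> \<alpha>"
      using assms(4) Cons c H by (auto simp: valid_reduced_Cons is_letter_def)
    have v1: "cons_red G (\<alpha>, t) v = (\<alpha>, t) # v" for t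
      using v by (cases v) auto
    have assoc: "(x \<otimes>\<^bsub>H\<^esub> y) \<otimes>\<^bsub>H\<^esub> z = x \<otimes>\<^bsub>H\<^esub> (y \<otimes>\<^bsub>H\<^esub> z)" using xy z by (simp add: m_assoc)
    have 1: "x = z" if "x \<otimes>\<^bsub>H\<^esub> y = \<one>\<^bsub>H\<^esub>" "y \<otimes>\<^bsub>H\<^esub> z = \<one>\<^bsub>H\<^esub>"
      using assoc that xy z by simp
    have 2: "x \<otimes>\<^bsub>H\<^esub> (y \<otimes>\<^bsub>H\<^esub> z) = z" if "x \<otimes>\<^bsub>H\<^esub> y = \<one>\<^bsub>H\<^esub>"
      using assoc[symmetric] that xy z by simp
    show ?thesis
    proof (cases "x \<otimes>\<^bsub>H\<^esub> y = \<one>\<^bsub>H\<^esub>")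
      case True
      then show ?thesis
        using 1[OF True] 2[OF True] v1 z(2)
        by (cases "y \<otimes>\<^bsub>H\<^esub> z = \<one>\<^bsub>H\<^esub>") (simp_all add: Cons a b c H)
    next
      case False
      then show ?thesis
        using assoc v1 xy by (cases "y \<otimes>\<^bsub>H\<^esub> z = \<one>\<^bsub>H\<^esub>") (simp_all add: Cons a b c H)
    qed
  qed
qed

text \<open>The action of a word on reduced words factors through its reduction; this step lets
  \<open>red\<close> be applied inside a left factor.\<close>

lemma foldr_cons_red:
  assumes "letter a" "vred w" "vred z"
  shows "foldr (cons_red G) (cons_red G a w) z = cons_red G a (foldr (cons_red G) w z)"
proof (cases w)
  case (Cons b v)
  have l: "letter b" "vred v" using assms Cons by (auto simp: valid_reduced_Cons)
  have v: "vred (foldr (cons_red G) v z)"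
    using l assms by (intro vred_foldr) (auto simp: valid_reduced_def)
  show ?thesis using cons_red_mult[OF assms(1) l(1) _ v] Cons by auto
qed simp

lemma red_vred [simp]: "vred w \<Longrightarrow> red G w = w"
proof (induction w)
  case (Cons a w)
  then show ?case by (cases w) (auto simp: red_Cons valid_reduced_Cons)
qed simp

lemma red_red_right [simp]: "\<forall>a\<in>set v. letter a \<Longrightarrow> red G (u @ red G v) = red G (u @ v)"
  by (simp add: red_append vred_red)

lemma red_red_left [simp]:
  "\<forall>a\<in>set u. letter a \<Longrightarrow> \<forall>a\<in>set v. letter a \<Longrightarrow> red G (red G u @ v) = red G (u @ v)"
proof (induction u)
  case (Cons a u)
  then show ?case
    by (simp add: red_Cons red_append foldr_cons_red vred_red)
qed simp

lemma red_cong_mid: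
  assumes "\<forall>a\<in>set (u @ v @ v' @ w). letter a" "red G v = red G v'"
  shows "red G (u @ v @ w) = red G (u @ v' @ w)"
proof -
  have "red G (v @ w) = red G (v' @ w)"
    using assms red_red_left[of v w] red_red_left[of v' w] by simp
  then show ?thesis by (simp add: red_append)
qed

lemma red_letter_linv: "letter a \<Longrightarrow> red G [a, linv a] = []"
proof -
  assume a: "letter a"
  then interpret group "G (fst a)" using group_G is_letter_def by blast
  show ?thesis using a by (auto simp: is_letter_def letter_inv_def red_Cons)
qed

lemma red_winv_cancel: "\<forall>a\<in>set w. letter a \<Longrightarrow> red G (w @ winv w) = []"
proof (induction w)
  case (Cons a w)
  have l: "\<forall>x\<in>set (winv w). letter x" using Cons.prems by (intro letters_winv) auto
  have "red G ((a # w) @ winv (a # w)) = red G ([a] @ (w @ winv w) @ [linv a])"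
    by (simp add: word_inv_Cons)
  also have "\<dots> = red G ([a] @ [] @ [linv a])"
    using Cons l by (intro red_cong_mid) auto
  finally show ?case using red_letter_linv Cons.prems by simp
qed simp

text \<open>Uniqueness of inverses: the trivial \<open>?r @ winv ?r\<close> is appended to
  \<open>winv w\<close>, then \<open>?r\<close> is traded for \<open>w\<close>, which cancels
  against \<open>winv w\<close>.\<close>

lemma red_winv:
  assumes "\<forall>a\<in>set w. letter a"
  shows "red G (winv w) = winv (red G w)"
proof -
  let ?r = "red G w"
  have r: "\<forall>a\<in>set ?r. letter a" using vred_red[OF assms] by (auto simp: valid_reduced_def)
  note l = assms r letters_winv[OF assms] letters_winv[OF r]
  have "red G (winv w) = red G (winv w @ (?r @ winv ?r) @ [])"
    using red_cong_mid[of "winv w" "?r @ winv ?r" "[]" "[]", OF _ trans[OF red_winv_cancel[OF r] red_Nil[symmetric]]] l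
    by (simp add: ball_Un del: red_red_left red_red_right)
  also have "\<dots> = red G (winv w @ ?r @ winv ?r)" by simp
  also have "\<dots> = red G (winv w @ w @ winv ?r)"
    using l by (intro red_cong_mid) (auto simp: vred_red)
  also have "\<dots> = red G ([] @ (winv w @ winv (winv w)) @ winv ?r)"
    using winv_winv[OF assms] by simp
  also have "\<dots> = red G ([] @ [] @ winv ?r)"
    using l winv_winv[OF assms] red_winv_cancel[OF l(3)] by (intro red_cong_mid) auto
  also have "\<dots> = winv ?r" using vred_winv[OF vred_red[OF assms]] by simp
  finally show ?thesis .
qed

end

subsection \<open>Lengths over the generators and products of two reduced words\<close>

context free_product
begin

lemma Gam_letter: "a \<in> Gam P \<Gamma> \<Longrightarrow> letter a"
  using \<Gamma>_sub by (auto simp: Gam_def is_letter_def)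

lemma Gam_linv: "a \<in> Gam P \<Gamma> \<Longrightarrow> linv a \<in> Gam P \<Gamma>"
  using \<Gamma>_inv by (auto simp: Gam_def letter_inv_def)

lemma finite_Gam: "finite (Gam P \<Gamma>)"
proof -
  have "Gam P \<Gamma> = Sigma P \<Gamma>" by (auto simp: Gam_def)
  then show ?thesis using finite_P finite_\<Gamma> by simp
qed

lemma Gam_letters: "set ws \<subseteq> Gam P \<Gamma> \<Longrightarrow> \<forall>a\<in>set ws. letter a"
  using Gam_letter by auto

text \<open>The identity is not a letter and becomes the empty word, so that computations in one
  factor carry over to words without case splits.\<close>

definition elt :: "nat \<Rightarrow> nat \<Rightarrow> word" where
  "elt \<alpha> g = (if g = \<one>\<^bsub>G \<alpha>\<^esub> then [] else [(\<alpha>, g)])"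

lemma elt_letter: "letter a \<Longrightarrow> elt (fst a) (snd a) = [a]"
  by (simp add: elt_def is_letter_def)

lemma red_elt_mult:
  assumes "\<alpha> \<in> P" "g \<in> carrier (G \<alpha>)" "h \<in> carrier (G \<alpha>)"
  shows "red G (elt \<alpha> g @ elt \<alpha> h) = elt \<alpha> (g \<otimes>\<^bsub>G \<alpha>\<^esub> h)"
proof -
  interpret group "G \<alpha>" using assms(1) by (rule group_G)
  show ?thesis using assms by (simp add: elt_def red_Cons)
qed

lemma ex_gamma_word_elt:
  assumes "\<alpha> \<in> P" "g \<in> carrier (G \<alpha>)"
  shows "\<exists>ws. set ws \<subseteq> Gam P \<Gamma> \<and> red G ws = elt \<alpha> g"
proof -
  interpret group "G \<alpha>" using assms(1) by (rule group_G)
  have gen: "\<exists>ws. set ws \<subseteq> Gam P \<Gamma> \<and> red G ws = elt \<alpha> h" if "h \<in> \<Gamma> \<alpha>" for h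
  proof (intro exI conjI)
    show "set [(\<alpha>, h)] \<subseteq> Gam P \<Gamma>" using that assms(1) by (simp add: Gam_def)
    show "red G [(\<alpha>, h)] = elt \<alpha> h"
      using that \<Gamma>_sub[OF assms(1)] by (auto simp: elt_def red_Cons)
  qed
  have "g \<in> generate (G \<alpha>) (\<Gamma> \<alpha>)" using assms \<Gamma>_gen by simp
  then show ?thesis
  proof induction
    case one
    then show ?case by (intro exI[of _ "[]"]) (simp add: elt_def)
  next
    case (incl h)
    then show ?case by (rule gen)
  next
    case (inv h)
    then show ?case using \<Gamma>_inv[OF assms(1)] by (intro gen)
  next
    case (eng g h)
    then obtain u v where u: "set u \<subseteq> Gam P \<Gamma>" "red G u = elt \<alpha> g"
      and v: "set v \<subseteq> Gam P \<Gamma>" "red G v = elt \<alpha> h" by blast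
    have gh: "g \<in> carrier (G \<alpha>)" "h \<in> carrier (G \<alpha>)"
      using eng.hyps \<Gamma>_gen[OF assms(1)] by auto
    have "red G (u @ v) = red G (red G u @ red G v)"
      using Gam_letters[OF u(1)] Gam_letters[OF v(1)] vred_red[of v]
      by (subst red_red_left) (auto simp: valid_reduced_def)
    also have "\<dots> = elt \<alpha> (g \<otimes>\<^bsub>G \<alpha>\<^esub> h)"
      using u v red_elt_mult[OF assms(1) gh] by simp
    finally show ?case using u(1) v(1) by (intro exI[of _ "u @ v"]) simp
  qed
qed

lemma red_append_red:
  assumes "\<forall>a\<in>set u. letter a" "\<forall>a\<in>set v. letter a"
  shows "red G (red G u @ red G v) = red G (u @ v)"
  using assms by simp

lemma ex_gamma_word:
  assumes "vred f" shows "\<exists>ws. set ws \<subseteq> Gam P \<Gamma> \<and> red G ws = f"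
  using assms
proof (induction f)
  case Nil
  show ?case by (intro exI[of _ "[]"]) simp
next
  case (Cons a f)
  then obtain v where v: "set v \<subseteq> Gam P \<Gamma>" "red G v = f"
    by (auto simp: valid_reduced_Cons)
  have a: "letter a" using Cons.prems by (simp add: valid_reduced_Cons)
  then obtain u where u: "set u \<subseteq> Gam P \<Gamma>" "red G u = [a]"
    using ex_gamma_word_elt[of "fst a" "snd a"] elt_letter[of a] by (auto simp: is_letter_def)
  have "red G (u @ v) = red G ([a] @ f)"
    using red_append_red[of u v] Gam_letters u v by simp
  then show ?case using u v Cons.prems by (intro exI[of _ "u @ v"]) simp
qed

lemma gamma_len_le: "set ws \<subseteq> Gam P \<Gamma> \<Longrightarrow> gamma_len G P \<Gamma> (red G ws) \<le> length ws"
  unfolding gamma_len_def by (rule Least_le) blast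

lemma gamma_len_attained:
  assumes "vred f"
  shows "\<exists>ws. set ws \<subseteq> Gam P \<Gamma> \<and> length ws = gamma_len G P \<Gamma> f \<and> red G ws = f"
proof -
  have "\<exists>n ws. set ws \<subseteq> Gam P \<Gamma> \<and> length ws = n \<and> red G ws = f"
    using ex_gamma_word[OF assms] by blast
  then show ?thesis unfolding gamma_len_def by (rule LeastI_ex)
qed

lemma gamma_len_append:
  assumes "vred u" "vred v"
  shows "gamma_len G P \<Gamma> (red G (u @ v)) \<le> gamma_len G P \<Gamma> u + gamma_len G P \<Gamma> v"
proof -
  obtain us vs where u: "set us \<subseteq> Gam P \<Gamma>" "length us = gamma_len G P \<Gamma> u" "red G us = u"
    and v: "set vs \<subseteq> Gam P \<Gamma>" "length vs = gamma_len G P \<Gamma> v" "red G vs = v"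
    using gamma_len_attained assms by metis
  have "red G (u @ v) = red G (us @ vs)"
    using red_append_red[of us vs] Gam_letters u v by simp
  then show ?thesis using gamma_len_le[of "us @ vs"] u v by simp
qed

definition lwt :: "letter \<Rightarrow> nat" where
  "lwt a = gamma_len G P \<Gamma> [a]"

definition wt :: "word \<Rightarrow> nat" where
  "wt w = sum_list (map lwt w)"

lemma wt_Nil [simp]: "wt [] = 0" and wt_Cons [simp]: "wt (a # w) = lwt a + wt w"
  and wt_append [simp]: "wt (u @ v) = wt u + wt v"
  by (simp_all add: wt_def)

lemma vred_single [simp]: "vred [a] \<longleftrightarrow> letter a"
  by (simp add: valid_reduced_Cons)

lemma lwt_ge_1:
  assumes "letter a" shows "1 \<le> lwt a"
proof -
  obtain ws where ws: "length ws = lwt a" "red G ws = [a]"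
    using gamma_len_attained[of "[a]"] assms by (auto simp: lwt_def)
  then have "ws \<noteq> []" by auto
  then have "1 \<le> length ws" by (cases ws) auto
  then show ?thesis using ws by simp
qed

lemma lwt_Gam: "a \<in> Gam P \<Gamma> \<Longrightarrow> lwt a \<le> 1"
  using gamma_len_le[of "[a]"] by (simp add: lwt_def red_Cons)

lemma lwt_eq_1:
  assumes "letter a" "lwt a = 1" shows "a \<in> Gam P \<Gamma>"
proof -
  obtain ws where ws: "set ws \<subseteq> Gam P \<Gamma>" "length ws = 1" "red G ws = [a]"
    using gamma_len_attained[of "[a]"] assms by (auto simp: lwt_def)
  then obtain b where "ws = [b]" by (cases ws) auto
  then show ?thesis using ws by (simp add: red_Cons)
qed

lemma length_le_wt: "\<forall>a\<in>set w. letter a \<Longrightarrow> length w \<le> wt w"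
proof (induction w)
  case (Cons a w)
  then show ?case using lwt_ge_1[of a] by simp
qed simp

lemma wt_Gam: "set w \<subseteq> Gam P \<Gamma> \<Longrightarrow> wt w \<le> length w"
proof (induction w)
  case (Cons a w)
  then show ?case using lwt_Gam[of a] by simp
qed simp

lemma wt_cons_red:
  assumes "letter a" "vred w" shows "wt (cons_red G a w) \<le> lwt a + wt w"
proof (cases w)
  case (Cons b v)
  have b: "letter b" using assms Cons by (simp add: valid_reduced_Cons)
  have "lwt (fst a, snd a \<otimes>\<^bsub>G (fst a)\<^esub> snd b) \<le> lwt a + lwt b"
    if "fst a = fst b" "snd a \<otimes>\<^bsub>G (fst a)\<^esub> snd b \<noteq> \<one>\<^bsub>G (fst a)\<^esub>"
    using gamma_len_append[of "[a]" "[b]"] that assms(1) b by (simp add: lwt_def red_Cons)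
  then show ?thesis using Cons by auto
qed simp

lemma wt_red: "\<forall>a\<in>set w. letter a \<Longrightarrow> wt (red G w) \<le> wt w"
proof (induction w)
  case (Cons a w)
  then show ?case using wt_cons_red[of a "red G w"] vred_red[of w] by (simp add: red_Cons)
qed simp

text \<open>For the lower bound, reduction never increases \<open>wt\<close>, and a word over the
  generators has weight at most its length.\<close>

lemma gamma_len_eq_wt:
  assumes "vred w" shows "gamma_len G P \<Gamma> w = wt w"
proof (rule antisym)
  show "gamma_len G P \<Gamma> w \<le> wt w"
    using assms
  proof (induction w)
    case Nil
    show ?case using gamma_len_le[of "[]"] by simp
  next
    case (Cons a w)
    then have "letter a" "vred w" by (auto simp: valid_reduced_Cons)
    then show ?case
      using gamma_len_append[of "[a]" w] Cons red_vred[OF Cons.prems] by (simp add: lwt_def)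
  qed
  obtain ws where ws: "set ws \<subseteq> Gam P \<Gamma>" "length ws = gamma_len G P \<Gamma> w" "red G ws = w"
    using gamma_len_attained assms by blast
  then show "wt w \<le> gamma_len G P \<Gamma> w"
    using wt_red[OF Gam_letters] wt_Gam[of ws] by fastforce
qed

text \<open>\<open>q\<close> cancels against \<open>winv q\<close>, then \<open>ma\<close> meets
  \<open>mb\<close> and merges into \<open>mc\<close>. All three may be empty when the cancellation
  ends between different factors or at the end of a word.\<close>

definition decomp :: "word \<Rightarrow> word \<Rightarrow> word \<Rightarrow> word \<Rightarrow> word \<Rightarrow> word \<Rightarrow> word \<Rightarrow> word \<Rightarrow> bool" where
  "decomp x y p ma q mb r mc \<longleftrightarrow> x = p @ ma @ q \<and> y = winv q @ mb @ r
     \<and> red G (x @ y) = p @ mc @ r \<and> red G (ma @ mb) = mc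
     \<and> length ma \<le> 1 \<and> length mb \<le> 1 \<and> length mc \<le> 1"

text \<open>Peel the last letter of \<open>x\<close>: compared with the first letter of
  \<open>y\<close> it lies in another factor, merges, or cancels. Only in the last case does the
  recursion continue, and the letter joins \<open>q\<close>.\<close>

lemma ex_decomp:
  assumes "vred x" "vred y"
  shows "\<exists>p ma q mb r mc. decomp x y p ma q mb r mc"
  using assms
proof (induction x arbitrary: y rule: rev_induct)
  case Nil
  then have "decomp [] y [] [] [] [] y []" by (simp add: decomp_def)
  then show ?case by blast
next
  case (snoc a x)
  have x: "vred x" "letter a" using snoc.prems by (auto simp: valid_reduced_append)
  have lx: "\<forall>c\<in>set x. letter c" using x by (simp add: valid_reduced_def)
  show ?case
  proof (cases y)
    case Nil
    then have "decomp (x @ [a]) y (x @ [a]) [] [] [] [] []"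
      using snoc.prems by (simp add: decomp_def)
    then show ?thesis by blast
  next
    case (Cons b v)
    have v: "vred v" "letter b" using snoc.prems Cons by (auto simp: valid_reduced_Cons)
    have lv: "\<forall>c\<in>set v. letter c" using v by (simp add: valid_reduced_def)
    show ?thesis
    proof (cases "fst a = fst b")
      case False
      then have "vred ((x @ [a]) @ y)"
        using snoc.prems Cons unfolding valid_reduced_append[of G P "x @ [a]" y] by simp
      then have "red G ((x @ [a]) @ y) = (x @ [a]) @ y" by (rule red_vred)
      then have "decomp (x @ [a]) y (x @ [a]) [] [] [] y []"
        by (simp add: decomp_def)
      then show ?thesis by blast
    next
      case True
      interpret group "G (fst a)" using x(2) group_G by (simp add: is_letter_def)
      let ?ab = "snd a \<otimes>\<^bsub>G (fst a)\<^esub> snd b"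
      have ab: "snd a \<in> carrier (G (fst a))" "snd b \<in> carrier (G (fst a))"
        using x(2) v(2) True by (simp_all add: is_letter_def)
      show ?thesis
      proof (cases "?ab = \<one>\<^bsub>G (fst a)\<^esub>")
        case False
        let ?c = "(fst a, ?ab)"
        have c: "letter ?c" using x(2) ab False by (simp add: is_letter_def)
        have r: "red G [a, b] = [?c]" using True False by (simp add: red_Cons)
        have vr: "vred (x @ [?c] @ v)"
          using snoc.prems Cons True c by (auto simp: valid_reduced_append valid_reduced_Cons)
        have "red G (x @ [a, b] @ v) = red G (x @ [?c] @ v)"
          using x v lx lv c r by (intro red_cong_mid) auto
        then have "decomp (x @ [a]) y x [a] [] [b] v [?c]"
          using Cons r red_vred[OF vr] by (simp add: decomp_def)
        then show ?thesis by blast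
      next
        case one: True
        have "snd b = inv\<^bsub>G (fst a)\<^esub> snd a"
          using inv_equality[of "snd b" "snd a"] inv_comm[of "snd a" "snd b"] one ab by simp
        then have b: "b = linv a" using True by (simp add: letter_inv_def prod_eq_iff)
        obtain p ma q mb r mc where d: "decomp x v p ma q mb r mc"
          using snoc.IH[OF x(1) v(1)] by blast
        have "red G (x @ [a, b] @ v) = red G (x @ [] @ v)"
          using x v lx lv red_letter_linv[OF x(2)] b by (intro red_cong_mid) auto
        also have "\<dots> = p @ mc @ r"
          using d unfolding decomp_def append_Nil by blast
        finally have "red G ((x @ [a]) @ y) = p @ mc @ r" using Cons by simp
        then have "decomp (x @ [a]) y p ma (q @ [a]) mb r mc"
          using d Cons b unfolding decomp_def by (simp add: word_inv_Cons)
        then show ?thesis by blast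
      qed
    qed
  qed
qed

text \<open>For use after a replacement: images of this form still multiply correctly, whatever has
  become of \<open>p\<close>, \<open>q\<close> and \<open>r\<close>, provided that the three words
  are reduced.\<close>

lemma decomp_red:
  assumes "x = p @ ma @ q" "y = winv q @ mb @ r" "z = p @ mc @ r" "red G (ma @ mb) = mc"
    and "vred x" "vred y" "vred z"
  shows "red G (x @ y) = z"
proof -
  have l: "\<forall>a\<in>set p. letter a" "\<forall>a\<in>set ma. letter a" "\<forall>a\<in>set q. letter a" "\<forall>a\<in>set mb. letter a"
    "\<forall>a\<in>set r. letter a" "\<forall>a\<in>set mc. letter a"
    using assms by (auto simp: valid_reduced_def)
  have "red G ((p @ ma) @ (q @ winv q) @ (mb @ r)) = red G ((p @ ma) @ [] @ (mb @ r))"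
    using l letters_winv[OF l(3)] red_winv_cancel[OF l(3)]
    by (intro red_cong_mid) auto
  also have "\<dots> = red G (p @ (ma @ mb) @ r)" by simp
  also have "\<dots> = red G (p @ mc @ r)"
  proof (rule red_cong_mid)
    have "vred mc" using assms(3,7) by (simp add: valid_reduced_append)
    then show "red G (ma @ mb) = red G mc" using assms(4) by simp
  qed (use l in auto)
  also have "\<dots> = z" using assms(3,7) by simp
  finally show ?thesis using assms(1,2) by simp
qed

end

subsection \<open>Transformations of a minimal solution\<close>

definition flip :: "var \<Rightarrow> var" where
  "flip x = (fst x, \<not> snd x)"

text \<open>An equation \<open>L = R\<close> is rewritten as \<open>L R\<^sup>-\<^sup>1 = 1\<close>, so that its truth is
  the emptiness of one reduced word, which replacements of nonempty words by nonempty words respect.\<close>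
definition eqword :: "var list \<Rightarrow> var list \<Rightarrow> var list" where
  "eqword L R = L @ rev (map flip R)"

text \<open>Starting from the empty prefix makes every prefix value either empty or the product of
  the preceding pair.\<close>

definition word_steps :: "(nat \<Rightarrow> nat monoid) \<Rightarrow> (nat \<Rightarrow> word) \<Rightarrow> var list \<Rightarrow> (word \<times> word) set" where
  "word_steps G \<sigma> E = (\<lambda>i. (eval_vars G \<sigma> (take i E), sig_hat G \<sigma> (E ! i))) ` {..<length E}"

fun steps :: "(nat \<Rightarrow> nat monoid) \<Rightarrow> (nat \<Rightarrow> word) \<Rightarrow> bform \<Rightarrow> (word \<times> word) set" where
  "steps G \<sigma> (Eq L R) = word_steps G \<sigma> (eqword L R)"
| "steps G \<sigma> (InC X C) = {}"
| "steps G \<sigma> (Neg f) = steps G \<sigma> f"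
| "steps G \<sigma> (Conj f g) = steps G \<sigma> f \<union> steps G \<sigma> g"
| "steps G \<sigma> (Disj f g) = steps G \<sigma> f \<union> steps G \<sigma> g"

lemma length_eqword: "length (eqword L R) = length (L @ R)"
  by (simp add: eqword_def)

lemma finite_steps: "finite (steps G \<sigma> \<Phi>)"
  by (induction \<Phi>) (auto simp: word_steps_def)

lemma card_steps: "card (steps G \<sigma> \<Phi>) \<le> eqsize \<Phi>"
proof (induction \<Phi>)
  case (Eq L R)
  then show ?case
    using card_image_le[of "{..<length (eqword L R)}"]
    by (simp add: word_steps_def length_eqword del: length_append)
next
  case (Conj f g)
  then show ?case using card_Un_le[of "steps G \<sigma> f" "steps G \<sigma> g"] by simp
next
  case (Disj f g)
  then show ?case using card_Un_le[of "steps G \<sigma> f" "steps G \<sigma> g"] by simp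
qed auto

lemma card_eqvars: "finite (eqvars \<Phi>) \<and> card (eqvars \<Phi>) \<le> eqsize \<Phi>"
proof (induction \<Phi>)
  case (Eq L R)
  then show ?case
    using card_image_le[of "set (L @ R)" fst] card_length[of "L @ R"]
    by (simp del: set_append length_append add: order_trans[of "card (fst ` set (L @ R))"])
next
  case (Conj f g)
  then show ?case using card_Un_le[of "eqvars f" "eqvars g"] by simp
next
  case (Disj f g)
  then show ?case using card_Un_le[of "eqvars f" "eqvars g"] by simp
qed auto

context free_product
begin

lemma concat_sig_flip:
  assumes "\<forall>x\<in>set R. vred (\<sigma> (fst x))"
  shows "concat (map (sig_hat G \<sigma>) (rev (map flip R))) = winv (concat (map (sig_hat G \<sigma>) R))"
  using assms
proof (induction R)
  case (Cons x R)
  have "sig_hat G \<sigma> (flip x) = winv (sig_hat G \<sigma> x)"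
    using Cons.prems by (simp add: sig_hat_def flip_def)
  then show ?case using Cons by simp
qed simp

lemma vred_sig_hat: "vred (\<sigma> (fst x)) \<Longrightarrow> vred (sig_hat G \<sigma> x)"
  by (simp add: sig_hat_def)

lemma letters_concat_sig:
  assumes "\<forall>x\<in>set L. vred (\<sigma> (fst x))"
  shows "\<forall>a\<in>set (concat (map (sig_hat G \<sigma>) L)). letter a"
  using assms vred_sig_hat vred_letters by fastforce

lemma holds_eqword:
  assumes "\<forall>x\<in>set (L @ R). vred (\<sigma> (fst x))"
  shows "holds G \<sigma> (Eq L R) \<longleftrightarrow> eval_vars G \<sigma> (eqword L R) = []"
proof -
  define l r where "l = concat (map (sig_hat G \<sigma>) L)" and "r = concat (map (sig_hat G \<sigma>) R)"
  have l: "\<forall>a\<in>set l. letter a" and r: "\<forall>a\<in>set r. letter a"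
    using letters_concat_sig[of L \<sigma>] letters_concat_sig[of R \<sigma>] assms unfolding l_def r_def by simp_all
  note r' = letters_winv[OF r]
  have e: "eval_vars G \<sigma> (eqword L R) = red G (l @ winv r)"
    using concat_sig_flip[of R \<sigma>] assms by (simp add: eval_vars_def eqword_def l_def r_def)
  have "red G l = red G r \<longleftrightarrow> red G (l @ winv r) = []"
  proof
    assume "red G l = red G r"
    then have "red G ([] @ l @ winv r) = red G ([] @ r @ winv r)"
      using l r r' by (intro red_cong_mid) auto
    then show "red G (l @ winv r) = []" using red_winv_cancel[OF r] by simp
  next
    assume a: "red G (l @ winv r) = []"
    have "red G (winv r @ r) = []" using red_winv_cancel[OF r'] winv_winv[OF r] by simp
    then have "red G (l @ (winv r @ r) @ []) = red G (l @ [] @ [])"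
      using l r r' by (intro red_cong_mid) auto
    moreover have "red G ([] @ (l @ winv r) @ r) = red G ([] @ [] @ r)"
      using l r r' a by (intro red_cong_mid) auto
    ultimately show "red G l = red G r" by simp
  qed
  then show ?thesis using e by (simp add: eval_vars_def l_def r_def)
qed

lemma eval_vars_snoc:
  assumes "\<forall>x\<in>set (L @ [y]). vred (\<sigma> (fst x))"
  shows "eval_vars G \<sigma> (L @ [y]) = red G (eval_vars G \<sigma> L @ sig_hat G \<sigma> y)"
  using assms letters_concat_sig[of L \<sigma>] letters_concat_sig[of "[y]" \<sigma>]
  by (simp add: eval_vars_def)

lemma eval_vars_map:
  assumes "\<forall>x\<in>set E. vred (\<sigma> (fst x)) \<and> vred (\<tau> (fst x)) \<and> sig_hat G \<tau> x = F (sig_hat G \<sigma> x)"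
    and "\<And>x y. (x, y) \<in> word_steps G \<sigma> E \<Longrightarrow> red G (F x @ F y) = F (red G (x @ y))"
    and "F [] = []" "i \<le> length E"
  shows "eval_vars G \<tau> (take i E) = F (eval_vars G \<sigma> (take i E))"
  using assms(4)
proof (induction i)
  case 0
  then show ?case using assms(3) by (simp add: eval_vars_def)
next
  case (Suc i)
  then have i: "i < length E" by simp
  have v: "\<forall>x\<in>set (take i E @ [E ! i]). vred (\<sigma> (fst x)) \<and> vred (\<tau> (fst x))"
    using assms(1) i by (auto dest: in_set_takeD)
  have "eval_vars G \<tau> (take (Suc i) E) = red G (eval_vars G \<tau> (take i E) @ sig_hat G \<tau> (E ! i))"
    using v eval_vars_snoc i by (simp add: take_Suc_conv_app_nth)
  also have "\<dots> = red G (F (eval_vars G \<sigma> (take i E)) @ F (sig_hat G \<sigma> (E ! i)))"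
    using Suc i assms(1) by simp
  also have "\<dots> = F (red G (eval_vars G \<sigma> (take i E) @ sig_hat G \<sigma> (E ! i)))"
    using i by (intro assms(2)) (auto simp: word_steps_def)
  also have "\<dots> = F (eval_vars G \<sigma> (take (Suc i) E))"
    using v eval_vars_snoc i by (simp add: take_Suc_conv_app_nth)
  finally show ?case .
qed

lemma fst_flip [simp]: "fst (flip x) = fst x"
  by (simp add: flip_def)

lemma eqword_vars: "fst ` set (eqword L R) = fst ` set (L @ R)"
  by (auto simp: eqword_def image_Un image_image)

text \<open>Compatibility of \<open>F\<close> is asked only for the products in
  \<open>steps\<close>. Because of \<open>Neg\<close> truth must be preserved in both directions,
  which for equations comes from preserving emptiness of the last product.\<close>

lemma holds_map:
  assumes "\<And>X. X \<in> eqvars \<Phi> \<union> cvars \<Phi> \<Longrightarrow> vred (\<sigma> X) \<and> vred (\<tau> X) \<and> same_shape (\<sigma> X) (\<tau> X)"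
    and "\<And>x. fst x \<in> eqvars \<Phi> \<Longrightarrow> sig_hat G \<tau> x = F (sig_hat G \<sigma> x)"
    and "\<And>x y. (x, y) \<in> steps G \<sigma> \<Phi> \<Longrightarrow> red G (F x @ F y) = F (red G (x @ y))"
    and "\<And>x y. (x, y) \<in> steps G \<sigma> \<Phi> \<Longrightarrow> F (red G (x @ y)) = [] \<longleftrightarrow> red G (x @ y) = []"
    and "F [] = []"
  shows "holds G \<tau> \<Phi> \<longleftrightarrow> holds G \<sigma> \<Phi>"
  using assms
proof (induction \<Phi>)
  case (Eq L R)
  let ?E = "eqword L R"
  have in_eq: "fst x \<in> eqvars (Eq L R)" if "x \<in> set ?E" for x
    using that eqword_vars[of L R] by (metis eqvars.simps(1) imageI)
  have v: "\<forall>x\<in>set ?E. vred (\<sigma> (fst x)) \<and> vred (\<tau> (fst x)) \<and> sig_hat G \<tau> x = F (sig_hat G \<sigma> x)"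
    using in_eq Eq.prems(1,2) by blast
  have "eval_vars G \<tau> (take (length ?E) ?E) = F (eval_vars G \<sigma> (take (length ?E) ?E))"
    using v Eq.prems(3,5) by (intro eval_vars_map) auto
  then have e: "eval_vars G \<tau> ?E = F (eval_vars G \<sigma> ?E)" by simp
  have "F (eval_vars G \<sigma> ?E) = [] \<longleftrightarrow> eval_vars G \<sigma> ?E = []"
  proof (cases "?E = []")
    \<comment> \<open>An empty chain has no last step to which the assumption on emptiness could be
      applied.\<close>
    case True
    then show ?thesis using Eq.prems(5) by (simp add: eval_vars_def)
  next
    case False
    define i where "i = length ?E - 1"
    have i: "i < length ?E" using False by (simp add: i_def)
    then have i2: "?E = take i ?E @ [?E ! i]"
      using take_Suc_conv_app_nth[OF i] by (simp add: i_def)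
    note i = i i2
    have "\<forall>x\<in>set (take i ?E @ [?E ! i]). vred (\<sigma> (fst x))" using v i(2) by auto
    then have "eval_vars G \<sigma> ?E = red G (eval_vars G \<sigma> (take i ?E) @ sig_hat G \<sigma> (?E ! i))"
      using eval_vars_snoc i(2) by metis
    moreover have "(eval_vars G \<sigma> (take i ?E), sig_hat G \<sigma> (?E ! i)) \<in> steps G \<sigma> (Eq L R)"
      using i(1) by (auto simp: word_steps_def)
    ultimately show ?thesis using Eq.prems(4) by simp
  qed
  moreover have "\<forall>x\<in>set (L @ R). vred (\<sigma> (fst x))" "\<forall>x\<in>set (L @ R). vred (\<tau> (fst x))"
    using Eq.prems(1) by auto
  ultimately show ?case using holds_eqword[of L R \<sigma>] holds_eqword[of L R \<tau>] e by simp
next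
  case (InC X C)
  then show ?case using in_constr_same_shape[of "\<sigma> X" "\<tau> X"] by simp
next
  case (Conj f g)
  have "holds G \<tau> f \<longleftrightarrow> holds G \<sigma> f" by (rule Conj.IH(1)) (use Conj.prems in auto)
  moreover have "holds G \<tau> g \<longleftrightarrow> holds G \<sigma> g" by (rule Conj.IH(2)) (use Conj.prems in auto)
  ultimately show ?case by simp
next
  case (Disj f g)
  have "holds G \<tau> f \<longleftrightarrow> holds G \<sigma> f" by (rule Disj.IH(1)) (use Disj.prems in auto)
  moreover have "holds G \<tau> g \<longleftrightarrow> holds G \<sigma> g" by (rule Disj.IH(2)) (use Disj.prems in auto)
  ultimately show ?case by simp
qed simp_all

end

section \<open>Minimal solutions and the words along their chains of products\<close>

locale minimal_solution = free_product +
  fixes \<Phi> :: bform and \<sigma> :: "nat \<Rightarrow> word" and \<Omega> :: "nat set"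
  assumes \<Omega>: "\<Omega> = eqvars \<Phi>" and cvars_\<Omega>: "cvars \<Phi> \<subseteq> \<Omega>"
    and solution: "is_solution G P \<Omega> \<Phi> \<sigma>"
    and minimal: "is_solution G P \<Omega> \<Phi> \<tau> \<Longrightarrow> sol_length G P \<Gamma> \<Omega> \<sigma> \<le> sol_length G P \<Gamma> \<Omega> \<tau>"
begin

abbreviation sig where "sig x \<equiv> sig_hat G \<sigma> x"
abbreviation stp where "stp \<equiv> steps G \<sigma> \<Phi>"

lemma finite_\<Omega>: "finite \<Omega>"
  using card_eqvars \<Omega> by blast

lemma vred_\<sigma>: "X \<in> \<Omega> \<Longrightarrow> vred (\<sigma> X)"
  using solution by (simp add: is_solution_def)

lemma vred_sig: "fst x \<in> \<Omega> \<Longrightarrow> vred (sig x)"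
  by (simp add: vred_\<sigma> vred_sig_hat)

definition nodes :: "word set" where
  "nodes = insert [] (sig ` (\<Omega> \<times> UNIV) \<union> (\<lambda>(x, y). red G (x @ y)) ` stp)"

lemma steps_cases:
  assumes "(x, y) \<in> steps G \<sigma> \<Psi>" "eqvars \<Psi> \<subseteq> \<Omega>"
  shows "\<exists>E i. i < length E \<and> fst ` set E \<subseteq> \<Omega> \<and> word_steps G \<sigma> E \<subseteq> steps G \<sigma> \<Psi> \<and> length E \<le> eqsize \<Psi>
    \<and> x = eval_vars G \<sigma> (take i E) \<and> y = sig (E ! i)"
  using assms
proof (induction \<Psi>)
  case (Eq L R)
  then have "fst ` set (eqword L R) \<subseteq> \<Omega>" "length (eqword L R) \<le> eqsize (Eq L R)"
    using eqword_vars[of L R] length_eqword[of L R] by simp_all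
  moreover obtain i where "i < length (eqword L R)" "x = eval_vars G \<sigma> (take i (eqword L R))"
    "y = sig (eqword L R ! i)" using Eq.prems(1) by (auto simp: word_steps_def)
  ultimately show ?case by (intro exI[of _ "eqword L R"] exI[of _ i]) simp
next
  case (Conj f g)
  then consider "(x, y) \<in> steps G \<sigma> f" | "(x, y) \<in> steps G \<sigma> g" by auto
  then show ?case
  proof cases
    case 1
    then obtain E i where "i < length E" "fst ` set E \<subseteq> \<Omega>" "word_steps G \<sigma> E \<subseteq> steps G \<sigma> f"
      "length E \<le> eqsize f" "x = eval_vars G \<sigma> (take i E)" "y = sig (E ! i)"
      using Conj.IH(1) Conj.prems by auto
    then show ?thesis by (intro exI[of _ E] exI[of _ i]) auto
  next
    case 2
    then obtain E i where "i < length E" "fst ` set E \<subseteq> \<Omega>" "word_steps G \<sigma> E \<subseteq> steps G \<sigma> g"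
      "length E \<le> eqsize g" "x = eval_vars G \<sigma> (take i E)" "y = sig (E ! i)"
      using Conj.IH(2) Conj.prems by auto
    then show ?thesis by (intro exI[of _ E] exI[of _ i]) auto
  qed
next
  case (Disj f g)
  then consider "(x, y) \<in> steps G \<sigma> f" | "(x, y) \<in> steps G \<sigma> g" by auto
  then show ?case
  proof cases
    case 1
    then obtain E i where "i < length E" "fst ` set E \<subseteq> \<Omega>" "word_steps G \<sigma> E \<subseteq> steps G \<sigma> f"
      "length E \<le> eqsize f" "x = eval_vars G \<sigma> (take i E)" "y = sig (E ! i)"
      using Disj.IH(1) Disj.prems by auto
    then show ?thesis by (intro exI[of _ E] exI[of _ i]) auto
  next
    case 2
    then obtain E i where "i < length E" "fst ` set E \<subseteq> \<Omega>" "word_steps G \<sigma> E \<subseteq> steps G \<sigma> g"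
      "length E \<le> eqsize g" "x = eval_vars G \<sigma> (take i E)" "y = sig (E ! i)"
      using Disj.IH(2) Disj.prems by auto
    then show ?thesis by (intro exI[of _ E] exI[of _ i]) auto
  qed
qed simp_all

lemma eval_vars_induct:
  assumes "fst ` set E \<subseteq> \<Omega>" "word_steps G \<sigma> E \<subseteq> stp" "i \<le> length E"
    and "Q []" "\<And>x. fst x \<in> \<Omega> \<Longrightarrow> Q (sig x)"
    and "\<And>x y. (x, y) \<in> stp \<Longrightarrow> Q x \<Longrightarrow> Q y \<Longrightarrow> Q (red G (x @ y))"
  shows "Q (eval_vars G \<sigma> (take i E))"
  using assms(3)
proof (induction i)
  case 0
  then show ?case using assms(4) by (simp add: eval_vars_def)
next
  case (Suc i)
  then have i: "i < length E" by simp
  have v: "\<forall>x\<in>set (take i E @ [E ! i]). vred (\<sigma> (fst x))"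
    using assms(1) nth_mem[OF i] vred_\<sigma> by (auto dest!: in_set_takeD)
  have e: "eval_vars G \<sigma> (take (Suc i) E) = red G (eval_vars G \<sigma> (take i E) @ sig (E ! i))"
    using eval_vars_snoc[OF v] i by (simp add: take_Suc_conv_app_nth)
  have "fst (E ! i) \<in> \<Omega>" using assms(1) nth_mem[OF i] by blast
  moreover have "(eval_vars G \<sigma> (take i E), sig (E ! i)) \<in> stp"
    using assms(2) i by (auto simp: word_steps_def)
  ultimately show ?case unfolding e using assms(5,6) Suc by simp
qed

text \<open>Induction along the chains: all words in them arise from the empty word and the
  variables by the recorded products.\<close>

lemma node_induct:
  assumes "Q []" "\<And>x. fst x \<in> \<Omega> \<Longrightarrow> Q (sig x)"
    and "\<And>x y. (x, y) \<in> stp \<Longrightarrow> Q x \<Longrightarrow> Q y \<Longrightarrow> Q (red G (x @ y))"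
  shows "w \<in> nodes \<Longrightarrow> Q w" and "(x, y) \<in> stp \<Longrightarrow> Q x" and "(x, y) \<in> stp \<Longrightarrow> Q y"
proof -
  have *: "Q x \<and> Q y" if step: "(x, y) \<in> stp" for x y
  proof -
    obtain E i where E: "i < length E" "fst ` set E \<subseteq> \<Omega>" "word_steps G \<sigma> E \<subseteq> stp"
      "x = eval_vars G \<sigma> (take i E)" "y = sig (E ! i)"
      using steps_cases[OF step] \<Omega> by auto
    then have "fst (E ! i) \<in> \<Omega>" using nth_mem[OF E(1)] by blast
    with E show ?thesis using eval_vars_induct[OF E(2,3), of i Q] assms by simp
  qed
  then show "(x, y) \<in> stp \<Longrightarrow> Q x" "(x, y) \<in> stp \<Longrightarrow> Q y" by blast+
  show "w \<in> nodes \<Longrightarrow> Q w" using * assms by (auto simp: nodes_def)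
qed

lemma node_sig: "fst x \<in> \<Omega> \<Longrightarrow> sig x \<in> nodes"
  by (cases x) (auto simp: nodes_def)

lemma node_Nil: "[] \<in> nodes"
  by (simp add: nodes_def)

lemma node_red: "(x, y) \<in> stp \<Longrightarrow> red G (x @ y) \<in> nodes"
  by (force simp: nodes_def)

lemma node_step: "(x, y) \<in> stp \<Longrightarrow> x \<in> nodes" "(x, y) \<in> stp \<Longrightarrow> y \<in> nodes"
  by (rule node_induct(2,3)[of "\<lambda>w. w \<in> nodes"]; simp add: node_Nil node_sig node_red)+

lemma vred_node: "w \<in> nodes \<Longrightarrow> vred w"
proof (rule node_induct(1)[of vred])
  show "vred (red G (x @ y))" if "vred x" "vred y" for x y
    using that by (intro vred_red) (auto simp: valid_reduced_def)
qed (auto intro: vred_sig)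

lemma sol_length_wt:
  assumes "\<And>x. fst x \<in> \<Omega> \<Longrightarrow> vred (sig_hat G \<tau> x)"
  shows "sol_length G P \<Gamma> \<Omega> \<tau> = card (\<Omega> \<times> (UNIV :: bool set)) + (\<Sum>x\<in>\<Omega> \<times> UNIV. wt (sig_hat G \<tau> x))"
  unfolding sol_length_def using assms by (auto intro!: sum.cong gamma_len_eq_wt)

text \<open>This is where minimality enters. The images of the variables form a solution, so their
  total weight is at least the original one; as no single weight increases, none can
  decrease.\<close>

lemma wt_not_decreased:
  assumes F_inv: "\<And>X. X \<in> \<Omega> \<Longrightarrow> F (winv (\<sigma> X)) = winv (F (\<sigma> X))"
    and F_shape: "\<And>w. w \<in> nodes \<Longrightarrow> vred (F w) \<and> same_shape w (F w)"
    and F_dec: "\<And>x y. (x, y) \<in> stp \<Longrightarrow> \<exists>p ma q mb r. F x = p @ ma @ q \<and> F y = winv q @ mb @ r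
       \<and> F (red G (x @ y)) = p @ red G (ma @ mb) @ r"
    and F_wt: "\<And>x. fst x \<in> \<Omega> \<Longrightarrow> wt (F (sig x)) \<le> wt (sig x)"
    and x: "fst x \<in> \<Omega>"
  shows "wt (F (sig x)) = wt (sig x)"
proof -
  define \<tau> where "\<tau> = F \<circ> \<sigma>"
  have sig\<tau>: "sig_hat G \<tau> x = F (sig x)" if "fst x \<in> \<Omega>" for x
    using that F_inv by (simp add: \<tau>_def sig_hat_def)
  have node: "\<sigma> X \<in> nodes" if "X \<in> \<Omega>" for X
    using node_sig[of "(X, True)"] that by (simp add: sig_hat_def)
  have vr: "vred (\<tau> X)" "same_shape (\<sigma> X) (\<tau> X)" if "X \<in> \<Omega>" for X
    using F_shape[OF node[OF that]] by (simp_all add: \<tau>_def)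
  have "holds G \<tau> \<Phi> \<longleftrightarrow> holds G \<sigma> \<Phi>"
  proof (rule holds_map)
    show "vred (\<sigma> X) \<and> vred (\<tau> X) \<and> same_shape (\<sigma> X) (\<tau> X)" if "X \<in> eqvars \<Phi> \<union> cvars \<Phi>" for X
      using that cvars_\<Omega> \<Omega> vr vred_\<sigma> by blast
    show "sig_hat G \<tau> x = F (sig x)" if "fst x \<in> eqvars \<Phi>" for x
      using sig\<tau> \<Omega> that by simp
    show "F [] = []" using F_shape[OF node_Nil] by (simp add: same_shape_def)
    fix x y assume xy: "(x, y) \<in> stp"
    obtain p ma q mb r where *: "F x = p @ ma @ q" "F y = winv q @ mb @ r"
       "F (red G (x @ y)) = p @ red G (ma @ mb) @ r" using F_dec[OF xy] by blast
    show "red G (F x @ F y) = F (red G (x @ y))"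
      using F_shape[OF node_step(1)[OF xy]] F_shape[OF node_step(2)[OF xy]] F_shape[OF node_red[OF xy]]
      by (intro decomp_red[OF * refl]) auto
    show "F (red G (x @ y)) = [] \<longleftrightarrow> red G (x @ y) = []"
      using F_shape[OF node_red[OF xy]] by (auto simp: same_shape_def)
  qed
  then have "is_solution G P \<Omega> \<Phi> \<tau>"
    using solution vr by (simp add: is_solution_def)
  then have "sol_length G P \<Gamma> \<Omega> \<sigma> \<le> sol_length G P \<Gamma> \<Omega> \<tau>" by (rule minimal)
  moreover have "vred (sig_hat G \<tau> x)" if "fst x \<in> \<Omega>" for x
    using sig\<tau>[OF that] F_shape[OF node_sig[OF that]] by simp
  moreover have "(\<Sum>x\<in>\<Omega> \<times> UNIV. wt (sig_hat G \<tau> x)) = (\<Sum>x\<in>\<Omega> \<times> UNIV. wt (F (sig x)))"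
    using sig\<tau> by (intro sum.cong) auto
  ultimately have "(\<Sum>x\<in>\<Omega> \<times> UNIV. wt (sig x)) \<le> (\<Sum>x\<in>\<Omega> \<times> UNIV. wt (F (sig x)))"
    using sol_length_wt[of \<tau>] sol_length_wt[of \<sigma>] vred_sig by simp
  moreover have "(\<Sum>x\<in>\<Omega> \<times> UNIV. wt (F (sig x))) < (\<Sum>x\<in>\<Omega> \<times> UNIV. wt (sig x))"
    if "wt (F (sig x)) < wt (sig x)"
  proof (rule sum_strict_mono_ex1)
    show "\<exists>x\<in>\<Omega> \<times> UNIV. wt (F (sig x)) < wt (sig x)"
      using that x by (intro bexI[of _ x]) (auto simp: mem_Times_iff)
  qed (use F_wt finite_\<Omega> in auto)
  ultimately show ?thesis using F_wt[OF x] by linarith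
qed

end

subsection \<open>The letters of a minimal solution\<close>

lemma reduced_iff_distinct_adj: "reduced w \<longleftrightarrow> distinct_adj (map fst w)"
  by (induction w rule: reduced.induct) auto

lemma same_shape_map_fst:
  assumes "map fst u = map fst v" shows "same_shape u v"
proof (cases "u = []")
  case False
  then have v: "v \<noteq> []" using assms by auto
  have "fst (hd u) = fst (hd v)" "fst (last u) = fst (last v)"
    using False v assms by (metis hd_map) (metis False v assms last_map)
  moreover have "alph u = alph v" using assms unfolding alph_def by (metis list.set_map)
  ultimately show ?thesis using False v by (simp add: same_shape_def)
qed (use assms in simp)

lemma (in free_product) vred_map_fst:
  assumes "vred u" "map fst u = map fst v" "\<forall>a\<in>set v. letter a" shows "vred v"
  using assms by (simp add: valid_reduced_def reduced_iff_distinct_adj)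

definition count_in :: "letter set \<Rightarrow> word \<Rightarrow> nat" where
  "count_in S w = length (filter (\<lambda>a. a \<in> S) w)"

lemma count_in_simps [simp]:
  "count_in S [] = 0" "count_in S (a # w) = (if a \<in> S then Suc (count_in S w) else count_in S w)"
  "count_in S (u @ v) = count_in S u + count_in S v"
  by (simp_all add: count_in_def)

text \<open>Parity vectors are additive over the field with two elements, with symmetric difference
  as addition of letter sets.\<close>

lemma odd_count_in_sym_diff:
  "odd (count_in (S - T \<union> (T - S)) w) \<longleftrightarrow> odd (count_in S w) \<noteq> odd (count_in T w)"
  by (induction w) auto

context free_product
begin

definition gen_letter :: "nat \<Rightarrow> letter" where
  "gen_letter \<alpha> = (\<alpha>, SOME g. g \<in> \<Gamma> \<alpha>)"

text \<open>A factor that contains a letter is nontrivial, so its generating set cannot be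
  empty.\<close>

lemma gen_letter:
  assumes "letter a" shows "gen_letter (fst a) \<in> Gam P \<Gamma>" "fst (gen_letter \<alpha>) = \<alpha>"
proof -
  have a: "fst a \<in> P" using assms by (simp add: is_letter_def)
  have "\<Gamma> (fst a) \<noteq> {}"
  proof
    assume "\<Gamma> (fst a) = {}"
    then have "carrier (G (fst a)) = {\<one>\<^bsub>G (fst a)\<^esub>}"
      using \<Gamma>_gen[OF a] group.generate_empty[OF group_G[OF a]] by simp
    then show False using assms by (simp add: is_letter_def)
  qed
  then have "(SOME g. g \<in> \<Gamma> (fst a)) \<in> \<Gamma> (fst a)" by (simp add: some_in_eq)
  then show "gen_letter (fst a) \<in> Gam P \<Gamma>" using a by (simp add: Gam_def gen_letter_def)
  show "fst (gen_letter \<alpha>) = \<alpha>" by (simp add: gen_letter_def)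
qed

text \<open>The letters of \<open>S\<close> are replaced alternately by a generator and its inverse. On words with an
  even number of letters from \<open>S\<close> this commutes with inversion, although the letters of \<open>S\<close>
  are their own inverses and the generator need not be.\<close>
fun alternate :: "letter set \<Rightarrow> bool \<Rightarrow> word \<Rightarrow> word" where
  "alternate S s [] = []"
| "alternate S s (a # w) =
    (if a \<in> S then (if s then linv (gen_letter (fst a)) else gen_letter (fst a)) # alternate S (\<not> s) w
     else a # alternate S s w)"

lemma alternate_append:
  "alternate S s (u @ v) = alternate S s u @ alternate S (s \<noteq> odd (count_in S u)) v"
proof (induction u arbitrary: s)
  case (Cons a u)
  then show ?case by (cases s; cases "odd (count_in S u)") simp_all
qed simp

lemma map_fst_alternate: "map fst (alternate S s w) = map fst w"
  by (induction w arbitrary: s) (auto simp: gen_letter_def)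

lemma letters_alternate:
  "\<forall>a\<in>set w. letter a \<Longrightarrow> \<forall>a\<in>set (alternate S s w). letter a"
  using Gam_letter gen_letter(1) by (induction w arbitrary: s) auto

lemma linv_in_self_inverse:
  assumes "\<forall>a\<in>S. linv a = a" "letter a" shows "linv a \<in> S \<longleftrightarrow> a \<in> S"
  using assms linv_linv by metis

lemma count_in_winv:
  assumes "\<forall>a\<in>S. linv a = a" "\<forall>a\<in>set w. letter a"
  shows "count_in S (winv w) = count_in S w"
  using assms(2) by (induction w) (auto simp: word_inv_Cons linv_in_self_inverse[OF assms(1)])

text \<open>The backward reading starts in the state in which the forward reading ends, and
  inversion swaps the two substitutes of a letter of \<open>S\<close>.\<close>

lemma alternate_winv:
  assumes S: "\<forall>a\<in>S. linv a = a" and "\<forall>a\<in>set w. letter a"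
  shows "alternate S s (winv w) = winv (alternate S (s \<noteq> odd (count_in S w)) w)"
  using assms(2)
proof (induction w arbitrary: s)
  case (Cons a w)
  have a: "letter a" using Cons.prems by simp
  have g: "letter (gen_letter (fst a))" using gen_letter(1)[OF a] Gam_letter by blast
  have "alternate S s (winv (a # w)) =
    alternate S s (winv w) @ alternate S (s \<noteq> odd (count_in S w)) [linv a]"
    using Cons.prems S by (simp add: word_inv_Cons alternate_append count_in_winv)
  also have "alternate S s (winv w) = winv (alternate S (s \<noteq> odd (count_in S w)) w)"
    using Cons by simp
  finally show ?case
    using g linv_in_self_inverse[OF S a] S
    by (cases "a \<in> S"; cases s; cases "odd (count_in S w)") (simp_all add: word_inv_Cons)
qed simp

lemma wt_alternate: "\<forall>a\<in>set w. letter a \<Longrightarrow> wt (alternate S s w) \<le> wt w"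
proof (induction w arbitrary: s)
  case (Cons a w)
  have "lwt (linv (gen_letter (fst a))) \<le> lwt a" "lwt (gen_letter (fst a)) \<le> lwt a"
    using gen_letter(1)[of a] Gam_linv lwt_Gam lwt_ge_1[of a] Cons.prems by (meson list.set_intros(1) order_trans)+
  then show ?case using Cons.IH[of s] Cons.IH[of "\<not> s"] Cons.prems by (auto intro: add_mono)
qed simp

lemma wt_alternate_less:
  assumes "\<forall>a\<in>set w. letter a" "b \<in> set w" "b \<in> S" "b \<notin> Gam P \<Gamma>"
  shows "wt (alternate S s w) < wt w"
proof -
  obtain u v where w: "w = u @ b # v" using assms(2) by (meson split_list)
  have b: "letter b" using assms by auto
  then have "lwt b \<noteq> 1" using lwt_eq_1 assms(4) by blast
  then have l: "1 < lwt b" using lwt_ge_1[OF b] by simp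
  have "lwt (linv (gen_letter (fst b))) \<le> 1" "lwt (gen_letter (fst b)) \<le> 1"
    using gen_letter(1)[OF b] Gam_linv lwt_Gam by blast+
  then show ?thesis
    using wt_alternate[of u S s] assms(1,3) l
      wt_alternate[of v S "\<not> (s \<noteq> odd (count_in S u))"]
    by (auto simp: w alternate_append)
qed

lemma wt_map_eqD:
  assumes "\<forall>b\<in>set w. lwt (h b) \<le> lwt b" "wt (map h w) = wt w" "b \<in> set w"
  shows "lwt (h b) = lwt b"
proof -
  have le: "wt (map h u) \<le> wt u" if "set u \<subseteq> set w" for u
    using that assms(1) by (induction u) (auto intro: add_mono)
  obtain u v where w: "w = u @ b # v" using assms(3) by (meson split_list)
  have "wt (map h u) \<le> wt u" "wt (map h v) \<le> wt v" "lwt (h b) \<le> lwt b"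
    using le[of u] le[of v] assms(1) w by auto
  then show ?thesis using assms(2) unfolding w by simp
qed

end

context minimal_solution
begin

text \<open>One decomposition per step is fixed, so that middle letters and cuts refer to the same
  choice.\<close>

definition dec where
  "dec x y = (SOME d. case d of (p, ma, q, mb, r, mc) \<Rightarrow> decomp x y p ma q mb r mc)"

lemma dec:
  assumes "(x, y) \<in> stp" "dec x y = (p, ma, q, mb, r, mc)"
  shows "decomp x y p ma q mb r mc"
proof -
  have "\<exists>d. case d of (p, ma, q, mb, r, mc) \<Rightarrow> decomp x y p ma q mb r mc"
    using ex_decomp[of x y] node_step[OF assms(1)] vred_node by auto
  then have "case dec x y of (p, ma, q, mb, r, mc) \<Rightarrow> decomp x y p ma q mb r mc"
    unfolding dec_def by (rule someI_ex)
  then show ?thesis using assms(2) by simp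
qed

definition mid :: "word \<times> word \<Rightarrow> letter set" where
  "mid xy = (case dec (fst xy) (snd xy) of (p, ma, q, mb, r, mc) \<Rightarrow> set ma \<union> set mb \<union> set mc)"

definition mids :: "letter set" where
  "mids = (\<Union>xy\<in>stp. mid xy)"

definition cmids :: "letter set" where
  "cmids = mids \<union> linv ` mids"

definition sletters :: "letter set" where
  "sletters = (\<Union>x\<in>\<Omega> \<times> UNIV. set (sig x))"

lemma finite_sletters: "finite sletters"
  using finite_\<Omega> by (simp add: sletters_def)

lemma letter_sletters: "a \<in> sletters \<Longrightarrow> letter a"
  unfolding sletters_def using vred_sig vred_letters by fastforce

lemma dec_mids:
  assumes "(x, y) \<in> stp" "dec x y = (p, ma, q, mb, r, mc)"
  shows "set ma \<subseteq> cmids" "set mb \<subseteq> cmids" "set mc \<subseteq> cmids"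
  using assms by (force simp: cmids_def mids_def mid_def)+

lemma mid_bound:
  assumes "xy \<in> stp" shows "finite (mid xy) \<and> card (mid xy) \<le> 3"
proof -
  obtain x y where xy: "xy = (x, y)" by (cases xy)
  obtain p ma q mb r mc where d: "dec x y = (p, ma, q, mb, r, mc)" by (cases "dec x y")
  have "length ma \<le> 1" "length mb \<le> 1" "length mc \<le> 1"
    using dec[OF _ d] assms xy by (auto simp: decomp_def)
  then have "length (ma @ mb @ mc) \<le> 3" by simp
  then have "card (set (ma @ mb @ mc)) \<le> 3" using card_length order_trans by blast
  then show ?thesis using d xy by (simp add: mid_def Un_assoc)
qed

lemma cmids_bound: "finite cmids \<and> card cmids \<le> 6 * card stp"
proof -
  have f: "finite mids" using mid_bound finite_steps by (auto simp: mids_def)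
  have "card mids \<le> (\<Sum>xy\<in>stp. card (mid xy))"
    unfolding mids_def using finite_steps by (rule card_UN_le)
  also have "\<dots> \<le> 3 * card stp"
    using mid_bound sum_bounded_above[of stp "\<lambda>xy. card (mid xy)" 3] by (simp add: mult.commute)
  finally show ?thesis
    using f card_Un_le[of mids "linv ` mids"] card_image_le[OF f, of linv] by (simp add: cmids_def)
qed

text \<open>The only letters of a product that are not inherited from its factors are those of
  \<open>mc\<close>.\<close>

lemma node_letters: "w \<in> nodes \<Longrightarrow> set w \<subseteq> sletters \<union> cmids"
proof (erule node_induct(1)[of "\<lambda>w. set w \<subseteq> sletters \<union> cmids", rotated -1])
  show "set (sig x) \<subseteq> sletters \<union> cmids" if "fst x \<in> \<Omega>" for x
    using that by (cases x) (auto simp: sletters_def)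
  fix x y assume xy: "(x, y) \<in> stp" and s: "set x \<subseteq> sletters \<union> cmids" "set y \<subseteq> sletters \<union> cmids"
  obtain p ma q mb r mc where d: "dec x y = (p, ma, q, mb, r, mc)" by (cases "dec x y")
  show "set (red G (x @ y)) \<subseteq> sletters \<union> cmids"
    using dec[OF xy d] dec_mids[OF xy d] s by (auto simp: decomp_def)
qed simp

lemma \<sigma>_node: "X \<in> \<Omega> \<Longrightarrow> \<sigma> X \<in> nodes"
  using node_sig[of "(X, True)"] by (simp add: sig_hat_def)

lemma node_letter: "w \<in> nodes \<Longrightarrow> \<forall>a\<in>set w. letter a"
  using vred_node vred_letters by blast

lemma mid_subset:
  assumes "(x, y) \<in> stp" shows "mid (x, y) \<subseteq> set x \<union> set y \<union> set (red G (x @ y))"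
proof -
  obtain p ma q mb r mc where d: "dec x y = (p, ma, q, mb, r, mc)" by (cases "dec x y")
  then show ?thesis using dec[OF assms d] by (auto simp: decomp_def mid_def)
qed

lemma letter_mids: "b \<in> mids \<Longrightarrow> letter b"
proof -
  assume "b \<in> mids"
  then obtain x y where xy: "(x, y) \<in> stp" "b \<in> mid (x, y)" by (auto simp: mids_def)
  then have "b \<in> set x \<union> set y \<union> set (red G (x @ y))" using mid_subset by blast
  then show ?thesis
    using node_letter[OF node_step(1)[OF xy(1)]] node_letter[OF node_step(2)[OF xy(1)]]
      node_letter[OF node_red[OF xy(1)]] by blast
qed

lemma cmids_linv: "a \<in> cmids \<Longrightarrow> linv a \<in> cmids"
  using letter_mids by (auto simp: cmids_def)

text \<open>Exchange \<open>a\<close> for a generator \<open>c\<close> of its factor and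
  \<open>linv a\<close> for \<open>linv c\<close>. This is well defined because
  \<open>linv a \<noteq> a\<close>, commutes with inversion and leaves the middle letters alone.
  Minimality then forces \<open>a\<close> to have the length 1 of \<open>c\<close>.\<close>

lemma generic_letter_in_Gam:
  assumes a: "a \<in> sletters" "linv a \<noteq> a" "a \<notin> cmids"
  shows "a \<in> Gam P \<Gamma>"
proof -
  have la: "letter a" using a letter_sletters by blast
  have la': "linv a \<notin> cmids" using cmids_linv[of "linv a"] a(3) la by auto
  define c where "c = gen_letter (fst a)"
  have c: "c \<in> Gam P \<Gamma>" "fst c = fst a" using gen_letter[OF la] by (simp_all add: c_def)
  have lc: "letter c" using c Gam_letter by blast
  define h where "h b = (if b = a then c else if b = linv a then linv c else b)" for b
  have h_fst: "fst (h b) = fst b" for b using c by (simp add: h_def)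
  have h_letter: "letter (h b)" if "letter b" for b using that lc by (simp add: h_def)
  have h_linv: "h (linv b) = linv (h b)" if "letter b" for b
  proof -
    have "linv b = a \<longleftrightarrow> b = linv a" "linv b = linv a \<longleftrightarrow> b = a" using that la linv_linv by metis+
    then show ?thesis using lc a(2) by (auto simp: h_def)
  qed
  have h_winv: "map h (winv w) = winv (map h w)" if "\<forall>b\<in>set w. letter b" for w
    using that h_linv by (induction w) (auto simp: word_inv_Cons)
  have h_wt: "lwt (h b) \<le> lwt b" if "letter b" for b
    using that lwt_Gam[OF c(1)] lwt_Gam[OF Gam_linv[OF c(1)]] lwt_ge_1[OF that] by (auto simp: h_def)
  have h_fix: "map h w = w" if "set w \<subseteq> cmids" for w
    using that a la' by (intro map_idI) (auto simp: h_def)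
  have eq: "wt (map h (sig x)) = wt (sig x)" if "fst x \<in> \<Omega>" for x
  proof (rule wt_not_decreased[OF _ _ _ _ that])
    show "map h (winv (\<sigma> X)) = winv (map h (\<sigma> X))" if "X \<in> \<Omega>" for X
      using that by (intro h_winv node_letter \<sigma>_node)
    show "vred (map h w) \<and> same_shape w (map h w)" if w: "w \<in> nodes" for w
    proof
      have e: "map fst w = map fst (map h w)" using h_fst by simp
      show "vred (map h w)" using vred_map_fst[OF vred_node[OF w] e] node_letter[OF w] h_letter by auto
      show "same_shape w (map h w)" using e by (rule same_shape_map_fst)
    qed
    show "wt (map h (sig x)) \<le> wt (sig x)" if "fst x \<in> \<Omega>" for x
    proof -
      have "wt (map h w) \<le> wt w" if "\<forall>b\<in>set w. letter b" for w
        using that h_wt by (induction w) (auto intro: add_mono)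
      then show ?thesis using node_letter[OF node_sig[OF that]] by blast
    qed
    fix x y assume xy: "(x, y) \<in> stp"
    obtain p ma q mb r mc where d: "dec x y = (p, ma, q, mb, r, mc)" by (cases "dec x y")
    note dd = dec[OF xy d, unfolded decomp_def] and mfix = dec_mids[OF xy d, THEN h_fix]
    have "\<forall>b\<in>set q. letter b" using node_letter[OF node_step(1)[OF xy]] dd by auto
    then have "map h x = map h p @ ma @ map h q \<and> map h y = winv (map h q) @ mb @ map h r
       \<and> map h (red G (x @ y)) = map h p @ red G (ma @ mb) @ map h r"
      using dd mfix h_winv by (metis map_append)
    then show "\<exists>p ma q mb r. map h x = p @ ma @ q \<and> map h y = winv q @ mb @ r
       \<and> map h (red G (x @ y)) = p @ red G (ma @ mb) @ r" by blast
  qed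
  obtain x where x: "fst x \<in> \<Omega>" "a \<in> set (sig x)" using a(1) by (auto simp: sletters_def)
  have "lwt (h a) = lwt a"
    using wt_map_eqD[OF _ eq[OF x(1)] x(2)] h_wt node_letter[OF node_sig[OF x(1)]] by blast
  then have "lwt a = 1" using lwt_Gam[OF c(1)] lwt_ge_1[OF lc] by (simp add: h_def)
  then show ?thesis using lwt_eq_1[OF la] by blast
qed

definition involutions :: "letter set" where
  "involutions = {a \<in> sletters. linv a = a \<and> a \<notin> cmids \<and> a \<notin> Gam P \<Gamma>}"

text \<open>With even counts throughout, \<open>alternate S False\<close> meets the conditions of
  \<open>wt_not_decreased\<close>, yet it makes any variable that contains a letter of
  \<open>S\<close> lighter.\<close>

lemma even_involutions_empty:
  assumes S: "S \<subseteq> involutions" and even: "\<And>X. X \<in> \<Omega> \<Longrightarrow> even (count_in S (\<sigma> X))"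
  shows "S = {}"
proof (rule ccontr)
  assume "S \<noteq> {}"
  then obtain b where b: "b \<in> S" by blast
  have inv: "\<forall>a\<in>S. linv a = a" using S by (auto simp: involutions_def)
  have avoid: "count_in S w = 0" "alternate S s w = w" if "set w \<subseteq> cmids" for w s
    using that S by (induction w) (auto simp: involutions_def)
  let ?F = "alternate S False"
  \<comment> \<open>The middles avoid \<open>S\<close>, so evenness of both factors gives
    \<open>p\<close>, \<open>q\<close> and \<open>r\<close> the same parity, and
    \<open>p @ mc @ r\<close> is even again.\<close>
  have ev: "even (count_in S w)" if "w \<in> nodes" for w
    using that
  proof (rule node_induct(1)[of "\<lambda>w. even (count_in S w)", rotated -1])
    show "even (count_in S (sig x))" if "fst x \<in> \<Omega>" for x
      using even[OF that] count_in_winv[OF inv node_letter[OF \<sigma>_node[OF that]]]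
      by (simp add: sig_hat_def)
    fix x y assume xy: "(x, y) \<in> stp" and e: "even (count_in S x)" "even (count_in S y)"
    obtain p ma q mb r mc where d: "dec x y = (p, ma, q, mb, r, mc)" by (cases "dec x y")
    note dd = dec[OF xy d, unfolded decomp_def]
    have "\<forall>b\<in>set q. letter b" using node_letter[OF node_step(1)[OF xy]] dd by auto
    then have "count_in S (winv q) = count_in S q" using count_in_winv[OF inv] by blast
    then show "even (count_in S (red G (x @ y)))"
      using e dd avoid(1)[OF dec_mids(1)[OF xy d]] avoid(1)[OF dec_mids(2)[OF xy d]]
        avoid(1)[OF dec_mids(3)[OF xy d]] by auto
  qed simp
  have eq: "wt (?F (sig x)) = wt (sig x)" if "fst x \<in> \<Omega>" for x
  proof (rule wt_not_decreased[OF _ _ _ _ that])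
    show "?F (winv (\<sigma> X)) = winv (?F (\<sigma> X))" if "X \<in> \<Omega>" for X
      using alternate_winv[OF inv node_letter[OF \<sigma>_node[OF that]]] even[OF that] by simp
    show "vred (?F w) \<and> same_shape w (?F w)" if w: "w \<in> nodes" for w
      using vred_map_fst[OF vred_node[OF w] map_fst_alternate[symmetric]] letters_alternate[OF node_letter[OF w]]
        same_shape_map_fst[OF map_fst_alternate[symmetric]] by blast
    show "wt (?F (sig x)) \<le> wt (sig x)" if "fst x \<in> \<Omega>" for x
      using wt_alternate[OF node_letter[OF node_sig[OF that]]] .
    fix x y assume xy: "(x, y) \<in> stp"
    obtain p ma q mb r mc where d: "dec x y = (p, ma, q, mb, r, mc)" by (cases "dec x y")
    note dd = dec[OF xy d, unfolded decomp_def] and m = dec_mids[OF xy d]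
    have q: "\<forall>b\<in>set q. letter b" using node_letter[OF node_step(1)[OF xy]] dd by auto
    \<comment> \<open>\<open>p\<close> and \<open>winv q\<close> both leave the scan in state
      \<open>s\<close>. Hence \<open>q\<close> and its inverse copy are replaced consistently, and
      so are the two copies of \<open>r\<close>.\<close>
    define s where "s = odd (count_in S q)"
    have "even (count_in S x)" using ev node_step(1)[OF xy] by blast
    then have ps: "odd (count_in S p) = s" using dd avoid(1)[OF m(1)] by (auto simp: s_def)
    have "?F x = ?F p @ ma @ alternate S s q"
      using dd avoid[OF m(1)] ps by (simp add: alternate_append)
    moreover have "?F y = winv (alternate S s q) @ mb @ alternate S s r"
      using dd avoid[OF m(2)] alternate_winv[OF inv q] count_in_winv[OF inv q]
      by (simp add: alternate_append s_def)
    moreover have "?F (red G (x @ y)) = ?F p @ red G (ma @ mb) @ alternate S s r"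
    proof -
      have "red G (x @ y) = p @ mc @ r" "red G (ma @ mb) = mc" using dd by blast+
      then show ?thesis using avoid[OF m(3)] ps by (simp add: alternate_append)
    qed
    ultimately show "\<exists>p ma q mb r. ?F x = p @ ma @ q \<and> ?F y = winv q @ mb @ r
       \<and> ?F (red G (x @ y)) = p @ red G (ma @ mb) @ r" by blast
  qed
  have "b \<in> sletters" "b \<notin> Gam P \<Gamma>" using b S by (auto simp: involutions_def)
  then obtain x where x: "fst x \<in> \<Omega>" "b \<in> set (sig x)" by (auto simp: sletters_def)
  then show False
    using eq[OF x(1)] wt_alternate_less[OF node_letter[OF node_sig[OF x(1)]] x(2) b, of False] \<open>b \<notin> Gam P \<Gamma>\<close>
    by simp
qed

text \<open>Two subsets with the same parity vector have a symmetric difference with only even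
  counts, which must be empty. So \<open>f\<close> is injective from \<open>Pow involutions\<close>
  into \<open>Pow \<Omega>\<close>.\<close>

lemma card_involutions: "card involutions \<le> card \<Omega>"
proof (rule ccontr)
  assume "\<not> ?thesis"
  then have less: "card \<Omega> < card involutions" by simp
  have fin: "finite involutions" using finite_sletters by (simp add: involutions_def)
  define f where "f S = {X \<in> \<Omega>. odd (count_in S (\<sigma> X))}" for S
  have "card (f ` Pow involutions) \<le> card (Pow \<Omega>)"
    using finite_\<Omega> by (intro card_mono) (auto simp: f_def)
  also have "\<dots> < card (Pow involutions)"
    using less fin finite_\<Omega> by (simp add: card_Pow)
  finally have "\<not> inj_on f (Pow involutions)" using pigeonhole by blast
  then obtain S T where ST: "S \<subseteq> involutions" "T \<subseteq> involutions" "S \<noteq> T" "f S = f T"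
    by (auto simp: inj_on_def)
  let ?D = "S - T \<union> (T - S)"
  have "even (count_in ?D (\<sigma> X))" if "X \<in> \<Omega>" for X
  proof -
    have "X \<in> f S \<longleftrightarrow> X \<in> f T" using ST by simp
    then show ?thesis using that odd_count_in_sym_diff[of S T "\<sigma> X"] by (simp add: f_def)
  qed
  then have "?D = {}" using even_involutions_empty[of ?D] ST by blast
  then show False using ST by blast
qed

definition letters :: "letter set" where
  "letters = Gam P \<Gamma> \<union> cmids \<union> involutions"

lemma letters_bound: "finite letters \<and> card letters \<le> card (Gam P \<Gamma>) + 6 * card stp + card \<Omega>"
  using card_Un_le[of "Gam P \<Gamma> \<union> cmids" involutions] card_Un_le[of "Gam P \<Gamma>" cmids]
    cmids_bound card_involutions finite_Gam finite_sletters
  by (auto simp: letters_def involutions_def)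

lemma node_letters_sub: "w \<in> nodes \<Longrightarrow> set w \<subseteq> letters"
  using node_letters generic_letter_in_Gam by (fastforce simp: letters_def involutions_def)

end

subsection \<open>Replacement of factors\<close>

text \<open>The two parts are nonempty, so the occurrence is really cut in two by the boundary
  between \<open>s\<close> and \<open>t\<close>.\<close>

definition straddle :: "'a list set \<Rightarrow> 'a list \<Rightarrow> 'a list \<Rightarrow> bool" where
  "straddle D s t \<longleftrightarrow> (\<exists>d1 d2. d1 @ d2 \<in> D \<and> d1 \<noteq> [] \<and> d2 \<noteq> [] \<and> suffix d1 s \<and> prefix d2 t)"

lemma straddleI:
  "d1 @ d2 \<in> D \<Longrightarrow> d1 \<noteq> [] \<Longrightarrow> d2 \<noteq> [] \<Longrightarrow> suffix d1 s \<Longrightarrow> prefix d2 t \<Longrightarrow> straddle D s t"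
  unfolding straddle_def by blast

lemma straddle_suffix: "straddle D s t \<Longrightarrow> suffix s s' \<Longrightarrow> straddle D s' t"
  unfolding straddle_def using suffix_order.trans by blast

lemma sublist_append_straddle:
  assumes "sublist d (s @ t)" "d \<in> D" "\<not> straddle D s t"
  shows "sublist d s \<or> sublist d t"
proof (rule ccontr)
  assume n: "\<not> ?thesis"
  then obtain d1 d2 where d: "d = d1 @ d2" "suffix d1 s" "prefix d2 t"
    using assms(1) sublist_append by blast
  moreover have "d1 \<noteq> []" "d2 \<noteq> []" using n d by auto
  ultimately show False using assms(2,3) unfolding straddle_def by blast
qed

text \<open>A greedy scan from left to right. After a hit, \<open>drop (k - 1) w\<close> removes the
  remaining letters of the occurrence, whose first letter is \<open>a\<close>.\<close>

function repl :: "nat \<Rightarrow> word set \<Rightarrow> (word \<Rightarrow> word) \<Rightarrow> word \<Rightarrow> word" where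
  "repl k D g [] = []"
| "repl k D g (a # w) = (if take k (a # w) \<in> D then g (take k (a # w)) @ repl k D g (drop (k - 1) w)
     else a # repl k D g w)"
  by pat_completeness auto
termination by (relation "measure (\<lambda>(k, D, g, w). length w)") auto

declare repl.simps(2) [simp del]

text \<open>\<open>2 \<le> k\<close> protects the middle pieces of the decompositions, which have at
  most one letter. Closure under \<open>winv\<close> lets a variable and its inverse change
  together.\<close>

locale replacement = free_product +
  fixes k :: nat and D :: "word set" and g :: "word \<Rightarrow> word"
  assumes k: "2 \<le> k" and length_D: "d \<in> D \<Longrightarrow> length d = k"
    and vred_D: "d \<in> D \<Longrightarrow> vred d" and winv_D: "d \<in> D \<Longrightarrow> winv d \<in> D"
    and winv_g: "d \<in> D \<Longrightarrow> g (winv d) = winv (g d)"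
    and shape_g: "d \<in> D \<Longrightarrow> vred (g d) \<and> same_shape d (g d)"
    and wt_g: "d \<in> D \<Longrightarrow> wt (g d) < wt d"
begin

abbreviation rp where "rp \<equiv> repl k D g"

lemma repl_hit: "take k w \<in> D \<Longrightarrow> rp w = g (take k w) @ rp (drop k w)"
proof (cases w)
  case Nil
  assume "take k w \<in> D"
  then show ?thesis using Nil length_D[of "[]"] k by simp
next
  case (Cons a v)
  assume "take k w \<in> D"
  moreover have "drop (k - 1) v = drop k w" using Cons k by (cases k) auto
  ultimately show ?thesis using Cons by (simp add: repl.simps(2))
qed

lemma repl_miss: "take k (a # w) \<notin> D \<Longrightarrow> rp (a # w) = a # rp w"
  by (simp add: repl.simps(2))

lemma take_D_length: "take k w \<in> D \<Longrightarrow> k \<le> length w"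
  using length_D[of "take k w"] by simp

lemma repl_word: "d \<in> D \<Longrightarrow> rp d = g d"
  using repl_hit[of d] length_D[of d] by simp

lemma repl_short: "length w < k \<Longrightarrow> rp w = w"
proof (induction w)
  case (Cons a w)
  then have "take k (a # w) \<notin> D" using take_D_length[of "a # w"] by linarith
  then show ?case using Cons repl_miss[of a w] by simp
qed simp

text \<open>The scan can step over the boundary only by a hit that is cut by it; otherwise it
  arrives exactly there and starts afresh on \<open>t\<close>.\<close>

lemma repl_append: "\<not> straddle D s t \<Longrightarrow> rp (s @ t) = rp s @ rp t"
proof (induction "length s" arbitrary: s rule: less_induct)
  case less
  show ?case
  proof (cases s)
    case (Cons a s')
    show ?thesis
    proof (cases "take k (s @ t) \<in> D")
      case True
      have ks: "k \<le> length s"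
      proof (rule ccontr)
        assume n: "\<not> ?thesis"
        define d2 where "d2 = take (k - length s) t"
        have "s @ d2 \<in> D" using True n by (simp add: d2_def)
        moreover have "d2 \<noteq> []" using take_D_length[OF True] n by (auto simp: d2_def)
        ultimately have "straddle D s t"
          using Cons by (intro straddleI[of s d2]) (auto simp: d2_def take_is_prefix)
        then show False using less.prems by simp
      qed
      have "\<not> straddle D (drop k s) t"
        using less.prems straddle_suffix[OF _ suffix_drop[of k s], of D t] by argo
      then have "rp (drop k s @ t) = rp (drop k s) @ rp t" using less.hyps[of "drop k s"] k Cons by simp
      then show ?thesis using repl_hit[OF True] repl_hit[of s] True ks by simp
    next
      case False
      have s: "take k s \<notin> D"
      proof
        assume t: "take k s \<in> D"
        then show False using take_D_length[OF t] False by simp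
      qed
      have "suffix s' s" using Cons by (simp add: suffix_ConsI)
      then have "\<not> straddle D s' t" using less.prems straddle_suffix[of D s' t s] by argo
      then have "rp (s' @ t) = rp s' @ rp t" using less.hyps[of s'] Cons by simp
      then show ?thesis using repl_miss[of a "s' @ t"] repl_miss[of a s'] s False Cons by simp
    qed
  qed simp
qed

lemma straddle_winv:
  assumes "straddle D (winv t) (winv s)" "\<forall>a\<in>set (s @ t). letter a"
  shows "straddle D s t"
proof -
  have st: "winv (winv s) = s" "winv (winv t) = t" using assms(2) by (auto intro: winv_winv)
  obtain d1 d2 where d: "d1 @ d2 \<in> D" "d1 \<noteq> []" "d2 \<noteq> []" "suffix d1 (winv t)" "prefix d2 (winv s)"
    using assms(1) unfolding straddle_def by blast
  obtain u where u: "winv t = u @ d1" using d(4) by (auto simp: suffix_def)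
  obtain v where v: "winv s = d2 @ v" using d(5) by (auto simp: prefix_def)
  have "s = winv v @ winv d2" using st(1) v by simp
  moreover have "t = winv d1 @ winv u" using st(2) u by simp
  moreover have "winv d2 @ winv d1 \<in> D" using winv_D[OF d(1)] by simp
  ultimately show ?thesis using d(2,3)
    by (intro straddleI[of "winv d2" "winv d1"]) (auto simp: suffix_def prefix_def)
qed

text \<open>No two occurrences overlap. Then the scan from the left takes every occurrence, as a
  scan from the right would; inverting a word exchanges the two scans.\<close>

definition isolated :: "word \<Rightarrow> bool" where
  "isolated w \<longleftrightarrow> (\<forall>d t. sublist (d @ t) w \<and> d \<in> D \<longrightarrow> \<not> straddle D d t)"

lemma isolated_sublist: "isolated w \<Longrightarrow> sublist v w \<Longrightarrow> isolated v"
  unfolding isolated_def using sublist_order.order_trans by blast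

text \<open>A leading occurrence or else a single letter is split off. No occurrence is cut there,
  by isolation or because it would have been a leading hit, so \<open>repl_append\<close> applies to
  the inverse word too.\<close>

lemma repl_winv:
  assumes "isolated w" "\<forall>a\<in>set w. letter a"
  shows "rp (winv w) = winv (rp w)"
  using assms
proof (induction "length w" arbitrary: w rule: less_induct)
  case less
  show ?case
  proof (cases w)
    case (Cons a v)
    show ?thesis
    proof (cases "take k w \<in> D")
      case True
      let ?d = "take k w" and ?t = "drop k w"
      have l: "\<forall>a\<in>set ?t. letter a" "\<forall>a\<in>set (?d @ ?t). letter a" using less.prems(2) by (auto dest: in_set_dropD)
      have "isolated ?t" using less.prems(1) isolated_sublist sublist_drop by blast
      then have IH: "rp (winv ?t) = winv (rp ?t)" using less.hyps[of ?t] l k Cons by simp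
      have "\<not> straddle D ?d ?t" using less.prems(1) True unfolding isolated_def by simp
      then have "\<not> straddle D (winv ?t) (winv ?d)" using straddle_winv l(2) by blast
      then have "rp (winv ?t @ winv ?d) = rp (winv ?t) @ rp (winv ?d)" by (rule repl_append)
      also have "\<dots> = winv (rp ?t) @ winv (g ?d)"
        using IH repl_word[OF winv_D[OF True]] winv_g[OF True] by simp
      also have "winv ?t @ winv ?d = winv w" using word_inv_append[of G ?d ?t, symmetric] by simp
      finally show ?thesis using repl_hit[OF True] by simp
    next
      case False
      have n: "\<not> straddle D [a] v"
      proof
        assume "straddle D [a] v"
        then obtain d1 d2 where d: "d1 @ d2 \<in> D" "d1 \<noteq> []" "suffix d1 [a]" "prefix d2 v"
          unfolding straddle_def by blast
        then have "d1 = [a]" by (auto simp: suffix_Cons)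
        then have "prefix (d1 @ d2) w" using d Cons by simp
        then have "take k w = d1 @ d2" using length_D[OF d(1)] by (auto simp: prefix_def)
        then show False using False d by simp
      qed
      have l: "\<forall>a\<in>set v. letter a" "\<forall>b\<in>set ([a] @ v). letter b" using less.prems(2) Cons by auto
      have "isolated v" using isolated_sublist[OF less.prems(1)] Cons by (simp add: sublist_Cons_right)
      then have IH: "rp (winv v) = winv (rp v)" using less.hyps[of v] l Cons by simp
      have "\<not> straddle D (winv v) (winv [a])" using straddle_winv l(2) n by blast
      then have "rp (winv v @ winv [a]) = rp (winv v) @ rp (winv [a])" by (rule repl_append)
      also have "rp (winv [a]) = winv [a]" using k by (intro repl_short) simp
      finally show ?thesis using IH Cons repl_miss[of a v] False by (simp add: word_inv_Cons)
    qed
  qed simp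
qed

lemma repl_shape: "vred w \<Longrightarrow> vred (rp w) \<and> same_shape w (rp w)"
proof (induction "length w" arbitrary: w rule: less_induct)
  case less
  show ?case
  proof (cases w)
    case (Cons a v)
    show ?thesis
    proof (cases "take k w \<in> D")
      case True
      have w: "vred (take k w @ drop k w)" using less.prems by simp
      then have IH: "vred (rp (drop k w)) \<and> same_shape (drop k w) (rp (drop k w))"
        using less.hyps[of "drop k w"] k Cons unfolding valid_reduced_append by simp
      then have "vred (g (take k w) @ rp (drop k w))"
        using shape_g[OF True] by (intro valid_reduced_shape_append[OF w]) auto
      moreover have "same_shape (take k w @ drop k w) (g (take k w) @ rp (drop k w))"
        using shape_g[OF True] IH by (intro same_shape_append) auto
      ultimately show ?thesis using repl_hit[OF True] by simp
    next
      case False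
      have w: "vred ([a] @ v)" using less.prems Cons by simp
      then have IH: "vred (rp v) \<and> same_shape v (rp v)"
        using less.hyps[of v] Cons by (simp add: valid_reduced_Cons)
      have a: "vred [a]" using less.prems Cons by (simp add: valid_reduced_Cons)
      have "rp w = [a] @ rp v" using repl_miss[of a v] False Cons by simp
      then show ?thesis
        using valid_reduced_shape_append[OF w same_shape_refl _ a] IH
          same_shape_append[OF same_shape_refl[of "[a]"]] Cons by simp
    qed
  qed simp
qed

lemma repl_wt: "wt (rp w) \<le> wt w"
proof (induction "length w" arbitrary: w rule: less_induct)
  case less
  show ?case
  proof (cases w)
    case (Cons a v)
    show ?thesis
    proof (cases "take k w \<in> D")
      case True
      have "wt (rp (drop k w)) \<le> wt (drop k w)" using less[of "drop k w"] k Cons by simp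
      moreover have "wt w = wt (take k w) + wt (drop k w)" using wt_append[of "take k w" "drop k w"] by simp
      ultimately show ?thesis using repl_hit[OF True] wt_g[OF True] by simp
    next
      case False
      then show ?thesis using less[of v] Cons repl_miss[of a v] by simp
    qed
  qed simp
qed

text \<open>The scan may miss the given occurrence of \<open>d\<close> if an earlier hit overlaps
  it, but then that hit already saves weight.\<close>

lemma repl_wt_less:
  "d \<in> D \<Longrightarrow> sublist d w \<Longrightarrow> wt (rp w) < wt w"
proof (induction w)
  case Nil
  then show ?case using length_D[of d] k by simp
next
  case (Cons a v)
  let ?w = "a # v"
  show ?case
  proof (cases "take k ?w \<in> D")
    case True
    have "wt ?w = wt (take k ?w) + wt (drop k ?w)" using wt_append[of "take k ?w" "drop k ?w"] by simp
    then show ?thesis using repl_hit[OF True] wt_g[OF True] repl_wt[of "drop k ?w"] by simp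
  next
    case False
    have "\<not> prefix d ?w"
    proof
      assume "prefix d ?w"
      then have "take k ?w = d" using length_D[OF Cons.prems(1)] by (auto simp: prefix_def)
      then show False using False Cons.prems by simp
    qed
    then have "sublist d v" using Cons.prems(2) by (simp add: sublist_Cons_right)
    then show ?thesis using Cons repl_miss[OF False] by simp
  qed
qed

end

section \<open>Short words of a prescribed shape\<close>

context free_product
begin

text \<open>Take one generator for each type of the alphabet, with the prescribed types at the ends.
  A type is repeated only when both ends agree and other types lie between them, which accounts for
  the extra 1.\<close>

lemma short_shape:
  assumes p: "vred p" "p \<noteq> []"
  shows "\<exists>p'. vred p' \<and> same_shape p p' \<and> set p' \<subseteq> Gam P \<Gamma> \<and> length p' \<le> card (Gam P \<Gamma>) + 1"
proof -
  define A f l where "A = alph p" and "f = fst (hd p)" and "l = fst (last p)"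
  have fl: "f \<in> A" "l \<in> A" using p(2) by (auto simp: A_def f_def l_def alph_def)
  have fA: "finite A" by (simp add: A_def alph_def)
  have gl: "gen_letter \<alpha> \<in> Gam P \<Gamma>" if \<alpha>: "\<alpha> \<in> A" for \<alpha>
  proof -
    obtain a where "a \<in> set p" "\<alpha> = fst a" using \<alpha> unfolding A_def alph_def by blast
    then show ?thesis using gen_letter(1)[of a] vred_letters[OF p(1)] by simp
  qed
  have "inj_on gen_letter A" by (auto simp: inj_on_def gen_letter_def)
  moreover have "gen_letter ` A \<subseteq> Gam P \<Gamma>" using gl by blast
  ultimately have cA: "card A \<le> card (Gam P \<Gamma>)" using finite_Gam card_inj_on_le by blast
  have mk: ?thesis if ts: "distinct_adj ts" "set ts = A" "hd ts = f" "last ts = l" "length ts \<le> card A + 1" for ts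
  proof (intro exI conjI)
    have ne: "ts \<noteq> []" using ts(2) fl by auto
    have mf: "map fst (map gen_letter ts) = ts" by (simp add: gen_letter_def o_def)
    show "set (map gen_letter ts) \<subseteq> Gam P \<Gamma>" using gl ts(2) by auto
    then show "vred (map gen_letter ts)"
      using Gam_letters[of "map gen_letter ts"] ts(1) mf unfolding valid_reduced_def reduced_iff_distinct_adj by simp
    have "alph (map gen_letter ts) = A" using ts(2) by (simp add: alph_def image_image gen_letter_def)
    then show "same_shape p (map gen_letter ts)"
      using ne p(2) ts(3,4) by (simp add: same_shape_def A_def f_def l_def hd_map last_map gen_letter_def)
    show "length (map gen_letter ts) \<le> card (Gam P \<Gamma>) + 1" using ts(5) cA by simp
  qed
  define xs where "xs = sorted_list_of_set (A - {f, l})"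
  have xs: "set xs = A - {f, l}" "distinct xs" using fA by (simp_all add: xs_def)
  have adj: "distinct_adj ys" if "distinct ys" for ys :: "nat list"
    using that by (simp add: distinct_adj_conv_nth nth_eq_iff_index_eq)
  show ?thesis
  proof (cases "f = l")
    case False
    have d: "distinct (f # xs @ [l])" using xs False by auto
    have "card (set (f # xs @ [l])) = length (f # xs @ [l])" using d by (rule distinct_card)
    moreover have "set (f # xs @ [l]) = A" using xs fl by auto
    ultimately show ?thesis using adj[OF d] by (intro mk[of "f # xs @ [l]"]) auto
  next
    case True
    show ?thesis
    proof (cases "xs = []")
      case xs0: True
      then have A: "A = {f}" using xs fl True by auto
      then show ?thesis using True by (intro mk[of "[f]"]) auto
    next
      case xs1: False
      have "distinct_adj xs" using xs(2) by (rule adj)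
      moreover have "hd xs \<noteq> f" "last xs \<noteq> l" using xs xs1 hd_in_set last_in_set by force+
      ultimately have "distinct_adj (f # xs @ [l])"
        using xs1 by (simp add: distinct_adj_Cons distinct_adj_append_iff)
      moreover have "length xs = card (A - {f})" using distinct_card[OF xs(2)] xs(1) True by simp
      then have "length (f # xs @ [l]) \<le> card A + 1" using card_Suc_Diff1[OF fA fl(1)] by simp
      ultimately show ?thesis using xs fl by (intro mk[of "f # xs @ [l]"]) auto
    qed
  qed
qed

text \<open>For even length the two middle letters would be inverse to each other and hence lie in
  one factor, against reducedness. So there is a middle letter, and the rest is its mirror
  image.\<close>

lemma self_inverse_split:
  assumes v: "vred v" "winv v = v" "v \<noteq> []"
  shows "\<exists>p a. v = p @ [a] @ winv p"
proof -
  have app_eqD: "a = c \<and> b = d" if "a @ b = c @ d" "length a = length c" for a b c d :: word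
    using that by simp
  define m where "m = length v div 2"
  show ?thesis
  proof (cases "even (length v)")
    case True
    define u where "u = drop m v"
    have l: "length u = m" "length (take m v) = m" using True by (auto simp: u_def m_def)
    have "length v = 2 * m" using True by (simp add: m_def)
    then have "m \<noteq> 0" using v(3) by (intro notI) simp
    then have "u \<noteq> []" using l(1) by auto
    have vv: "take m v @ u = v" by (simp add: u_def)
    have "winv u @ winv (take m v) = winv (take m v @ u)" by (rule word_inv_append[symmetric])
    also have "\<dots> = take m v @ u" by (simp only: vv v(2))
    finally have "take m v @ u = winv u @ winv (take m v)" by (rule sym)
    moreover have "length (take m v) = length (winv u)" using l by simp
    ultimately have t: "take m v = winv u" using app_eqD by blast
    then have "vred (winv u @ u)" using v(1) vv by argo
    then show ?thesis using \<open>u \<noteq> []\<close> by (simp add: valid_reduced_append last_word_inv)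
  next
    case False
    define u where "u = drop (Suc m) v"
    have l: "m < length v" "length u = m" "length (take m v) = m"
      using False v(3) by (auto simp: u_def m_def elim!: oddE)
    have vv: "take m v @ [v ! m] @ u = v"
      using id_take_nth_drop[OF l(1), symmetric] by (simp add: u_def)
    have "winv u @ [linv (v ! m)] @ winv (take m v) = winv (take m v @ [v ! m] @ u)"
      by (simp add: word_inv_Cons)
    also have "\<dots> = take m v @ [v ! m] @ u" by (simp only: vv v(2))
    finally have "take m v @ [v ! m] @ u = winv u @ [linv (v ! m)] @ winv (take m v)" by (rule sym)
    moreover have "length (take m v) = length (winv u)" using l by simp
    ultimately have "[v ! m] @ u = [linv (v ! m)] @ winv (take m v)" using app_eqD by blast
    then have "u = winv (take m v)" by (simp only: append_Cons append_Nil list.inject)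
    then have "v = take m v @ [v ! m] @ winv (take m v)" using vv by argo
    then show ?thesis by blast
  qed
qed

text \<open>A self-inverse \<open>v\<close> needs a self-inverse substitute: its middle letter
  stays, and the half \<open>p\<close> is shortened together with its mirror image. The weight of
  \<open>winv v\<close> is compared as well because inverse occurrences are replaced at the same
  time.\<close>

lemma short_replacement:
  assumes v: "vred v" "2 * card (Gam P \<Gamma>) + 5 \<le> length v"
  shows "\<exists>v'. vred v' \<and> same_shape v v' \<and> wt v' < wt v \<and> wt (winv v') < wt (winv v) \<and> (winv v = v \<longrightarrow> winv v' = v')"
proof (cases "winv v = v")
  case False
  have "v \<noteq> []" using v(2) by auto
  then obtain v' where v': "vred v'" "same_shape v v'" "set v' \<subseteq> Gam P \<Gamma>" "length v' \<le> card (Gam P \<Gamma>) + 1"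
    using short_shape v(1) by blast
  have "wt v' < length v" using wt_Gam[OF v'(3)] v'(4) v(2) by simp
  then have "wt v' < wt v" using length_le_wt[of v] vred_letters[OF v(1)] by fastforce
  moreover have "wt (winv v') < wt (winv v)"
  proof -
    have "set (winv v') \<subseteq> Gam P \<Gamma>" using v'(3) Gam_linv by (auto simp: word_inv_eq)
    then have "wt (winv v') < length (winv v)" using wt_Gam[of "winv v'"] v'(4) v(2) by simp
    also have "\<dots> \<le> wt (winv v)" using vred_winv[OF v(1)] by (intro length_le_wt) (simp add: valid_reduced_def)
    finally show ?thesis .
  qed
  ultimately show ?thesis using v' False by blast
next
  case True
  have "v \<noteq> []" using v(2) by auto
  then obtain p a where p: "v = p @ [a] @ winv p" using self_inverse_split[OF v(1) True] by blast
  have vp: "vred p" "letter a" using v(1) p by (auto simp: valid_reduced_append valid_reduced_Cons)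
  have lp: "card (Gam P \<Gamma>) + 2 \<le> length p" using v(2) p by simp
  then have "p \<noteq> []" by auto
  then obtain p' where p': "vred p'" "same_shape p p'" "set p' \<subseteq> Gam P \<Gamma>" "length p' \<le> card (Gam P \<Gamma>) + 1"
    using short_shape vp(1) by blast
  have sw: "same_shape (winv p) (winv p')" using p'(2) by (rule same_shape_word_inv)
  have "vred ([a] @ winv p)" using v(1) valid_reduced_append[of G P p "[a] @ winv p"] p by simp
  then have s1: "vred ([a] @ winv p')"
    by (rule valid_reduced_shape_append[OF _ same_shape_refl sw]) (use vp p'(1) in auto)
  have s2: "same_shape ([a] @ winv p) ([a] @ winv p')" using sw by (intro same_shape_append) simp
  have a: "linv a = a" using True p by (simp add: vp word_inv_Cons)
  let ?v' = "p' @ [a] @ winv p'"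
  have "vred ?v'"
    using v(1) unfolding p by (rule valid_reduced_shape_append[OF _ p'(2) s2 p'(1) s1])
  moreover have "same_shape v ?v'" unfolding p using p'(2) s2 by (rule same_shape_append)
  moreover have "winv ?v' = ?v'" using a p'(1) by (simp add: word_inv_Cons)
  moreover have "wt ?v' < wt v"
  proof -
    have "set (winv p') \<subseteq> Gam P \<Gamma>" using p'(3) Gam_linv by (auto simp: word_inv_eq)
    then have "wt (winv p') \<le> length p'" using wt_Gam by fastforce
    moreover have "wt p' \<le> length p'" using wt_Gam p'(3) by blast
    moreover have "length p \<le> wt p" using length_le_wt vred_letters vp(1) by blast
    moreover have "length p \<le> wt (winv p)" using length_le_wt[of "winv p"] vred_letters[of "winv p"] vp(1) by simp
    ultimately show ?thesis using lp p'(4) p by simp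
  qed
  ultimately show ?thesis using True by (intro exI[of _ ?v']) simp
qed

end

subsection \<open>Long factors cross a cut\<close>

context minimal_solution
begin

text \<open>Both sides of the middle piece, in each of the two factors and in their product.\<close>

definition step_cuts :: "word \<times> word \<Rightarrow> (word \<times> word) set" where
  "step_cuts xy = (case dec (fst xy) (snd xy) of (p, ma, q, mb, r, mc) \<Rightarrow>
     set [(p, ma @ q), (p @ ma, q), (winv q, mb @ r), (winv q @ mb, r), (p, mc @ r), (p @ mc, r)])"

text \<open>The cuts in front of the words \<open>\<sigma> X\<close> cannot be crossed; they are
  there so that large windows around them contain the solution.\<close>

definition cuts0 :: "(word \<times> word) set" where
  "cuts0 = (\<Union>xy\<in>stp. step_cuts xy) \<union> (\<lambda>X. ([], \<sigma> X)) ` \<Omega>"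

definition cuts :: "(word \<times> word) set" where
  "cuts = cuts0 \<union> (\<lambda>(s, t). (winv t, winv s)) ` cuts0"

definition wnodes :: "word set" where
  "wnodes = nodes \<union> winv ` nodes"

definition crosses :: "word \<Rightarrow> bool" where
  "crosses v \<longleftrightarrow> (\<exists>(s, t)\<in>cuts. straddle {v} s t)"

lemma dec_cuts:
  assumes "(x, y) \<in> stp" "dec x y = (p, ma, q, mb, r, mc)"
  shows "(p, ma @ q) \<in> cuts" "(p @ ma, q) \<in> cuts" "(winv q, mb @ r) \<in> cuts" "(winv q @ mb, r) \<in> cuts"
    "(p, mc @ r) \<in> cuts" "(p @ mc, r) \<in> cuts"
proof -
  have "step_cuts (x, y) \<subseteq> cuts" using assms(1) by (auto simp: cuts_def cuts0_def)
  moreover have "step_cuts (x, y) = set [(p, ma @ q), (p @ ma, q), (winv q, mb @ r), (winv q @ mb, r), (p, mc @ r), (p @ mc, r)]"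
    using assms(2) by (simp add: step_cuts_def)
  ultimately show "(p, ma @ q) \<in> cuts" "(p @ ma, q) \<in> cuts" "(winv q, mb @ r) \<in> cuts" "(winv q @ mb, r) \<in> cuts"
    "(p, mc @ r) \<in> cuts" "(p @ mc, r) \<in> cuts" by simp_all
qed

lemma cuts_bound: "finite cuts \<and> card cuts \<le> 2 * (6 * card stp + card \<Omega>)"
proof -
  have s: "finite (step_cuts xy)" "card (step_cuts xy) \<le> 6" for xy
  proof -
    obtain p ma q mb r mc where d: "dec (fst xy) (snd xy) = (p, ma, q, mb, r, mc)"
      by (cases "dec (fst xy) (snd xy)")
    let ?l = "[(p, ma @ q), (p @ ma, q), (winv q, mb @ r), (winv q @ mb, r), (p, mc @ r), (p @ mc, r)]"
    have e: "step_cuts xy = set ?l" using d by (simp add: step_cuts_def)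
    have "card (set ?l) \<le> length ?l" by (rule card_length)
    then show "finite (step_cuts xy)" "card (step_cuts xy) \<le> 6" unfolding e by simp_all
  qed
  have f: "finite cuts0" using s finite_steps finite_\<Omega> by (simp add: cuts0_def)
  have "card (\<Union>xy\<in>stp. step_cuts xy) \<le> (\<Sum>xy\<in>stp. card (step_cuts xy))"
    using finite_steps by (rule card_UN_le)
  also have "\<dots> \<le> 6 * card stp"
    using s sum_bounded_above[of stp "\<lambda>xy. card (step_cuts xy)" 6] by (simp add: mult.commute)
  finally have "card cuts0 \<le> 6 * card stp + card \<Omega>"
    using card_Un_le[of "\<Union>xy\<in>stp. step_cuts xy" "(\<lambda>X. ([], \<sigma> X)) ` \<Omega>"]
      card_image_le[OF finite_\<Omega>, of "\<lambda>X. ([] :: word, \<sigma> X)"] unfolding cuts0_def by linarith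
  then show ?thesis
    using f card_Un_le[of cuts0 "(\<lambda>(s, t). (winv t, winv s)) ` cuts0"]
      card_image_le[OF f, of "\<lambda>(s, t). (winv t, winv s)"] unfolding cuts_def by simp
qed

lemma cuts0_node: "(s, t) \<in> cuts0 \<Longrightarrow> s @ t \<in> nodes"
proof -
  assume st: "(s, t) \<in> cuts0"
  consider xy where "xy \<in> stp" "(s, t) \<in> step_cuts xy" | X where "X \<in> \<Omega>" "s = []" "t = \<sigma> X"
    using st by (auto simp: cuts0_def)
  then show ?thesis
  proof cases
    case 1
    obtain x y where xy: "xy = (x, y)" by (cases xy)
    obtain p ma q mb r mc where d: "dec x y = (p, ma, q, mb, r, mc)" by (cases "dec x y")
    have s: "(x, y) \<in> stp" using 1 xy by simp
    have "s @ t = x \<or> s @ t = y \<or> s @ t = red G (x @ y)"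
    proof -
      have D: "p @ ma @ q = x" "winv q @ mb @ r = y" "p @ mc @ r = red G (x @ y)"
        using dec[OF s d] unfolding decomp_def by metis+
      have "(s, t) \<in> set [(p, ma @ q), (p @ ma, q), (winv q, mb @ r), (winv q @ mb, r), (p, mc @ r), (p @ mc, r)]"
        using 1(2) xy d by (simp add: step_cuts_def)
      then have "s @ t = p @ ma @ q \<or> s @ t = winv q @ mb @ r \<or> s @ t = p @ mc @ r" by auto
      then show ?thesis by (simp only: D)
    qed
    then show ?thesis using node_step[OF s] node_red[OF s] by auto
  next
    case 2
    then show ?thesis using \<sigma>_node by simp
  qed
qed

lemma cuts_wnode: "(s, t) \<in> cuts \<Longrightarrow> s @ t \<in> wnodes"
proof -
  assume st: "(s, t) \<in> cuts"
  show ?thesis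
  proof (cases "(s, t) \<in> cuts0")
    case True
    then show ?thesis using cuts0_node by (simp add: wnodes_def)
  next
    case False
    then obtain s' t' where e: "(s', t') \<in> cuts0" "s = winv t'" "t = winv s'"
      using st by (auto simp: cuts_def)
    then have "s @ t = winv (s' @ t')" by simp
    then show ?thesis using cuts0_node[OF e(1)] unfolding wnodes_def by blast
  qed
qed

lemma vred_wnode: "w \<in> wnodes \<Longrightarrow> vred w"
  using vred_node by (auto simp: wnodes_def)

lemma finite_wnodes: "finite wnodes"
  using finite_\<Omega> finite_steps by (simp add: wnodes_def nodes_def)

lemma cuts_winv: "(s, t) \<in> cuts \<Longrightarrow> (winv t, winv s) \<in> cuts"
proof -
  assume st: "(s, t) \<in> cuts"
  show ?thesis
  proof (cases "(s, t) \<in> cuts0")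
    case True
    then show ?thesis by (force simp: cuts_def)
  next
    case False
    then obtain s' t' where e: "(s', t') \<in> cuts0" "s = winv t'" "t = winv s'"
      using st by (auto simp: cuts_def)
    have "vred s'" "vred t'" using vred_node[OF cuts0_node[OF e(1)]] by (auto simp: valid_reduced_append)
    then show ?thesis using e by (simp add: cuts_def)
  qed
qed

lemma crosses_winv:
  assumes "crosses (winv v)" "vred v" shows "crosses v"
proof -
  obtain s t d1 d2 where st: "(s, t) \<in> cuts" "d1 @ d2 = winv v" "d1 \<noteq> []" "d2 \<noteq> []" "suffix d1 s" "prefix d2 t"
    using assms(1) by (auto simp: crosses_def straddle_def)
  have "winv (d1 @ d2) = v" unfolding st(2) using assms(2) by simp
  then have v: "v = winv d2 @ winv d1" by simp
  have "straddle {v} (winv t) (winv s)"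
    using st v by (intro straddleI[of "winv d2" "winv d1"]) (auto simp: suffix_def prefix_def)
  then show ?thesis unfolding crosses_def using cuts_winv[OF st(1)] by blast
qed

lemma vred_sublist: "vred w \<Longrightarrow> sublist v w \<Longrightarrow> vred v"
  by (auto simp: sublist_def valid_reduced_append)

lemma sublist_winv: "sublist v w \<Longrightarrow> sublist (winv v) (winv w)"
  by (fastforce simp: sublist_def)

text \<open>Uncut occurrences let the scan treat the pieces between cuts separately, so it meets the
  conditions of \<open>wt_not_decreased\<close> and yet makes some variable lighter.\<close>

lemma no_uncrossed_replacement:
  assumes rep: "replacement G P \<Gamma> k D g"
    and cross: "\<And>s t. (s, t) \<in> cuts \<Longrightarrow> \<not> straddle D s t"
    and iso: "\<And>w. w \<in> wnodes \<Longrightarrow> replacement.isolated D w"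
    and d: "d \<in> D" "w \<in> nodes" "sublist d w"
  shows False
proof -
  interpret replacement G P \<Gamma> k D g by (rule rep)
  have iso: "isolated w" if "w \<in> nodes" for w using iso that by (simp add: wnodes_def)
  \<comment> \<open>An occurrence in a product is not cut, and \<open>mc\<close> is too short for
    it, so it lies in \<open>p\<close> or \<open>r\<close> and hence in a factor. Going back along
    the chain it ends up in a variable.\<close>
  have sub: "\<exists>x. fst x \<in> \<Omega> \<and> sublist d (sig x)"
  proof -
    have "sublist d w \<longrightarrow> (\<exists>x. fst x \<in> \<Omega> \<and> sublist d (sig x))"
    proof (rule node_induct(1)[of "\<lambda>w. sublist d w \<longrightarrow> (\<exists>x. fst x \<in> \<Omega> \<and> sublist d (sig x))", OF _ _ _ d(2)])
      show "sublist d [] \<longrightarrow> (\<exists>x. fst x \<in> \<Omega> \<and> sublist d (sig x))"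
        using length_D[OF d(1)] k by auto
    next
      fix x y assume xy: "(x, y) \<in> stp"
        and IH: "sublist d x \<longrightarrow> (\<exists>x. fst x \<in> \<Omega> \<and> sublist d (sig x))"
          "sublist d y \<longrightarrow> (\<exists>x. fst x \<in> \<Omega> \<and> sublist d (sig x))"
      obtain p ma q mb r mc where dd: "dec x y = (p, ma, q, mb, r, mc)" by (cases "dec x y")
      have z: "x = p @ ma @ q" "y = winv q @ mb @ r" "red G (x @ y) = p @ mc @ r" "length mc \<le> 1"
        using dec[OF xy dd] unfolding decomp_def by blast+
      note c = dec_cuts[OF xy dd]
      show "sublist d (red G (x @ y)) \<longrightarrow> (\<exists>x. fst x \<in> \<Omega> \<and> sublist d (sig x))"
      proof
        assume "sublist d (red G (x @ y))"
        then have "sublist d ((p @ mc) @ r)" using z by simp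
        then have "sublist d (p @ mc) \<or> sublist d r"
          using sublist_append_straddle d(1) cross[OF c(6)] by blast
        moreover have "sublist d p \<or> sublist d mc" if "sublist d (p @ mc)"
        proof (rule sublist_append_straddle[OF that d(1)])
          show "\<not> straddle D p mc" using cross[OF c(5)] unfolding straddle_def by (meson prefix_prefix)
        qed
        moreover have "\<not> sublist d mc" using sublist_length_le[of d mc] length_D[OF d(1)] k z(4) by linarith
        ultimately have "sublist d p \<or> sublist d r" by blast
        moreover have "sublist d x" if "sublist d p" unfolding z(1) using that by (simp add: sublist_append)
        moreover have "sublist d y" if "sublist d r" unfolding z(2) using that by (simp add: sublist_append)
        ultimately show "\<exists>x. fst x \<in> \<Omega> \<and> sublist d (sig x)" using IH by blast
      qed
    qed blast
    then show ?thesis using d(3) by blast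
  qed
  then obtain x where x: "fst x \<in> \<Omega>" "sublist d (sig x)" by blast
  have "wt (rp (sig x)) = wt (sig x)"
  proof (rule wt_not_decreased[OF _ _ _ _ x(1)])
    show "rp (winv (\<sigma> X)) = winv (rp (\<sigma> X))" if "X \<in> \<Omega>" for X
      using repl_winv[OF iso node_letter] \<sigma>_node[OF that] by blast
    show "vred (rp w) \<and> same_shape w (rp w)" if "w \<in> nodes" for w
      using repl_shape[OF vred_node[OF that]] .
    show "wt (rp (sig x)) \<le> wt (sig x)" for x by (rule repl_wt)
    fix x y assume xy: "(x, y) \<in> stp"
    obtain p ma q mb r mc where dd: "dec x y = (p, ma, q, mb, r, mc)" by (cases "dec x y")
    have z: "x = p @ ma @ q" "y = winv q @ mb @ r" "red G (x @ y) = p @ mc @ r" "red G (ma @ mb) = mc"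
      "length ma \<le> 1" "length mb \<le> 1" "length mc \<le> 1"
      using dec[OF xy dd] unfolding decomp_def by blast+
    note c = dec_cuts[OF xy dd]
    \<comment> \<open>The two cuts enclose \<open>m\<close>, and a word of at most one letter is
      left unchanged.\<close>
    have split: "rp (s @ m @ t) = rp s @ m @ rp t"
      if st: "(s, m @ t) \<in> cuts" "(s @ m, t) \<in> cuts" "length m \<le> 1" for s m t
    proof -
      have "\<not> straddle D m t" using cross[OF st(2)] straddle_suffix[of D m t "s @ m"] by (auto simp: suffix_def)
      then have "rp (m @ t) = m @ rp t" using repl_append repl_short[of m] st(3) k by simp
      then show ?thesis using repl_append[OF cross[OF st(1)]] by simp
    qed
    have "isolated q" using isolated_sublist[OF iso[OF node_step(1)[OF xy]], of q] z(1) by (simp add: sublist_append)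
    moreover have "\<forall>a\<in>set q. letter a" using node_letter[OF node_step(1)[OF xy]] z(1) by simp
    ultimately have q: "rp (winv q) = winv (rp q)" by (rule repl_winv)
    have "rp x = rp p @ ma @ rp q" "rp y = winv (rp q) @ mb @ rp r"
      using split[OF c(1,2)] split[OF c(3,4)] z q by simp_all
    moreover have "rp (red G (x @ y)) = rp p @ red G (ma @ mb) @ rp r"
      unfolding z(3,4) using split[OF c(5,6)] z(7) by simp
    ultimately show "\<exists>p ma q mb r. rp x = p @ ma @ q \<and> rp y = winv q @ mb @ r
       \<and> rp (red G (x @ y)) = p @ red G (ma @ mb) @ r" by blast
  qed
  then show False using repl_wt_less[OF d(1) x(2)] by simp
qed

definition K :: nat where
  "K = 2 * card (Gam P \<Gamma>) + 5"

text \<open>A longest factor without crossing occurrence has no overlapping occurrences: the union of two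
  of them would be longer, hence cross a cut, and then one of them would cross it too. So all
  its occurrences can be replaced at once by something shorter.\<close>
lemma long_factor_crosses:
  assumes "w0 \<in> wnodes" "sublist v0 w0" "K \<le> length v0"
  shows "crosses v0"
proof (rule ccontr)
  assume n: "\<not> crosses v0"
  define Q where "Q v \<longleftrightarrow> (\<exists>w\<in>wnodes. sublist v w) \<and> K \<le> length v \<and> \<not> crosses v" for v
  have "Q v0" using assms n by (auto simp: Q_def)
  moreover have "\<forall>v. Q v \<longrightarrow> length v < Suc (Max (length ` wnodes))"
  proof (intro allI impI)
    fix v assume "Q v"
    then obtain w where w: "w \<in> wnodes" "sublist v w" by (auto simp: Q_def)
    then have "length w \<le> Max (length ` wnodes)" using finite_wnodes by simp
    then show "length v < Suc (Max (length ` wnodes))" using sublist_length_le[OF w(2)] by simp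
  qed
  ultimately obtain v where v: "Q v" and max: "\<And>u. Q u \<Longrightarrow> length u \<le> length v"
    using ex_has_greatest_nat[of Q v0 length] by blast
  obtain w where w: "w \<in> wnodes" "sublist v w" using v by (auto simp: Q_def)
  have vv: "vred v" using vred_sublist vred_wnode w by blast
  have len: "K \<le> length v" using v by (simp add: Q_def)
  obtain v' where v': "vred v'" "same_shape v v'" "wt v' < wt v" "wt (winv v') < wt (winv v)" "winv v = v \<longrightarrow> winv v' = v'"
    using short_replacement[OF vv] len by (auto simp: K_def)
  \<comment> \<open>If \<open>v\<close> is self-inverse, \<open>D\<close> has one element, and
    \<open>winv v' = v'\<close> keeps \<open>g\<close> compatible with inversion.\<close>
  define D where "D = {v, winv v}"
  define g where "g d = (if d = v then v' else winv v')" for d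
  have rep: "replacement G P \<Gamma> (length v) D g"
  proof
    show "2 \<le> length v" using len by (simp add: K_def)
    fix d assume d: "d \<in> D"
    show "length d = length v" "vred d" "winv d \<in> D" using d vv by (auto simp: D_def)
    show "g (winv d) = winv (g d)" using d vv v' by (auto simp: D_def g_def)
    show "vred (g d) \<and> same_shape d (g d)" "wt (g d) < wt d"
      using d v' vv same_shape_word_inv by (auto simp: D_def g_def)
  qed
  have nc: "\<not> crosses d" if "d \<in> D" for d
    using that v crosses_winv[of v] vv by (auto simp: D_def Q_def)
  obtain d u where d: "d \<in> D" "u \<in> nodes" "sublist d u"
  proof (cases "w \<in> nodes")
    case True
    then show ?thesis using that[of v w] w by (simp add: D_def)
  next
    case False
    then obtain u where u: "u \<in> nodes" "w = winv u" using w(1) by (auto simp: wnodes_def)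
    then have "sublist (winv v) u" using sublist_winv[OF w(2)] vred_node by simp
    then show ?thesis using that[of "winv v" u] u by (simp add: D_def)
  qed
  show False
  proof (rule no_uncrossed_replacement[OF rep _ _ d])
    show "\<not> straddle D s t" if "(s, t) \<in> cuts" for s t
    proof
      assume "straddle D s t"
      then obtain e where "e \<in> D" "straddle {e} s t" by (auto simp: straddle_def)
      then show False using nc that unfolding crosses_def by blast
    qed
    fix u assume u: "u \<in> wnodes"
    show "replacement.isolated D u"
      unfolding replacement.isolated_def[OF rep]
    proof (intro allI impI notI)
      fix d t assume dt: "sublist (d @ t) u \<and> d \<in> D" and "straddle D d t"
      then obtain d1 d2 where d12: "d1 @ d2 \<in> D" "d1 \<noteq> []" "d2 \<noteq> []" "suffix d1 d" "prefix d2 t"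
        by (auto simp: straddle_def)
      obtain d0 where d0: "d = d0 @ d1" using d12(4) by (auto simp: suffix_def)
      have "length d = length v" using dt by (auto simp: D_def)
      then have "length v < length (d @ d2)" using d12(3) by simp
      moreover have "sublist (d @ d2) u"
      proof -
        have "prefix (d @ d2) (d @ t)" using d12(5) by simp
        then show ?thesis using dt prefix_imp_sublist sublist_order.order_trans by blast
      qed
      ultimately have "crosses (d @ d2)" using max[of "d @ d2"] u len unfolding Q_def by fastforce
      then obtain s' t' u1 u2 where c: "(s', t') \<in> cuts" "u1 @ u2 = d @ d2" "u1 \<noteq> []" "u2 \<noteq> []"
        "suffix u1 s'" "prefix u2 t'" by (auto simp: crosses_def straddle_def)
      show False
      \<comment> \<open>The crossing point of \<open>d @ d2\<close> lies inside \<open>d\<close>, or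
        else at its end or later, and then inside the second occurrence
        \<open>d1 @ d2\<close>.\<close>
      proof (cases "length u1 < length d")
        case True
        then obtain e where e: "d = u1 @ e" "u2 = e @ d2" "e \<noteq> []"
          using c(2) by (auto simp: append_eq_append_conv2)
        have "straddle {d} s' t'"
          using c e by (intro straddleI[of u1 e]) (auto simp: prefix_def)
        then show False using nc dt c(1) unfolding crosses_def by blast
      next
        case False
        then obtain e where e: "u1 = d @ e" "d2 = e @ u2"
          using c(2) by (auto simp: append_eq_append_conv2)
        have "suffix (d1 @ e) s'" using c(5) unfolding e d0 by (auto simp: suffix_def)
        then have "straddle {d1 @ d2} s' t'"
          using c e d12 by (intro straddleI[of "d1 @ e" u2]) auto
        then show False using nc d12(1) c(1) unfolding crosses_def by blast
      qed
    qed
  qed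
qed

end

subsection \<open>Compression of words over the letters\<close>

text \<open>A straight-line program over an alphabet is modelled by the set of the values of its variables.\<close>
definition cat_closed :: "'a list set \<Rightarrow> bool" where
  "cat_closed S \<longleftrightarrow> finite S \<and> (\<forall>w\<in>S. w \<noteq> [] \<and> (length w = 1 \<or> (\<exists>u\<in>S. \<exists>v\<in>S. w = u @ v)))"

lemma cat_closed_insert: "cat_closed S \<Longrightarrow> u \<in> S \<Longrightarrow> v \<in> S \<Longrightarrow> cat_closed (insert (u @ v) S)"
  unfolding cat_closed_def by auto

text \<open>All words of a parse tree lie in \<open>S\<close>, and \<open>d\<close> bounds its
  height from above. Height is tracked apart from \<open>card S\<close> because it alone governs the
  cost of extracting a factor.\<close>

inductive derivable :: "'a list set \<Rightarrow> nat \<Rightarrow> 'a list \<Rightarrow> bool" for S where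
  leaf: "[a] \<in> S \<Longrightarrow> derivable S d [a]"
| node: "u @ v \<in> S \<Longrightarrow> derivable S d u \<Longrightarrow> derivable S d v \<Longrightarrow> derivable S (Suc d) (u @ v)"

lemma derivable_in: "derivable S d w \<Longrightarrow> w \<in> S"
  by (induction rule: derivable.induct) auto

lemma derivable_mono: "derivable S d w \<Longrightarrow> S \<subseteq> S' \<Longrightarrow> d \<le> d' \<Longrightarrow> derivable S' d' w"
proof (induction arbitrary: d' rule: derivable.induct)
  case (leaf a d)
  then show ?case by (auto intro: derivable.leaf)
next
  case (node u v d)
  then obtain e where "d' = Suc e" "d \<le> e" by (cases d') auto
  then show ?case using node by (auto intro: derivable.node)
qed

lemma derivable_Suc: "derivable S d w \<Longrightarrow> derivable S (Suc d) w"
  by (rule derivable_mono) auto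

text \<open>Descend to the end of the prefix. Each level that enters the right half adds one word,
  the left half followed by the prefix extracted from the right half.\<close>

lemma derivable_prefix:
  assumes "derivable S d w" "cat_closed S" "prefix v w" "v \<noteq> []"
  shows "\<exists>S'. S \<subseteq> S' \<and> cat_closed S' \<and> card S' \<le> card S + d \<and> derivable S' d v"
  using assms
proof (induction arbitrary: v rule: derivable.induct)
  case (leaf a d)
  then have "v = [a]" by (auto simp: prefix_Cons)
  then show ?case using leaf.hyps leaf.prems(1) by (intro exI[of _ S]) (simp add: derivable.leaf)
next
  case (node u w d)
  show ?case
  proof (cases "prefix v u")
    case True
    then obtain S' where "S \<subseteq> S'" "cat_closed S'" "card S' \<le> card S + d" "derivable S' d v"
      using node by blast
    then show ?thesis by (intro exI[of _ S'] conjI derivable_Suc) simp_all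
  next
    case False
    then obtain v' where v': "v = u @ v'" "prefix v' w" "v' \<noteq> []"
      using node.prems(2) by (auto simp: prefix_append)
    then obtain S' where S': "S \<subseteq> S'" "cat_closed S'" "card S' \<le> card S + d" "derivable S' d v'"
      using node by blast
    let ?S = "insert v S'"
    have u: "derivable S' d u" using derivable_mono[OF node.hyps(2) S'(1)] by simp
    have "cat_closed ?S" unfolding v'(1) using S' u by (intro cat_closed_insert derivable_in[of S' d])
    moreover have "derivable ?S (Suc d) v"
      unfolding v'(1) by (rule derivable.node) (auto intro: derivable_mono[OF u] derivable_mono[OF S'(4)])
    moreover have "card ?S \<le> card S + Suc d"
      using S'(2,3) by (simp add: cat_closed_def card_insert_if)
    ultimately show ?thesis using S'(1) by (intro exI[of _ ?S]) auto
  qed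
qed

lemma derivable_suffix:
  assumes "derivable S d w" "cat_closed S" "suffix v w" "v \<noteq> []"
  shows "\<exists>S'. S \<subseteq> S' \<and> cat_closed S' \<and> card S' \<le> card S + d \<and> derivable S' d v"
  using assms
proof (induction arbitrary: v rule: derivable.induct)
  case (leaf a d)
  then have "v = [a]" by (auto simp: suffix_Cons)
  then show ?case using leaf.hyps leaf.prems(1) by (intro exI[of _ S]) (simp add: derivable.leaf)
next
  case (node u w d)
  show ?case
  proof (cases "suffix v w")
    case True
    then obtain S' where "S \<subseteq> S'" "cat_closed S'" "card S' \<le> card S + d" "derivable S' d v"
      using node by blast
    then show ?thesis by (intro exI[of _ S'] conjI derivable_Suc) simp_all
  next
    case False
    then obtain v' where v': "v = v' @ w" "suffix v' u"
      using node.prems(2) unfolding suffix_append by blast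
    moreover from this have "v' \<noteq> []" using False by (intro notI) simp
    ultimately obtain S' where S': "S \<subseteq> S'" "cat_closed S'" "card S' \<le> card S + d" "derivable S' d v'"
      using node by blast
    let ?S = "insert v S'"
    have w: "derivable S' d w" using derivable_mono[OF node.hyps(3) S'(1)] by simp
    have "cat_closed ?S" unfolding v'(1) using S' w by (intro cat_closed_insert derivable_in[of S' d])
    moreover have "derivable ?S (Suc d) v"
      unfolding v'(1) by (rule derivable.node) (auto intro: derivable_mono[OF w] derivable_mono[OF S'(4)])
    moreover have "card ?S \<le> card S + Suc d"
      using S'(2,3) by (simp add: cat_closed_def card_insert_if)
    ultimately show ?thesis using S'(1) by (intro exI[of _ ?S]) auto
  qed
qed

text \<open>Go down to the node where the factor meets both halves. There it is a suffix of the left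
  half followed by a prefix of the right half, which costs
  \<open>d + d + 1 \<le> 2 * Suc d\<close>.\<close>

lemma derivable_sublist:
  assumes "derivable S d w" "cat_closed S" "sublist v w" "v \<noteq> []"
  shows "\<exists>S'. S \<subseteq> S' \<and> cat_closed S' \<and> card S' \<le> card S + 2 * d \<and> derivable S' d v"
  using assms
proof (induction arbitrary: v rule: derivable.induct)
  case (leaf a d)
  then have "v = [a]" by (auto simp: sublist_Cons_right prefix_Cons)
  then show ?case using leaf.hyps leaf.prems(1) by (intro exI[of _ S]) (simp add: derivable.leaf)
next
  case (node u w d)
  have IH: ?case
    if ex: "\<exists>S'. S \<subseteq> S' \<and> cat_closed S' \<and> card S' \<le> card S + 2 * d \<and> derivable S' d v"
  proof -
    obtain S' where "S \<subseteq> S'" "cat_closed S'" "card S' \<le> card S + 2 * d" "derivable S' d v"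
      using ex by blast
    then show ?thesis by (intro exI[of _ S'] conjI derivable_Suc) simp_all
  qed
  show ?case
  proof (cases "straddle {v} u w")
    case False
    from sublist_append_straddle[OF node.prems(2) singletonI False] show ?thesis
    proof
      assume "sublist v u"
      then show ?thesis using node.IH(1)[OF node.prems(1) _ node.prems(3)] by (intro IH)
    next
      assume "sublist v w"
      then show ?thesis using node.IH(2)[OF node.prems(1) _ node.prems(3)] by (intro IH)
    qed
  next
    case True
    then obtain v1 v2 where "v1 @ v2 \<in> {v}" "suffix v1 u" "prefix v2 w" "v1 \<noteq> []" "v2 \<noteq> []"
      unfolding straddle_def by blast
    then have 3: "v = v1 @ v2" "suffix v1 u" "prefix v2 w" "v1 \<noteq> []" "v2 \<noteq> []" by simp_all
    obtain S1 where S1: "S \<subseteq> S1" "cat_closed S1" "card S1 \<le> card S + d" "derivable S1 d v1"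
      using derivable_suffix[OF node.hyps(2) node.prems(1) 3(2,4)] by blast
    have "derivable S1 d w" using derivable_mono[OF node.hyps(3) S1(1)] by simp
    then obtain S2 where S2: "S1 \<subseteq> S2" "cat_closed S2" "card S2 \<le> card S1 + d" "derivable S2 d v2"
      using derivable_prefix[OF _ S1(2) 3(3,5)] by blast
    let ?S = "insert v S2"
    have v1: "derivable S2 d v1" using derivable_mono[OF S1(4) S2(1)] by simp
    have "cat_closed ?S" unfolding 3(1) using S2 v1 by (intro cat_closed_insert derivable_in[of S2 d])
    moreover have "derivable ?S (Suc d) v"
      unfolding 3(1) by (rule derivable.node) (auto intro: derivable_mono[OF v1] derivable_mono[OF S2(4)])
    moreover have "card ?S \<le> card S + 2 * Suc d"
      using S1(3) S2(2,3) by (simp add: cat_closed_def card_insert_if)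
    ultimately show ?thesis using S1(1) S2(1) by (intro exI[of _ ?S]) auto
  qed
qed

text \<open>Quantifying over all programs above \<open>S0\<close> lets additions be chained with
  their costs summed. The empty word is treated apart because \<open>cat_closed\<close> excludes
  it.\<close>

definition addable :: "'a list set \<Rightarrow> nat \<Rightarrow> nat \<Rightarrow> 'a list \<Rightarrow> bool" where
  "addable S0 c d w \<longleftrightarrow> (\<forall>S. S0 \<subseteq> S \<and> cat_closed S \<longrightarrow>
     (\<exists>S'. S \<subseteq> S' \<and> cat_closed S' \<and> card S' \<le> card S + c \<and> (w = [] \<or> derivable S' d w)))"

lemma addableE:
  assumes "addable S0 c d w" "S0 \<subseteq> S" "cat_closed S"
  obtains S' where "S \<subseteq> S'" "cat_closed S'" "card S' \<le> card S + c" "w = [] \<or> derivable S' d w"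
  using assms unfolding addable_def by blast

lemma addable_mono:
  assumes "addable S0 c d w" "c \<le> c'" "d \<le> d'" shows "addable S0 c' d' w"
  unfolding addable_def
proof (intro allI impI)
  fix S assume "S0 \<subseteq> S \<and> cat_closed S"
  then obtain S' where "S \<subseteq> S'" "cat_closed S'" "card S' \<le> card S + c" "w = [] \<or> derivable S' d w"
    using addableE[OF assms(1)] by blast
  then show "\<exists>S'. S \<subseteq> S' \<and> cat_closed S' \<and> card S' \<le> card S + c' \<and> (w = [] \<or> derivable S' d' w)"
    using assms(2,3) derivable_mono[of S' d w S' d'] by (intro exI[of _ S']) auto
qed

lemma addable_derivable: "w = [] \<or> derivable S0 d w \<Longrightarrow> addable S0 0 d w"
  unfolding addable_def
proof (intro allI impI)
  fix S assume w: "w = [] \<or> derivable S0 d w" and S: "S0 \<subseteq> S \<and> cat_closed S"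
  then have "w = [] \<or> derivable S d w" using derivable_mono[of S0 d w S d] by blast
  then show "\<exists>S'. S \<subseteq> S' \<and> cat_closed S' \<and> card S' \<le> card S + 0 \<and> (w = [] \<or> derivable S' d w)"
    using S by (intro exI[of _ S]) simp
qed

lemma addable_sublist:
  assumes "derivable S0 d w" "sublist v w" shows "addable S0 (2 * d) d v"
  unfolding addable_def
proof (intro allI impI)
  fix S assume S: "S0 \<subseteq> S \<and> cat_closed S"
  show "\<exists>S'. S \<subseteq> S' \<and> cat_closed S' \<and> card S' \<le> card S + 2 * d \<and> (v = [] \<or> derivable S' d v)"
  proof (cases "v = []")
    case True
    then show ?thesis using S by (intro exI[of _ S]) auto
  next
    case False
    have "derivable S d w" using derivable_mono[OF assms(1)] S by blast
    then show ?thesis using derivable_sublist[of S d w v] S assms(2) False by blast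
  qed
qed

lemma addable_append:
  assumes "addable S0 c1 d u" "addable S0 c2 d v" shows "addable S0 (c1 + c2 + 1) (Suc d) (u @ v)"
  unfolding addable_def
proof (intro allI impI)
  fix S assume S: "S0 \<subseteq> S \<and> cat_closed S"
  obtain S1 where S1: "S \<subseteq> S1" "cat_closed S1" "card S1 \<le> card S + c1" "u = [] \<or> derivable S1 d u"
    using addableE[OF assms(1)] S by blast
  obtain S2 where S2: "S1 \<subseteq> S2" "cat_closed S2" "card S2 \<le> card S1 + c2" "v = [] \<or> derivable S2 d v"
    using addableE[OF assms(2), of S1] S S1 by blast
  have u: "u = [] \<or> derivable S2 d u" using S1(4) derivable_mono[of S1 d u S2 d] S2(1) by blast
  show "\<exists>S'. S \<subseteq> S' \<and> cat_closed S' \<and> card S' \<le> card S + (c1 + c2 + 1) \<and> (u @ v = [] \<or> derivable S' (Suc d) (u @ v))"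
  proof (cases "u = [] \<or> v = []")
    case True
    then have "u @ v = [] \<or> derivable S2 d (u @ v)" using u S2(4) by auto
    then have "u @ v = [] \<or> derivable S2 (Suc d) (u @ v)" using derivable_mono[of S2 d "u @ v" S2 "Suc d"] by auto
    then show ?thesis using S1 S2 by (intro exI[of _ S2]) auto
  next
    case False
    then have uv: "derivable S2 d u" "derivable S2 d v" using u S2(4) by auto
    let ?S = "insert (u @ v) S2"
    have "cat_closed ?S" using S2(2) uv by (intro cat_closed_insert derivable_in[of S2 d])
    moreover have "derivable ?S (Suc d) (u @ v)"
      by (rule derivable.node) (auto intro: derivable_mono[OF uv(1)] derivable_mono[OF uv(2)])
    moreover have "card ?S \<le> card S + (c1 + c2 + 1)"
      using S1(3) S2(2,3) by (simp add: cat_closed_def card_insert_if)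
    ultimately show ?thesis using S1(1) S2(1) by (intro exI[of _ ?S]) auto
  qed
qed

lemma addable_letters:
  assumes "\<forall>a\<in>set w. [a] \<in> S0" shows "addable S0 (length w) (length w) w"
  using assms
proof (induction w)
  case Nil
  show ?case by (simp add: addable_derivable)
next
  case (Cons a w)
  have "addable S0 0 (length w) [a]" using Cons.prems by (intro addable_derivable) (auto intro: derivable.leaf)
  moreover have "addable S0 (length w) (length w) w" using Cons by simp
  ultimately have "addable S0 (0 + length w + 1) (Suc (length w)) ([a] @ w)" by (rule addable_append)
  then show ?case by simp
qed

lemma addable_all:
  assumes "finite Q" "\<And>w. w \<in> Q \<Longrightarrow> addable S0 c d w" "cat_closed S0"
  shows "\<exists>S. S0 \<subseteq> S \<and> cat_closed S \<and> card S \<le> card S0 + card Q * c \<and> (\<forall>w\<in>Q. w = [] \<or> derivable S d w)"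
  using assms(1,2)
proof (induction Q)
  case empty
  show ?case using assms(3) by (intro exI[of _ S0]) auto
next
  case (insert x Q)
  then obtain S where S: "S0 \<subseteq> S" "cat_closed S" "card S \<le> card S0 + card Q * c"
    "\<forall>w\<in>Q. w = [] \<or> derivable S d w" by auto
  obtain S' where S': "S \<subseteq> S'" "cat_closed S'" "card S' \<le> card S + c" "x = [] \<or> derivable S' d x"
    using addableE[OF insert.prems[of x] S(1,2)] by blast
  have "\<forall>w\<in>insert x Q. w = [] \<or> derivable S' d w"
    using S(4) S'(4) derivable_mono[OF _ S'(1) order_refl] by blast
  moreover have "card S' \<le> card S0 + card (insert x Q) * c"
    using S(3) S'(3) insert.hyps by simp
  ultimately show ?case using S(1) S'(1,2) by (intro exI[of _ S']) auto
qed

section \<open>Doubling the windows around the cuts\<close>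

context minimal_solution
begin

lemma letters_linv: "a \<in> letters \<Longrightarrow> linv a \<in> letters"
  using Gam_linv[of a] cmids_linv[of a] unfolding letters_def by (auto simp: involutions_def)

lemma wnode_letters_sub: "w \<in> wnodes \<Longrightarrow> set w \<subseteq> letters"
proof -
  assume "w \<in> wnodes"
  then consider "w \<in> nodes" | u where "u \<in> nodes" "w = winv u" by (auto simp: wnodes_def)
  then show ?thesis
  proof cases
    case 2
    then have "set w = linv ` set u" by (simp add: word_inv_eq)
    then show ?thesis
      using node_letters_sub[OF 2(1)] letters_linv by (simp only: image_subset_iff) (rule ballI, erule letters_linv[OF subsetD])
  qed (rule node_letters_sub)
qed

definition window :: "nat \<Rightarrow> word \<times> word \<Rightarrow> word" where
  "window i st = drop (length (fst st) - K * 2 ^ i) (fst st) @ take (K * 2 ^ i) (snd st)"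

definition singles :: "word set" where
  "singles = (\<lambda>a. [a]) ` letters"

lemma singles: "cat_closed singles" "card singles = card letters"
  using letters_bound by (auto simp: cat_closed_def singles_def card_image inj_on_def)

text \<open>Short factors are spelled out letter by letter. A factor of length at least
  \<open>K\<close> occurs across some cut and, being no longer than the radius
  \<open>K * 2 ^ i\<close>, lies within the window of that cut.\<close>

lemma factor_addable:
  assumes S: "singles \<subseteq> S" "\<forall>st\<in>cuts. window i st = [] \<or> derivable S d (window i st)" "K \<le> d"
    and v: "w \<in> wnodes" "sublist v w" "length v \<le> K * 2 ^ i"
  shows "addable S (K + 2 * d) d v"
proof (cases "length v < K")
  case True
  have "set v \<subseteq> letters" using wnode_letters_sub[OF v(1)] set_mono_sublist[OF v(2)] by blast
  then have "\<forall>a\<in>set v. [a] \<in> S" using S(1) by (auto simp: singles_def)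
  then show ?thesis using True S(3) by (intro addable_mono[OF addable_letters]) auto
next
  case False
  then have "crosses v" using long_factor_crosses v(1,2) by simp
  then obtain s t v1 v2 where c: "(s, t) \<in> cuts" "v = v1 @ v2" "v1 \<noteq> []" "suffix v1 s" "prefix v2 t"
    by (auto simp: crosses_def straddle_def)
  obtain s0 where s0: "s = s0 @ v1" using c(4) by (auto simp: suffix_def)
  obtain t0 where t0: "t = v2 @ t0" using c(5) by (auto simp: prefix_def)
  have l: "length v1 \<le> K * 2 ^ i" "length v2 \<le> K * 2 ^ i" using v(3) c(2) by auto
  have "drop (length s - K * 2 ^ i) s = drop (length s - K * 2 ^ i) s0 @ v1"
    using l(1) unfolding s0 by simp
  moreover have "take (K * 2 ^ i) t = v2 @ take (K * 2 ^ i - length v2) t0"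
    using l(2) unfolding t0 by simp
  ultimately have w: "window i (s, t) = drop (length s - K * 2 ^ i) s0 @ v @ take (K * 2 ^ i - length v2) t0"
    unfolding window_def c(2) by simp
  then have "sublist v (window i (s, t))" by (auto simp: sublist_def)
  moreover have "window i (s, t) \<noteq> []" using w c(2,3) by simp
  then have "derivable S d (window i (s, t))" using S(2) c(1) by blast
  ultimately have "addable S (2 * d) d v" using addable_sublist by blast
  then show ?thesis by (rule addable_mono) auto
qed

text \<open>A new window is an old one with a factor added on each side. With
  \<open>d = 2 * K + 2 * i\<close> this costs \<open>2 * (K + 2 * d)\<close> for the factors and 2
  for the concatenations, which is \<open>10 * K + 8 * i + 2\<close>, and adds two to the
  depth.\<close>

lemma windows_derivable:
  "\<exists>S. singles \<subseteq> S \<and> cat_closed S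
    \<and> card S \<le> card letters + card cuts * (2 * K + i * (10 * K + 8 * i + 2))
    \<and> (\<forall>st\<in>cuts. window i st = [] \<or> derivable S (2 * K + 2 * i) (window i st))"
proof (induction i)
  case 0
  have "\<exists>S. singles \<subseteq> S \<and> cat_closed S \<and> card S \<le> card singles + card (window 0 ` cuts) * (2 * K)
    \<and> (\<forall>w\<in>window 0 ` cuts. w = [] \<or> derivable S (2 * K) w)"
  proof (rule addable_all[OF _ _ singles(1)])
    show "finite (window 0 ` cuts)" using cuts_bound by simp
    fix w assume "w \<in> window 0 ` cuts"
    then obtain s t where st: "(s, t) \<in> cuts" "w = window 0 (s, t)" by auto
    have "set w \<subseteq> set (s @ t)" unfolding st(2) window_def by (auto dest: in_set_dropD in_set_takeD)
    then have "set w \<subseteq> letters" using wnode_letters_sub[OF cuts_wnode[OF st(1)]] by blast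
    then have "addable singles (length w) (length w) w"
      by (intro addable_letters) (auto simp: singles_def)
    moreover have "length w \<le> 2 * K" unfolding st(2) window_def by simp
    ultimately show "addable singles (2 * K) (2 * K) w" using addable_mono by blast
  qed
  then obtain S where S: "singles \<subseteq> S" "cat_closed S" "card S \<le> card letters + card (window 0 ` cuts) * (2 * K)"
    "\<forall>st\<in>cuts. window 0 st = [] \<or> derivable S (2 * K) (window 0 st)" using singles(2) by auto
  have "card (window 0 ` cuts) * (2 * K) \<le> card cuts * (2 * K)"
    using cuts_bound card_image_le by (intro mult_right_mono) auto
  then have "card S \<le> card letters + card cuts * (2 * K)" using S(3) by linarith
  then show ?case using S by (intro exI[of _ S]) simp
next
  case (Suc i)
  let ?d = "2 * K + 2 * i" and ?n = "K * 2 ^ i"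
  obtain S where S: "singles \<subseteq> S" "cat_closed S"
    "card S \<le> card letters + card cuts * (2 * K + i * (10 * K + 8 * i + 2))"
    "\<forall>st\<in>cuts. window i st = [] \<or> derivable S ?d (window i st)" using Suc by blast
  let ?c = "10 * K + 8 * i + 2"
  have "\<exists>S'. S \<subseteq> S' \<and> cat_closed S' \<and> card S' \<le> card S + card (window (Suc i) ` cuts) * ?c
    \<and> (\<forall>w\<in>window (Suc i) ` cuts. w = [] \<or> derivable S' (Suc (Suc ?d)) w)"
  proof (rule addable_all[OF _ _ S(2)])
    show "finite (window (Suc i) ` cuts)" using cuts_bound by simp
    fix w assume "w \<in> window (Suc i) ` cuts"
    then obtain s t where st: "(s, t) \<in> cuts" "w = window (Suc i) (s, t)" by auto
    \<comment> \<open>\<open>A\<close> and \<open>B\<close> are the parts of the new window between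
      the radii \<open>?n\<close> and \<open>2 * ?n\<close>.\<close>
    define A where "A = drop (length s - K * 2 ^ Suc i) (take (length s - ?n) s)"
    define B where "B = take ?n (drop ?n t)"
    have le: "length s - K * 2 ^ Suc i \<le> length s - ?n" by simp
    have "drop (length s - K * 2 ^ Suc i) s
        = drop (length s - K * 2 ^ Suc i) (take (length s - ?n) s @ drop (length s - ?n) s)" by simp
    also have "\<dots> = A @ drop (length s - ?n) s"
      unfolding drop_append A_def using le by simp
    finally have 1: "drop (length s - K * 2 ^ Suc i) s = A @ drop (length s - ?n) s" .
    have 2: "take (K * 2 ^ Suc i) t = take ?n t @ B"
      using take_add[of ?n ?n t] by (simp add: B_def mult_2 distrib_left)
    have w: "w = A @ (window i (s, t) @ B)" unfolding st(2) window_def using 1 2 by simp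
    have "sublist A s" unfolding A_def by (rule sublist_order.order_trans[OF sublist_drop sublist_take])
    then have "sublist A (s @ t)" by (simp add: sublist_append)
    moreover have "length A \<le> ?n" by (simp add: A_def)
    ultimately have A: "addable S (K + 2 * ?d) ?d A"
      using factor_addable[OF S(1,4) _ cuts_wnode[OF st(1)]] by simp
    have "sublist B t" unfolding B_def by (rule sublist_order.order_trans[OF sublist_take sublist_drop])
    then have "sublist B (s @ t)" by (simp add: sublist_append)
    moreover have "length B \<le> ?n" by (simp add: B_def)
    ultimately have B: "addable S (K + 2 * ?d) ?d B"
      using factor_addable[OF S(1,4) _ cuts_wnode[OF st(1)]] by simp
    have "addable S 0 ?d (window i (s, t))" using S(4) st(1) by (intro addable_derivable) blast
    then have "addable S (0 + (K + 2 * ?d) + 1) (Suc ?d) (window i (s, t) @ B)"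
      using B by (rule addable_append)
    moreover have "addable S (K + 2 * ?d) (Suc ?d) A" using A by (rule addable_mono) auto
    ultimately have "addable S (K + 2 * ?d + (0 + (K + 2 * ?d) + 1) + 1) (Suc (Suc ?d)) w"
      unfolding w using addable_append by blast
    then show "addable S ?c (Suc (Suc ?d)) w" by (rule addable_mono) auto
  qed
  then obtain S' where S': "S \<subseteq> S'" "cat_closed S'" "card S' \<le> card S + card (window (Suc i) ` cuts) * ?c"
    "\<forall>st\<in>cuts. window (Suc i) st = [] \<or> derivable S' (Suc (Suc ?d)) (window (Suc i) st)" by auto
  have "card (window (Suc i) ` cuts) * ?c \<le> card cuts * ?c"
    using cuts_bound card_image_le by (intro mult_right_mono) auto
  then have "card S' \<le> card letters + card cuts * (2 * K + i * ?c + ?c)"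
    using S(3) S'(3) by (simp add: algebra_simps)
  also have "\<dots> \<le> card letters + card cuts * (2 * K + Suc i * (10 * K + 8 * Suc i + 2))"
    by (intro add_left_mono mult_left_mono) (auto simp: algebra_simps)
  finally show ?case using S(1) S' by (intro exI[of _ S']) auto
qed

lemma solution_words_compressed:
  assumes "\<And>X. X \<in> \<Omega> \<Longrightarrow> length (\<sigma> X) \<le> 2 ^ i"
  shows "\<exists>S. cat_closed S \<and> (\<forall>w\<in>S. set w \<subseteq> letters) \<and> (\<forall>X\<in>\<Omega>. \<sigma> X = [] \<or> \<sigma> X \<in> S)
    \<and> card S \<le> card letters + card cuts * (2 * K + i * (10 * K + 8 * i + 2))"
proof -
  obtain S where S: "cat_closed S"
    "card S \<le> card letters + card cuts * (2 * K + i * (10 * K + 8 * i + 2))"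
    "\<forall>st\<in>cuts. window i st = [] \<or> derivable S (2 * K + 2 * i) (window i st)"
    using windows_derivable by blast
  \<comment> \<open>The letters of the other words in \<open>S\<close> were not tracked. Restricting
    to words over \<open>letters\<close> keeps the program closed, since the parts of a word use
    only its letters.\<close>
  let ?S = "{w \<in> S. set w \<subseteq> letters}"
  have "cat_closed ?S"
    unfolding cat_closed_def
  proof (intro conjI ballI)
    show "finite ?S" using S(1) by (simp add: cat_closed_def)
    fix w assume w: "w \<in> ?S"
    then show "w \<noteq> []" using S(1) by (simp add: cat_closed_def)
    consider "length w = 1" | u v where "u \<in> S" "v \<in> S" "w = u @ v"
      using w S(1) unfolding cat_closed_def by blast
    then show "length w = 1 \<or> (\<exists>u\<in>?S. \<exists>v\<in>?S. w = u @ v)"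
    proof cases
      case 2
      then show ?thesis using w by (intro disjI2 bexI[of _ u] bexI[of _ v]) auto
    qed simp
  qed
  moreover have "card ?S \<le> card S" using S(1) by (intro card_mono) (auto simp: cat_closed_def)
  moreover have "\<sigma> X = [] \<or> \<sigma> X \<in> ?S" if X: "X \<in> \<Omega>" for X
  proof -
    have "1 * 2 ^ i \<le> K * 2 ^ i" by (intro mult_right_mono) (simp_all add: K_def)
    then have "length (\<sigma> X) \<le> K * 2 ^ i" using assms[OF X] by linarith
    then have "window i ([], \<sigma> X) = \<sigma> X" by (simp add: window_def)
    moreover have "([], \<sigma> X) \<in> cuts" using X by (auto simp: cuts_def cuts0_def)
    ultimately show ?thesis using S(3) derivable_in[of S "2 * K + 2 * i" "\<sigma> X"] node_letters_sub[OF \<sigma>_node[OF X]] by auto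
  qed
  ultimately show ?thesis using S(2) by (intro exI[of _ ?S]) auto
qed

end

subsection \<open>Straight-line programs up to equality in the free product\<close>

context free_product
begin

text \<open>A straight-line program over \<open>\<Gamma>\<close>, up to equality in the free product: the set of the reduced
  values of its variables, ranked by the order of the variables.\<close>
definition slp_rank :: "word set \<Rightarrow> (word \<Rightarrow> nat) \<Rightarrow> bool" where
  "slp_rank E rk \<longleftrightarrow> (\<forall>e\<in>E. e = [] \<or> (\<exists>a\<in>Gam P \<Gamma>. e = [a])
     \<or> (\<exists>u\<in>E. \<exists>v\<in>E. rk u < rk e \<and> rk v < rk e \<and> e = red G (u @ v)))"

definition slp_set :: "word set \<Rightarrow> bool" where
  "slp_set E \<longleftrightarrow> finite E \<and> (\<exists>rk. slp_rank E rk)"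

lemma finite_bound:
  fixes rk :: "'a \<Rightarrow> nat" assumes "finite E" obtains M where "\<And>e. e \<in> E \<Longrightarrow> rk e < M"
  using assms that[of "Suc (Max (rk ` E))"] by (simp add: le_imp_less_Suc)

text \<open>The ranks of the second program are shifted above those of the first; a common value
  keeps its first rank.\<close>

lemma slp_set_Un:
  assumes "slp_set E" "slp_set F" shows "slp_set (E \<union> F)"
proof -
  obtain r1 r2 where r: "slp_rank E r1" "slp_rank F r2" and f: "finite E" "finite F"
    using assms by (auto simp: slp_set_def)
  obtain M where M: "\<And>e. e \<in> E \<Longrightarrow> r1 e < M" using finite_bound[OF f(1)] by blast
  define rk where "rk e = (if e \<in> E then r1 e else M + r2 e)" for e
  have "slp_rank (E \<union> F) rk"
    unfolding slp_rank_def
  proof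
    fix e assume e: "e \<in> E \<union> F"
    show "e = [] \<or> (\<exists>a\<in>Gam P \<Gamma>. e = [a])
     \<or> (\<exists>u\<in>E \<union> F. \<exists>v\<in>E \<union> F. rk u < rk e \<and> rk v < rk e \<and> e = red G (u @ v))"
    proof (cases "e \<in> E")
      case True
      consider "e = []" | "\<exists>a\<in>Gam P \<Gamma>. e = [a]"
        | u v where "u \<in> E" "v \<in> E" "r1 u < r1 e" "r1 v < r1 e" "e = red G (u @ v)"
        using r(1) True unfolding slp_rank_def by blast
      then show ?thesis
      proof cases
        case 3
        then have "rk u < rk e" "rk v < rk e" using True by (auto simp: rk_def)
        then show ?thesis using 3 by blast
      qed auto
    next
      case False
      then have eF: "e \<in> F" using e by simp
      consider "e = []" | "\<exists>a\<in>Gam P \<Gamma>. e = [a]"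
        | u v where "u \<in> F" "v \<in> F" "r2 u < r2 e" "r2 v < r2 e" "e = red G (u @ v)"
        using r(2) eF unfolding slp_rank_def by blast
      then show ?thesis
      proof cases
        case 3
        then have "rk u < rk e" "rk v < rk e" using False M[of u] M[of v] by (auto simp: rk_def)
        then show ?thesis using 3 by blast
      qed auto
    qed
  qed
  then show ?thesis using f by (auto simp: slp_set_def)
qed

lemma slp_set_Nil: "slp_set {[]}" and slp_set_Gam: "a \<in> Gam P \<Gamma> \<Longrightarrow> slp_set {[a]}"
  by (auto simp: slp_set_def slp_rank_def)

lemma slp_set_insert:
  assumes "slp_set E" "u \<in> E" "v \<in> E" shows "slp_set (insert (red G (u @ v)) E)"
proof (cases "red G (u @ v) \<in> E")
  case True
  then show ?thesis using assms by (simp add: insert_absorb)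
next
  case False
  obtain rk where rk: "slp_rank E rk" and f: "finite E" using assms by (auto simp: slp_set_def)
  obtain M where M: "\<And>e. e \<in> E \<Longrightarrow> rk e < M" using finite_bound[OF f] by blast
  define rk' where "rk' = rk(red G (u @ v) := M)"
  have old: "rk' e = rk e" if "e \<in> E" for e using that False by (auto simp: rk'_def)
  have "slp_rank (insert (red G (u @ v)) E) rk'"
    unfolding slp_rank_def
  proof
    fix e assume e: "e \<in> insert (red G (u @ v)) E"
    let ?E = "insert (red G (u @ v)) E"
    show "e = [] \<or> (\<exists>a\<in>Gam P \<Gamma>. e = [a])
     \<or> (\<exists>u\<in>?E. \<exists>v\<in>?E. rk' u < rk' e \<and> rk' v < rk' e \<and> e = red G (u @ v))"
    proof (cases "e \<in> E")
      case True
      consider "e = []" | "\<exists>a\<in>Gam P \<Gamma>. e = [a]"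
        | u v where "u \<in> E" "v \<in> E" "rk u < rk e" "rk v < rk e" "e = red G (u @ v)"
        using rk True unfolding slp_rank_def by blast
      then show ?thesis
      proof cases
        case 3
        then have "rk' u < rk' e" "rk' v < rk' e" using old True by auto
        then show ?thesis using 3 by blast
      qed auto
    next
      case False
      then have "e = red G (u @ v)" "rk' e = M" using e by (auto simp: rk'_def)
      then have "rk' u < rk' e" "rk' v < rk' e" using M old assms(2,3) by auto
      then show ?thesis using \<open>e = red G (u @ v)\<close> assms(2,3) by blast
    qed
  qed
  then show ?thesis using f by (auto simp: slp_set_def)
qed

lemma slp_set_UN:
  assumes "finite A" "\<And>a. a \<in> A \<Longrightarrow> slp_set (f a)" shows "slp_set (\<Union>a\<in>A. f a)"
  using assms
proof (induction A)
  case empty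
  show ?case by (simp add: slp_set_def slp_rank_def)
next
  case (insert a A)
  then show ?case using slp_set_Un by simp
qed

text \<open>Each binary digit of the exponent costs at most three values: the squared power, the
  generator and their product.\<close>

lemma slp_power:
  assumes "\<alpha> \<in> P" "g \<in> \<Gamma> \<alpha>" "n < 2 ^ i"
  shows "\<exists>E. slp_set E \<and> elt \<alpha> (g [^]\<^bsub>G \<alpha>\<^esub> (n :: nat)) \<in> E \<and> card E \<le> 3 * i + 1"
  using assms(3)
proof (induction i arbitrary: n)
  case 0
  then show ?case using slp_set_Nil by (intro exI[of _ "{[]}"]) (simp add: elt_def)
next
  case (Suc i)
  interpret group "G \<alpha>" using assms(1) by (rule group_G)
  have g: "g \<in> carrier (G \<alpha>)" using assms \<Gamma>_sub by blast
  let ?p = "\<lambda>n :: nat. g [^]\<^bsub>G \<alpha>\<^esub> n"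
  have pc: "?p m \<in> carrier (G \<alpha>)" for m using g by simp
  have "n div 2 < 2 ^ i" using Suc.prems by auto
  then obtain E where E: "slp_set E" "elt \<alpha> (?p (n div 2)) \<in> E" "card E \<le> 3 * i + 1"
    using Suc.IH by blast
  have f: "finite E" using E(1) by (simp add: slp_set_def)
  let ?e = "elt \<alpha> (?p (2 * (n div 2)))"
  have e: "?e = red G (elt \<alpha> (?p (n div 2)) @ elt \<alpha> (?p (n div 2)))"
    using red_elt_mult[OF assms(1) pc pc] nat_pow_mult[OF g] by (simp add: mult_2)
  have E1: "slp_set (insert ?e E)" unfolding e using slp_set_insert[OF E(1,2,2)] .
  have c1: "card (insert ?e E) \<le> 3 * i + 2" using E(3) f by (simp add: card_insert_if)
  show ?case
  proof (cases "even n")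
    case True
    then show ?thesis using E1 c1 by (intro exI[of _ "insert ?e E"]) simp
  next
    case False
    then have n: "n = 2 * (n div 2) + 1" by simp
    have "[(\<alpha>, g)] = elt \<alpha> g" using assms \<Gamma>_sub by (auto simp: elt_def)
    moreover have "(\<alpha>, g) \<in> Gam P \<Gamma>" using assms by (simp add: Gam_def)
    ultimately have s: "slp_set {elt \<alpha> g}" using slp_set_Gam[of "(\<alpha>, g)"] by simp
    let ?E = "insert ?e E \<union> {elt \<alpha> g}"
    have E2: "slp_set ?E" using slp_set_Un[OF E1 s] .
    have "elt \<alpha> (?p n) = red G (?e @ elt \<alpha> g)"
      using red_elt_mult[OF assms(1) pc g, of "2 * (n div 2)"] n g by (metis Suc_eq_plus1 nat_pow_Suc)
    then have E3: "slp_set (insert (elt \<alpha> (?p n)) ?E)"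
      using slp_set_insert[OF E2, of ?e "elt \<alpha> g"] by simp
    have "card ?E \<le> 3 * i + 3" using card_Un_le[of "insert ?e E" "{elt \<alpha> g}"] c1 by simp
    then have "card (insert (elt \<alpha> (?p n)) ?E) \<le> 3 * i + 4"
      using f by (simp add: card_insert_if)
    then show ?thesis using E3 by (intro exI[of _ "insert (elt \<alpha> (?p n)) ?E"]) simp
  qed
qed

text \<open>For \<open>A = carrier (G \<alpha>)\<close> this is the projection of the free product
  onto the factor \<open>\<alpha>\<close>; smaller sets \<open>A\<close> serve to separate the
  generators one by one.\<close>

definition part_prod :: "nat \<Rightarrow> nat set \<Rightarrow> word \<Rightarrow> nat" where
  "part_prod \<alpha> A w = foldr (\<lambda>a g. if fst a = \<alpha> \<and> snd a \<in> A then snd a \<otimes>\<^bsub>G \<alpha>\<^esub> g else g) w \<one>\<^bsub>G \<alpha>\<^esub>"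

lemma part_prod_Nil [simp]: "part_prod \<alpha> A [] = \<one>\<^bsub>G \<alpha>\<^esub>"
  by (simp add: part_prod_def)

lemma part_prod_Cons: "part_prod \<alpha> A (a # w) =
    (if fst a = \<alpha> \<and> snd a \<in> A then snd a \<otimes>\<^bsub>G \<alpha>\<^esub> part_prod \<alpha> A w else part_prod \<alpha> A w)"
  by (simp add: part_prod_def)

lemma part_prod_closed:
  assumes "\<alpha> \<in> P" "\<forall>a\<in>set w. letter a" shows "part_prod \<alpha> A w \<in> carrier (G \<alpha>)"
proof -
  interpret group "G \<alpha>" using assms(1) by (rule group_G)
  show ?thesis using assms(2) by (induction w) (auto simp: part_prod_Cons is_letter_def)
qed

text \<open>The projection respects the only relations used in reduction, namely products within one
  factor.\<close>

lemma part_prod_red: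
  assumes "\<alpha> \<in> P" "\<forall>a\<in>set w. letter a"
  shows "part_prod \<alpha> (carrier (G \<alpha>)) (red G w) = part_prod \<alpha> (carrier (G \<alpha>)) w"
  using assms(2)
proof (induction w)
  case (Cons a w)
  interpret group "G \<alpha>" using assms(1) by (rule group_G)
  have v: "vred (red G w)" using Cons.prems by (intro vred_red) simp
  have a: "letter a" using Cons.prems by simp
  have "part_prod \<alpha> (carrier (G \<alpha>)) (cons_red G a (red G w)) = part_prod \<alpha> (carrier (G \<alpha>)) (a # red G w)"
  proof (cases "red G w")
    case (Cons b v')
    have b: "letter b" "\<forall>a\<in>set v'. letter a" using v Cons by (auto simp: valid_reduced_def)
    have pc: "part_prod \<alpha> (carrier (G \<alpha>)) v' \<in> carrier (G \<alpha>)" using part_prod_closed assms(1) b(2) by blast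
    show ?thesis
    proof (cases "fst a = fst b")
      case True
      show ?thesis
      proof (cases "fst a = \<alpha>")
        case True
        then have ab: "snd a \<in> carrier (G \<alpha>)" "snd b \<in> carrier (G \<alpha>)" "fst b = \<alpha>"
          using a b(1) \<open>fst a = fst b\<close> by (auto simp: is_letter_def)
        have "snd a \<otimes>\<^bsub>G \<alpha>\<^esub> (snd b \<otimes>\<^bsub>G \<alpha>\<^esub> part_prod \<alpha> (carrier (G \<alpha>)) v')
          = (snd a \<otimes>\<^bsub>G \<alpha>\<^esub> snd b) \<otimes>\<^bsub>G \<alpha>\<^esub> part_prod \<alpha> (carrier (G \<alpha>)) v'" using ab pc by (simp add: m_assoc)
        then show ?thesis using Cons True ab pc by (auto simp: part_prod_Cons)
      next
        case False
        then show ?thesis using Cons \<open>fst a = fst b\<close> by (auto simp: part_prod_Cons)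
      qed
    next
      case False
      then show ?thesis using Cons by simp
    qed
  qed simp
  then show ?case using Cons by (simp add: red_Cons part_prod_Cons)
qed simp

text \<open>Commutativity of the factor collects all occurrences of \<open>g\<close> into one
  power.\<close>

lemma part_prod_insert:
  assumes "\<alpha> \<in> P" "g \<in> carrier (G \<alpha>)" "g \<notin> A" "\<forall>a\<in>set w. letter a"
  shows "\<exists>n \<le> length w. part_prod \<alpha> (insert g A) w = part_prod \<alpha> A w \<otimes>\<^bsub>G \<alpha>\<^esub> (g [^]\<^bsub>G \<alpha>\<^esub> (n :: nat))"
  using assms(4)
proof (induction w)
  case Nil
  interpret group "G \<alpha>" using assms(1) by (rule group_G)
  show ?case by (intro exI[of _ 0]) simp
next
  case (Cons a w)
  interpret comm_group "G \<alpha>" using assms(1) by (rule comm_group_G)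
  obtain n where n: "n \<le> length w"
    "part_prod \<alpha> (insert g A) w = part_prod \<alpha> A w \<otimes>\<^bsub>G \<alpha>\<^esub> (g [^]\<^bsub>G \<alpha>\<^esub> (n :: nat))"
    using Cons by auto
  have pc: "part_prod \<alpha> A w \<in> carrier (G \<alpha>)" using part_prod_closed assms(1) Cons.prems by simp
  show ?case
  proof (cases "fst a = \<alpha> \<and> snd a = g")
    case True
    have "g \<otimes>\<^bsub>G \<alpha>\<^esub> (part_prod \<alpha> A w \<otimes>\<^bsub>G \<alpha>\<^esub> g [^]\<^bsub>G \<alpha>\<^esub> n) = part_prod \<alpha> A w \<otimes>\<^bsub>G \<alpha>\<^esub> (g [^]\<^bsub>G \<alpha>\<^esub> Suc n)"
      using pc assms(2) by (simp add: m_ac)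
    then show ?thesis
      using True assms(3) n by (intro exI[of _ "Suc n"]) (simp add: part_prod_Cons)
  next
    case False
    have "snd a \<in> carrier (G \<alpha>)" if "fst a = \<alpha>" using Cons.prems that by (auto simp: is_letter_def)
    then show ?thesis
      using False n pc assms(2) by (intro exI[of _ n]) (auto simp: part_prod_Cons m_assoc)
  qed
qed

text \<open>Each generator adds \<open>3 * i + 1\<close> values for its power and one for the
  product with what is already there.\<close>

lemma slp_part_prod:
  assumes "\<alpha> \<in> P" "finite A" "A \<subseteq> \<Gamma> \<alpha>" "\<forall>a\<in>set w. letter a" "length w < 2 ^ i"
  shows "\<exists>E. slp_set E \<and> elt \<alpha> (part_prod \<alpha> A w) \<in> E \<and> card E \<le> card A * (3 * i + 2) + 1"
  using assms(2,3)
proof (induction A)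
  case empty
  have "part_prod \<alpha> {} w = \<one>\<^bsub>G \<alpha>\<^esub>" by (induction w) (auto simp: part_prod_Cons)
  then show ?case using slp_set_Nil by (intro exI[of _ "{[]}"]) (simp add: elt_def)
next
  case (insert g A)
  interpret group "G \<alpha>" using assms(1) by (rule group_G)
  obtain E where E: "slp_set E" "elt \<alpha> (part_prod \<alpha> A w) \<in> E" "card E \<le> card A * (3 * i + 2) + 1"
    using insert by auto
  have g: "g \<in> \<Gamma> \<alpha>" "g \<in> carrier (G \<alpha>)" using insert.prems \<Gamma>_sub[OF assms(1)] by auto
  obtain n where n: "n \<le> length w"
    "part_prod \<alpha> (insert g A) w = part_prod \<alpha> A w \<otimes>\<^bsub>G \<alpha>\<^esub> (g [^]\<^bsub>G \<alpha>\<^esub> (n :: nat))"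
    using part_prod_insert[OF assms(1) g(2) insert.hyps(2) assms(4)] by blast
  have "n < 2 ^ i" using n(1) assms(5) by simp
  then obtain E' where E': "slp_set E'" "elt \<alpha> (g [^]\<^bsub>G \<alpha>\<^esub> n) \<in> E'" "card E' \<le> 3 * i + 1"
    using slp_power[OF assms(1) g(1)] by blast
  let ?e = "elt \<alpha> (part_prod \<alpha> (insert g A) w)"
  have "?e = red G (elt \<alpha> (part_prod \<alpha> A w) @ elt \<alpha> (g [^]\<^bsub>G \<alpha>\<^esub> n))"
    using red_elt_mult[OF assms(1) part_prod_closed[OF assms(1,4)]] g(2) n(2) by simp
  then have "slp_set (insert ?e (E \<union> E'))"
    using slp_set_insert[OF slp_set_Un[OF E(1) E'(1)]] E(2) E'(2) by simp
  moreover have "card (insert ?e (E \<union> E')) \<le> card (insert g A) * (3 * i + 2) + 1"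
  proof -
    have f: "finite (E \<union> E')" using E(1) E'(1) by (simp add: slp_set_def)
    have "card (insert ?e (E \<union> E')) \<le> Suc (card (E \<union> E'))" using f by (simp add: card_insert_if)
    then show ?thesis using card_Un_le[of E E'] E(3) E'(3) insert.hyps by simp
  qed
  ultimately show ?case by (intro exI[of _ "insert ?e (E \<union> E')"]) simp
qed

text \<open>A shortest word over all generators might a priori use several factors. Projecting it to
  the factor of \<open>a\<close> leaves at most \<open>lwt a\<close> generators of that factor,
  which are then grouped into powers.\<close>

lemma slp_letter:
  assumes "letter a" "lwt a < 2 ^ i"
  shows "\<exists>E. slp_set E \<and> [a] \<in> E \<and> card E \<le> card (Gam P \<Gamma>) * (3 * i + 2) + 1"
proof -
  have \<alpha>: "fst a \<in> P" using assms(1) by (simp add: is_letter_def)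
  let ?\<alpha> = "fst a" and ?C = "carrier (G (fst a))"
  interpret group "G ?\<alpha>" using \<alpha> by (rule group_G)
  obtain ws where ws: "set ws \<subseteq> Gam P \<Gamma>" "length ws = lwt a" "red G ws = [a]"
    using gamma_len_attained[of "[a]"] assms(1) by (auto simp: lwt_def)
  have l: "\<forall>a\<in>set ws. letter a" using Gam_letters ws(1) by blast
  have "part_prod ?\<alpha> (\<Gamma> ?\<alpha>) u = part_prod ?\<alpha> ?C u" if "set u \<subseteq> Gam P \<Gamma>" for u
    using that \<Gamma>_sub[OF \<alpha>] by (induction u) (auto simp: part_prod_Cons Gam_def)
  then have "part_prod ?\<alpha> (\<Gamma> ?\<alpha>) ws = part_prod ?\<alpha> ?C (red G ws)"
    using part_prod_red[OF \<alpha> l] ws(1) by simp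
  also have "\<dots> = snd a" using ws(3) assms(1) by (simp add: part_prod_Cons is_letter_def)
  finally have "elt ?\<alpha> (part_prod ?\<alpha> (\<Gamma> ?\<alpha>) ws) = [a]" using elt_letter[OF assms(1)] by simp
  moreover obtain E where E: "slp_set E" "elt ?\<alpha> (part_prod ?\<alpha> (\<Gamma> ?\<alpha>) ws) \<in> E"
    "card E \<le> card (\<Gamma> ?\<alpha>) * (3 * i + 2) + 1"
    using slp_part_prod[OF \<alpha> finite_\<Gamma>[OF \<alpha>] subset_refl l] ws(2) assms(2) by auto
  moreover have "card (\<Gamma> ?\<alpha>) \<le> card (Gam P \<Gamma>)"
    using \<alpha> finite_Gam by (intro card_inj_on_le[of "Pair ?\<alpha>"]) (auto simp: Gam_def inj_on_def)
  then have "card (\<Gamma> ?\<alpha>) * (3 * i + 2) \<le> card (Gam P \<Gamma>) * (3 * i + 2)" by (rule mult_right_mono) simp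
  ultimately show ?thesis by (intro exI[of _ E]) auto
qed

text \<open>Different words of \<open>S\<close> may have the same value, so a new value is ranked by
  its shortest word in \<open>S\<close>, whose two parts are shorter. The ranks in \<open>E\<close>,
  which supplies the letters, stay below.\<close>

lemma slp_set_words:
  assumes E: "slp_set E" and S: "cat_closed S" "\<And>w a. w \<in> S \<Longrightarrow> a \<in> set w \<Longrightarrow> letter a \<and> [a] \<in> E"
  shows "slp_set (E \<union> red G ` S)"
proof -
  obtain r where r: "slp_rank E r" and f: "finite E" using E by (auto simp: slp_set_def)
  obtain M where M: "\<And>e. e \<in> E \<Longrightarrow> r e < M" using finite_bound[OF f] by blast
  define len where "len e = (LEAST n. \<exists>w\<in>S. red G w = e \<and> length w = n)" for e
  define rk where "rk e = (if e \<in> E then r e else M + len e)" for e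
  have "slp_rank (E \<union> red G ` S) rk"
    unfolding slp_rank_def
  proof
    let ?E = "E \<union> red G ` S"
    fix e assume e: "e \<in> ?E"
    show "e = [] \<or> (\<exists>a\<in>Gam P \<Gamma>. e = [a])
     \<or> (\<exists>u\<in>?E. \<exists>v\<in>?E. rk u < rk e \<and> rk v < rk e \<and> e = red G (u @ v))"
    proof (cases "e \<in> E")
      case True
      consider "e = []" | "\<exists>a\<in>Gam P \<Gamma>. e = [a]"
        | u v where "u \<in> E" "v \<in> E" "r u < r e" "r v < r e" "e = red G (u @ v)"
        using r True unfolding slp_rank_def by blast
      then show ?thesis
      proof cases
        case 3
        then have "rk u < rk e" "rk v < rk e" using True by (auto simp: rk_def)
        then show ?thesis using 3 by blast
      qed auto
    next
      case False
      then obtain w0 where "w0 \<in> S" "red G w0 = e" using e by auto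
      then have "\<exists>n. \<exists>w\<in>S. red G w = e \<and> length w = n" by blast
      then have "\<exists>w\<in>S. red G w = e \<and> length w = len e" unfolding len_def by (rule LeastI_ex)
      then obtain w where w: "w \<in> S" "red G w = e" "length w = len e" by blast
      have "length w \<noteq> 1"
      proof
        assume "length w = 1"
        then obtain a where a: "w = [a]" by (cases w) auto
        then have "[a] \<in> E" using S(2)[OF w(1)] by simp
        then show False using False w(2) a by (simp add: red_Cons)
      qed
      then obtain u v where uv: "u \<in> S" "v \<in> S" "w = u @ v"
        using S(1) w(1) unfolding cat_closed_def by blast
      have "u \<noteq> []" "v \<noteq> []" using S(1) uv unfolding cat_closed_def by auto
      then have l: "length u < len e" "length v < len e" unfolding w(3)[symmetric] uv(3) by simp_all
      have "len (red G x) \<le> length x" if "x \<in> S" for x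
        unfolding len_def using that by (intro Least_le) blast
      then have "rk (red G x) < rk e" if "x \<in> S" "length x < len e" for x
        using that False M[of "red G x"] by (fastforce simp: rk_def)
      then have "rk (red G u) < rk e" "rk (red G v) < rk e" using uv l by auto
      moreover have "e = red G (red G u @ red G v)"
        using w(2) uv S(2) red_append_red[of u v] by auto
      ultimately show ?thesis using uv by blast
    qed
  qed
  then show ?thesis using f S(1) by (auto simp: slp_set_def cat_closed_def)
qed

end

subsection \<open>Realization and size\<close>

context free_product
begin

text \<open>Every value gets a fresh variable. No rule merely copies a variable, so each
  \<open>X\<close> in \<open>\<Omega>\<close> repeats the rule of its value and is ranked above all
  fresh variables.\<close>

lemma slp_set_realized:
  assumes E: "slp_set E" and fin: "finite \<Omega>" and \<sigma>: "\<And>X. X \<in> \<Omega> \<Longrightarrow> \<sigma> X \<in> E"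
  shows "\<exists>V rl ord. slp_wf P \<Gamma> V rl ord \<and> \<Omega> \<subseteq> V \<and> card V \<le> card \<Omega> + card E
    \<and> (\<forall>X\<in>\<Omega>. \<forall>b. \<exists>w. slp_eval G V rl (X, b) w \<and> red G w = sig_hat G \<sigma> (X, b))"
proof -
  obtain rk where rk: "slp_rank E rk" and fE: "finite E" using E by (auto simp: slp_set_def)
  obtain M where M: "\<And>e. e \<in> E \<Longrightarrow> rk e < M" using finite_bound[OF fE] by blast
  obtain f where f: "bij_betw f E {0..<card E}" using ex_bij_betw_finite_nat[OF fE] by blast
  \<comment> \<open>Shifting the codes beyond all elements of \<open>\<Omega>\<close> makes them
    fresh.\<close>
  obtain m where m: "\<And>X. X \<in> \<Omega> \<Longrightarrow> X < m" using finite_bound[OF fin, of "\<lambda>X. X"] by blast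
  define code where "code e = f e + m" for e
  have code_inj: "inj_on code E" using f by (auto simp: bij_betw_def inj_on_def code_def)
  have code_new: "code e \<notin> \<Omega>" for e using m[of "code e"] by (auto simp: code_def)
  define V where "V = \<Omega> \<union> code ` E"
  define val where "val X = (if X \<in> \<Omega> then \<sigma> X else inv_into E code X)" for X
  have val_code: "val (code e) = e" if "e \<in> E" for e
    using that code_inj code_new by (simp add: val_def)
  have val_E: "val X \<in> E" if X: "X \<in> V" for X
  proof (cases "X \<in> \<Omega>")
    case True
    then show ?thesis using \<sigma> by (simp add: val_def)
  next
    case False
    then obtain e where "e \<in> E" "X = code e" using X by (auto simp: V_def)
    then show ?thesis using val_code by simp
  qed
  define ch where "ch e = (SOME uv. fst uv \<in> E \<and> snd uv \<in> E \<and> rk (fst uv) < rk e \<and> rk (snd uv) < rk e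
     \<and> e = red G (fst uv @ snd uv))" for e
  define rule where "rule e = (if e = [] then ROne else if \<exists>a\<in>Gam P \<Gamma>. e = [a] then RConst (hd e)
     else RCat (code (fst (ch e)), True) (code (snd (ch e)), True))" for e
  have rule_cases: "(e = [] \<and> rule e = ROne) \<or> (\<exists>a\<in>Gam P \<Gamma>. e = [a] \<and> rule e = RConst a)
     \<or> (\<exists>u\<in>E. \<exists>v\<in>E. rk u < rk e \<and> rk v < rk e \<and> e = red G (u @ v)
          \<and> rule e = RCat (code u, True) (code v, True))" if e: "e \<in> E" for e
  proof (cases "e = [] \<or> (\<exists>a\<in>Gam P \<Gamma>. e = [a])")
    case True
    then show ?thesis by (auto simp: rule_def)
  next
    case False
    then obtain u v where "u \<in> E" "v \<in> E" "rk u < rk e" "rk v < rk e" "e = red G (u @ v)"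
      using rk e unfolding slp_rank_def by blast
    then have "\<exists>uv. fst uv \<in> E \<and> snd uv \<in> E \<and> rk (fst uv) < rk e \<and> rk (snd uv) < rk e
     \<and> e = red G (fst uv @ snd uv)" by (intro exI[of _ "(u, v)"]) simp
    then have "fst (ch e) \<in> E \<and> snd (ch e) \<in> E \<and> rk (fst (ch e)) < rk e \<and> rk (snd (ch e)) < rk e
     \<and> e = red G (fst (ch e) @ snd (ch e))" unfolding ch_def by (rule someI_ex)
    moreover have "rule e = RCat (code (fst (ch e)), True) (code (snd (ch e)), True)"
      using False by (simp add: rule_def)
    ultimately show ?thesis by blast
  qed
  define rl where "rl X = rule (val X)" for X
  define h where "h X = (if X \<in> \<Omega> then M else rk (val X))" for X
  have h_code: "h (code e) = rk e" if "e \<in> E" for e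
    using that code_new val_code by (simp add: h_def)
  have h_less: "h (code u) < h X" if "X \<in> V" "u \<in> E" "rk u < rk (val X)" for X u
    using that h_code[of u] M by (auto simp: h_def)
  define ord where "ord = {p :: var \<times> var. h (fst (snd p)) < h (fst (fst p))}"
  have "slp_wf P \<Gamma> V rl ord"
    unfolding slp_wf_def
  proof (intro conjI ballI)
    show "finite V" using fin fE by (simp add: V_def)
    show "irrefl ord" "trans ord" by (auto simp: ord_def irrefl_def trans_def)
    fix X assume X: "X \<in> V"
    from rule_cases[OF val_E[OF X]] show "case rl X of RConst a \<Rightarrow> a \<in> Gam P \<Gamma> | ROne \<Rightarrow> True
      | RCat Y Z \<Rightarrow> fst Y \<in> V \<and> fst Z \<in> V
         \<and> ((X, True), (fst Y, True)) \<in> ord \<and> ((X, True), (fst Y, False)) \<in> ord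
         \<and> ((X, True), (fst Z, True)) \<in> ord \<and> ((X, True), (fst Z, False)) \<in> ord"
      using h_less[OF X] by (auto simp: rl_def ord_def V_def)
  qed
  moreover have ev: "\<exists>w. slp_eval G V rl (X, True) w \<and> set w \<subseteq> Gam P \<Gamma> \<and> red G w = val X" if "X \<in> V" for X
    using that
  proof (induction "h X" arbitrary: X rule: less_induct)
    case less
    from rule_cases[OF val_E[OF less.prems]]
    consider "val X = []" "rl X = ROne" | a where "a \<in> Gam P \<Gamma>" "val X = [a]" "rl X = RConst a"
      | u v where "u \<in> E" "v \<in> E" "rk u < rk (val X)" "rk v < rk (val X)" "val X = red G (u @ v)"
          "rl X = RCat (code u, True) (code v, True)" by (auto simp: rl_def)
    then show ?case
    proof cases
      case 1
      then show ?thesis using less.prems slp_eval.intros(2)[of X V rl G] by (intro exI[of _ "[]"]) simp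
    next
      case 2
      then show ?thesis
        using less.prems slp_eval.intros(1)[of X V rl a G] by (intro exI[of _ "[a]"]) (simp add: red_Cons)
    next
      case 3
      have "code u \<in> V" "code v \<in> V" using 3 by (auto simp: V_def)
      then obtain wu wv where w: "slp_eval G V rl (code u, True) wu" "set wu \<subseteq> Gam P \<Gamma>" "red G wu = u"
        "slp_eval G V rl (code v, True) wv" "set wv \<subseteq> Gam P \<Gamma>" "red G wv = v"
        using less.hyps[OF h_less[OF less.prems 3(1,3)]] less.hyps[OF h_less[OF less.prems 3(2,4)]]
          val_code[OF 3(1)] val_code[OF 3(2)] by auto
      have "slp_eval G V rl (X, True) (wu @ wv)"
        using less.prems 3(6) w(1,4) by (rule slp_eval.intros(3))
      moreover have "red G (wu @ wv) = val X"
        using red_append_red[of wu wv] Gam_letters[OF w(2)] Gam_letters[OF w(5)] w(3,6) 3(5) by simp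
      ultimately show ?thesis using w(2,5) by (intro exI[of _ "wu @ wv"]) simp
    qed
  qed
  moreover have "\<exists>w. slp_eval G V rl (X, b) w \<and> red G w = sig_hat G \<sigma> (X, b)" if X: "X \<in> \<Omega>" for X b
  proof -
    have "X \<in> V" "val X = \<sigma> X" using X by (auto simp: V_def val_def)
    then obtain w where w: "slp_eval G V rl (X, True) w" "set w \<subseteq> Gam P \<Gamma>" "red G w = \<sigma> X"
      using ev[of X] by auto
    show ?thesis
    proof (cases b)
      case True
      then show ?thesis using w by (intro exI[of _ w]) (simp add: sig_hat_def)
    next
      case False
      have "slp_eval G V rl (X, False) (winv w)" using w(1) by (rule slp_eval.intros(4))
      then show ?thesis
        using False red_winv[OF Gam_letters[OF w(2)]] w(3) by (intro exI[of _ "winv w"]) (simp add: sig_hat_def)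
    qed
  qed
  moreover have "card V \<le> card \<Omega> + card E"
    using card_Un_le[of \<Omega> "code ` E"] card_image_le[OF fE, of code] by (simp add: V_def)
  moreover have "\<Omega> \<subseteq> V" by (simp add: V_def)
  ultimately show ?thesis by blast
qed

lemma lwt_linv:
  assumes "letter a" shows "lwt (linv a) \<le> lwt a"
proof -
  obtain ws where ws: "set ws \<subseteq> Gam P \<Gamma>" "length ws = lwt a" "red G ws = [a]"
    using gamma_len_attained[of "[a]"] assms by (auto simp: lwt_def)
  have "set (winv ws) \<subseteq> Gam P \<Gamma>" using ws(1) Gam_linv by (auto simp: word_inv_eq)
  moreover have "red G (winv ws) = [linv a]"
    using red_winv[OF Gam_letters[OF ws(1)]] ws(3) by (simp add: word_inv_Cons)
  ultimately show ?thesis using gamma_len_le[of "winv ws"] ws(2) by (simp add: lwt_def)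
qed

lemma lwt_le_wt: "a \<in> set w \<Longrightarrow> lwt a \<le> wt w"
  by (induction w) auto

end

context minimal_solution
begin

abbreviation N where "N \<equiv> sol_length G P \<Gamma> \<Omega> \<sigma>"
abbreviation sz where "sz \<equiv> fnorm P \<Gamma> \<Phi>"

lemma wt_sig_le: "fst x \<in> \<Omega> \<Longrightarrow> wt (sig x) \<le> N"
proof -
  assume x: "fst x \<in> \<Omega>"
  then have "x \<in> \<Omega> \<times> UNIV" by (simp add: mem_Times_iff)
  then have "wt (sig x) \<le> (\<Sum>x\<in>\<Omega> \<times> UNIV. wt (sig x))"
    using finite_\<Omega> by (intro member_le_sum) auto
  then show ?thesis using sol_length_wt[of \<sigma>] vred_sig by simp
qed

text \<open>A chain has at most \<open>eqsize \<Phi>\<close> factors of weight at most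
  \<open>N\<close> each, and reduction does not increase weight.\<close>

lemma step_wt:
  assumes "(x, y) \<in> stp"
  shows "wt x \<le> sz * N" "wt y \<le> sz * N" "wt (red G (x @ y)) \<le> sz * N"
proof -
  obtain E i where E: "i < length E" "fst ` set E \<subseteq> \<Omega>" "length E \<le> eqsize \<Phi>"
    "x = eval_vars G \<sigma> (take i E)" "y = sig (E ! i)"
    using steps_cases[OF assms] \<Omega> by auto
  have c: "wt (concat (map (sig_hat G \<sigma>) L)) \<le> length L * N" if "fst ` set L \<subseteq> \<Omega>" for L
    using that
  proof (induction L)
    case (Cons z L)
    then show ?case using wt_sig_le[of z] by simp
  qed simp
  have t: "fst ` set (take i E) \<subseteq> \<Omega>" using E(2) set_take_subset[of i E] by blast
  then have v: "\<forall>z\<in>set (take i E). vred (\<sigma> (fst z))" using vred_\<sigma> unfolding image_subset_iff by blast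
  have "wt x \<le> wt (concat (map (sig_hat G \<sigma>) (take i E)))"
    unfolding E(4) eval_vars_def by (rule wt_red[OF letters_concat_sig[OF v]])
  also have "\<dots> \<le> i * N" using c[OF t] E(1) by simp
  finally have x: "wt x \<le> i * N" .
  have "fst (E ! i) \<in> \<Omega>" using E(2) nth_mem[OF E(1)] unfolding image_subset_iff by blast
  then have y: "wt y \<le> N" unfolding E(5) by (rule wt_sig_le)
  have "wt (red G (x @ y)) \<le> wt (x @ y)"
    using node_letter[OF node_step(1)[OF assms]] node_letter[OF node_step(2)[OF assms]]
    by (intro wt_red) auto
  then have z: "wt (red G (x @ y)) \<le> Suc i * N" using x y by simp
  have "Suc i \<le> sz" using E(1,3) by (simp add: fnorm_def)
  then have le: "Suc i * N \<le> sz * N" by (rule mult_right_mono) simp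
  show "wt x \<le> sz * N" "wt y \<le> sz * N" "wt (red G (x @ y)) \<le> sz * N"
    using x y z le by simp_all
qed

lemma sizes: "card (Gam P \<Gamma>) \<le> sz" "card stp \<le> sz" "card \<Omega> \<le> sz"
  using card_steps[of G \<sigma> \<Phi>] card_eqvars[of \<Phi>] \<Omega> by (auto simp: fnorm_def)

text \<open>Middle letters have weight at most \<open>sz * N\<close>; the inequality
  \<open>sz < 2 ^ sz\<close> turns the factor \<open>sz\<close> into \<open>sz\<close> further
  binary digits.\<close>

lemma letters_lwt:
  assumes "N \<le> 2 ^ i" "a \<in> letters"
  shows "letter a" "lwt a < 2 ^ (sz + i)"
proof -
  have sN: "sz * N < 2 ^ (sz + i)"
  proof -
    have "sz * N \<le> sz * 2 ^ i" using assms(1) by simp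
    also have "\<dots> < 2 ^ sz * 2 ^ i" by (intro mult_strict_right_mono) auto
    finally show ?thesis by (simp add: power_add)
  qed
  have mids: "letter b \<and> lwt b < 2 ^ (sz + i)" if b: "b \<in> mids" for b
  proof -
    obtain x y where xy: "(x, y) \<in> stp" "b \<in> mid (x, y)" using b by (auto simp: mids_def)
    then have "b \<in> set x \<union> set y \<union> set (red G (x @ y))" using mid_subset by blast
    then have "lwt b \<le> sz * N" using step_wt[OF xy(1)] lwt_le_wt order_trans by blast
    then show ?thesis using sN letter_mids[OF b] by simp
  qed
  have "letter a \<and> lwt a < 2 ^ (sz + i)"
  proof -
    consider "a \<in> Gam P \<Gamma>" | "a \<in> mids" | b where "b \<in> mids" "a = linv b" | "a \<in> sletters"
      using assms(2) by (auto simp: letters_def cmids_def involutions_def)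
    then show ?thesis
    proof cases
      case 1
      then have "card (Gam P \<Gamma>) \<noteq> 0" using finite_Gam by auto
      then have "(2 :: nat) ^ 1 \<le> 2 ^ (sz + i)" using sizes(1) by (intro power_increasing) auto
      then show ?thesis using lwt_Gam[OF 1] Gam_letter[OF 1] by simp
    next
      case 3
      then show ?thesis using mids[of b] lwt_linv[of b] by auto
    next
      case 4
      then obtain x where x: "fst x \<in> \<Omega>" "a \<in> set (sig x)" by (auto simp: sletters_def)
      then have "card \<Omega> \<noteq> 0" using finite_\<Omega> by auto
      then have "sz \<noteq> 0" using sizes(3) by auto
      have "lwt a \<le> N" using lwt_le_wt[OF x(2)] wt_sig_le[OF x(1)] by simp
      also have "N \<le> sz * N" using \<open>sz \<noteq> 0\<close> by simp
      finally show ?thesis using sN letter_sletters[OF 4] by simp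
    qed (use mids in auto)
  qed
  then show "letter a" "lwt a < 2 ^ (sz + i)" by auto
qed

lemma slp_bound:
  assumes i: "N \<le> 2 ^ i"
  shows "\<exists>E. slp_set E \<and> (\<forall>X\<in>\<Omega>. \<sigma> X \<in> E) \<and> card \<Omega> + card E \<le> 2000 * (sz + i + 1) ^ 3"
proof -
  let ?c = "sz * (3 * (sz + i) + 2) + 1"
  have "\<exists>E. slp_set E \<and> [a] \<in> E \<and> card E \<le> ?c" if a: "a \<in> letters" for a
  proof -
    obtain E where E: "slp_set E" "[a] \<in> E" "card E \<le> card (Gam P \<Gamma>) * (3 * (sz + i) + 2) + 1"
      using slp_letter letters_lwt[OF i a] by blast
    have "card (Gam P \<Gamma>) * (3 * (sz + i) + 2) \<le> sz * (3 * (sz + i) + 2)"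
      using sizes(1) by (rule mult_right_mono) simp
    then show ?thesis using E by (intro exI[of _ E]) linarith
  qed
  then obtain el where el: "\<And>a. a \<in> letters \<Longrightarrow> slp_set (el a) \<and> [a] \<in> el a \<and> card (el a) \<le> ?c" by metis
  define E0 where "E0 = {[]} \<union> (\<Union>a\<in>letters. el a)"
  have E0: "slp_set E0" unfolding E0_def
    using el letters_bound by (intro slp_set_Un slp_set_Nil slp_set_UN) auto
  have "card (\<Union>a\<in>letters. el a) \<le> (\<Sum>a\<in>letters. card (el a))"
    using letters_bound by (intro card_UN_le) auto
  also have "\<dots> \<le> card letters * ?c"
    using el sum_bounded_above[of letters "\<lambda>a. card (el a)" ?c] by simp
  finally have cE0: "card E0 \<le> 1 + card letters * ?c"
    using card_Un_le[of "{[]}" "\<Union>a\<in>letters. el a"] by (simp add: E0_def)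
  have "length (\<sigma> X) \<le> 2 ^ i" if X: "X \<in> \<Omega>" for X
    using length_le_wt[OF node_letter[OF \<sigma>_node[OF X]]] wt_sig_le[of "(X, True)"] X i
    by (simp add: sig_hat_def)
  then obtain S where S: "cat_closed S" "\<forall>w\<in>S. set w \<subseteq> letters" "\<forall>X\<in>\<Omega>. \<sigma> X = [] \<or> \<sigma> X \<in> S"
    "card S \<le> card letters + card cuts * (2 * K + i * (10 * K + 8 * i + 2))"
    using solution_words_compressed by blast
  let ?E = "E0 \<union> red G ` S"
  have "slp_set ?E"
  proof (rule slp_set_words[OF E0 S(1)])
    fix w a assume "w \<in> S" "a \<in> set w"
    then have "a \<in> letters" using S(2) by blast
    then show "letter a \<and> [a] \<in> E0"
      using letters_lwt(1)[OF i, of a] el[of a] unfolding E0_def by blast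
  qed
  moreover have "\<sigma> X \<in> ?E" if X: "X \<in> \<Omega>" for X
  proof -
    have "red G (\<sigma> X) = \<sigma> X" using vred_\<sigma>[OF X] by simp
    then show ?thesis using S(3) X unfolding E0_def by (metis UnI1 UnI2 imageI insertI1)
  qed
  moreover have "card \<Omega> + card ?E \<le> 2000 * (sz + i + 1) ^ 3"
  proof -
    \<comment> \<open>The programs for the letters contribute \<open>48 * q ^ 3\<close>, the one for
      the words over them \<open>1316 * q ^ 3\<close>; the lower-order terms fit into the remaining
      room below \<open>2000 * q ^ 3\<close>.\<close>
    define q where "q = sz + i + 1"
    have q: "1 \<le> q" "sz \<le> q" "i \<le> q" by (auto simp: q_def)
    have sq: "1 \<le> q * q" "q \<le> q * q" "q \<le> q * (q * q)" using q(1) by simp_all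
    have "finite S" using S(1) by (simp add: cat_closed_def)
    then have "card ?E \<le> card E0 + card S"
      using card_Un_le[of E0 "red G ` S"] card_image_le[of S "red G"] by linarith
    moreover have L: "card letters \<le> 8 * q" using conjunct2[OF letters_bound] sizes q(2) by linarith
    moreover have "card letters * ?c \<le> (8 * q) * (6 * (q * q))"
    proof (rule mult_le_mono[OF L])
      have "sz * (3 * (sz + i) + 2) \<le> q * (5 * q)" using q by (intro mult_le_mono) (auto simp: q_def)
      also have "\<dots> = 5 * (q * q)" by simp
      finally show "?c \<le> 6 * (q * q)" using sq(1) by linarith
    qed
    moreover have "card cuts * (2 * K + i * (10 * K + 8 * i + 2)) \<le> (14 * q) * (94 * (q * q))"
    proof (rule mult_le_mono)
      have "card cuts \<le> 12 * card stp + 2 * card \<Omega>" using cuts_bound by simp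
      then show "card cuts \<le> 14 * q" using sizes(2,3) q(2) by simp
      have K: "K \<le> 7 * q" using sizes(1) q by (simp add: K_def)
      have "i * (10 * K + 8 * i + 2) \<le> q * (80 * q)" using q K by (intro mult_le_mono) auto
      also have "\<dots> = 80 * (q * q)" by simp
      finally show "2 * K + i * (10 * K + 8 * i + 2) \<le> 94 * (q * q)" using K sq(2) by linarith
    qed
    moreover have "(8 * q) * (6 * (q * q)) = 48 * (q * (q * q))"
      "(14 * q) * (94 * (q * q)) = 1316 * (q * (q * q))" "q ^ 3 = q * (q * q)"
      by (simp_all add: power3_eq_cube)
    ultimately show ?thesis
      unfolding q_def[symmetric] using cE0 S(4) sizes(3) q(1,2) sq(3) by linarith
  qed
  ultimately show ?thesis by (intro exI[of _ ?E]) blast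
qed

end

theorem mainTheorem4:
  "\<exists>p :: real poly. \<forall>(P :: nat set) (G :: nat \<Rightarrow> nat monoid) (\<Gamma> :: nat \<Rightarrow> nat set)
      (\<Omega> :: nat set) (\<Phi> :: bform) (\<sigma> :: nat \<Rightarrow> word).
     finite P
     \<and> (\<forall>\<alpha>\<in>P. comm_group (G \<alpha>) \<and> finite (\<Gamma> \<alpha>)
          \<and> \<Gamma> \<alpha> \<subseteq> carrier (G \<alpha>) - {\<one>\<^bsub>G \<alpha>\<^esub>}
          \<and> (\<forall>g\<in>\<Gamma> \<alpha>. inv\<^bsub>G \<alpha>\<^esub> g \<in> \<Gamma> \<alpha>)
          \<and> generate (G \<alpha>) (\<Gamma> \<alpha>) = carrier (G \<alpha>))
     \<and> \<Omega> = eqvars \<Phi> \<and> cvars \<Phi> \<subseteq> \<Omega>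
     \<and> is_solution G P \<Omega> \<Phi> \<sigma>
     \<and> (\<forall>\<tau>. is_solution G P \<Omega> \<Phi> \<tau> \<longrightarrow> sol_length G P \<Gamma> \<Omega> \<sigma> \<le> sol_length G P \<Gamma> \<Omega> \<tau>)
     \<longrightarrow> (\<exists>V rl ord. slp_wf P \<Gamma> V rl ord \<and> \<Omega> \<subseteq> V
           \<and> real (card V) \<le> poly p (real (fnorm P \<Gamma> \<Phi>) + log 2 (real (sol_length G P \<Gamma> \<Omega> \<sigma>)))
           \<and> (\<forall>X\<in>\<Omega>. \<forall>b. \<exists>w. slp_eval G V rl (X, b) w \<and> red G w = sig_hat G \<sigma> (X, b)))"
\<comment> \<open>The shift by 2 absorbs the summand 1 in \<open>sz + i + 1\<close> and the rounding
  of \<open>log 2 N\<close> up to the integer \<open>i\<close>.\<close>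
proof (intro exI[of _ "smult 2000 ([:2, 1:] ^ 3)"] allI impI)
  fix P :: "nat set" and G :: "nat \<Rightarrow> nat monoid" and \<Gamma> :: "nat \<Rightarrow> nat set"
    and \<Omega> :: "nat set" and \<Phi> :: bform and \<sigma> :: "nat \<Rightarrow> word"
  assume A: "finite P
     \<and> (\<forall>\<alpha>\<in>P. comm_group (G \<alpha>) \<and> finite (\<Gamma> \<alpha>)
          \<and> \<Gamma> \<alpha> \<subseteq> carrier (G \<alpha>) - {\<one>\<^bsub>G \<alpha>\<^esub>}
          \<and> (\<forall>g\<in>\<Gamma> \<alpha>. inv\<^bsub>G \<alpha>\<^esub> g \<in> \<Gamma> \<alpha>)
          \<and> generate (G \<alpha>) (\<Gamma> \<alpha>) = carrier (G \<alpha>))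
     \<and> \<Omega> = eqvars \<Phi> \<and> cvars \<Phi> \<subseteq> \<Omega>
     \<and> is_solution G P \<Omega> \<Phi> \<sigma>
     \<and> (\<forall>\<tau>. is_solution G P \<Omega> \<Phi> \<tau> \<longrightarrow> sol_length G P \<Gamma> \<Omega> \<sigma> \<le> sol_length G P \<Gamma> \<Omega> \<tau>)"
  interpret minimal_solution G P \<Gamma> \<Phi> \<sigma> \<Omega>
  proof (intro minimal_solution.intro free_product.intro minimal_solution_axioms.intro)
    note A2 = A[THEN conjunct2, THEN conjunct1, THEN bspec]
    show "finite P" using A by (rule conjunct1)
    show "comm_group (G \<alpha>)" "finite (\<Gamma> \<alpha>)" "\<Gamma> \<alpha> \<subseteq> carrier (G \<alpha>) - {\<one>\<^bsub>G \<alpha>\<^esub>}"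
      "generate (G \<alpha>) (\<Gamma> \<alpha>) = carrier (G \<alpha>)" if "\<alpha> \<in> P" for \<alpha>
      using A2[OF that] by simp_all
    show "inv\<^bsub>G \<alpha>\<^esub> g \<in> \<Gamma> \<alpha>" if "\<alpha> \<in> P" "g \<in> \<Gamma> \<alpha>" for \<alpha> g
      using A2[OF that(1)] that(2) by simp
  qed (use A[THEN conjunct2, THEN conjunct2] in blast)+
  define i where "i = nat \<lceil>log 2 (real N)\<rceil>"
  \<comment> \<open>\<open>N = 0\<close> happens exactly when there are no variables; the default
    value of the logarithm then has to be nonnegative as well.\<close>
  have logN: "0 \<le> log 2 (real N)"
    by (cases "N = 0") (simp_all add: log_def[of _ 0])
  have "real N \<le> 2 ^ i"
  proof (cases "N = 0")
    case False
    then have "real N = 2 powr (log 2 (real N))" by simp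
    also have "\<dots> \<le> 2 powr real i"
      unfolding i_def by (intro powr_mono real_nat_ceiling_ge) simp
    finally show ?thesis by (simp add: powr_realpow)
  qed simp
  then have "N \<le> 2 ^ i" by (metis of_nat_le_iff of_nat_numeral of_nat_power)
  then obtain E where E: "slp_set E" "\<forall>X\<in>\<Omega>. \<sigma> X \<in> E" "card \<Omega> + card E \<le> 2000 * (sz + i + 1) ^ 3"
    using slp_bound by blast
  obtain V rl ord where V: "slp_wf P \<Gamma> V rl ord" "\<Omega> \<subseteq> V" "card V \<le> card \<Omega> + card E"
    "\<forall>X\<in>\<Omega>. \<forall>b. \<exists>w. slp_eval G V rl (X, b) w \<and> red G w = sig (X, b)"
    using slp_set_realized[OF E(1) finite_\<Omega>] E(2) by metis
  have "real i \<le> log 2 (real N) + 1" using logN unfolding i_def by linarith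
  then have "real (sz + i + 1) ^ 3 \<le> (real sz + log 2 (real N) + 2) ^ 3"
    by (intro power_mono) auto
  moreover have "card V \<le> 2000 * (sz + i + 1) ^ 3" using V(3) E(3) by linarith
  then have "real (card V) \<le> real (2000 * (sz + i + 1) ^ 3)" by (simp only: of_nat_le_iff)
  then have "real (card V) \<le> 2000 * real (sz + i + 1) ^ 3"
    by (simp only: of_nat_mult of_nat_power of_nat_numeral)
  moreover have "poly (smult 2000 ([:2, 1:] ^ 3)) x = 2000 * (x + 2) ^ 3" for x :: real
    by (simp add: poly_power add.commute)
  ultimately have "real (card V) \<le> poly (smult 2000 ([:2, 1:] ^ 3)) (real sz + log 2 (real N))"
    by simp
  with V show "\<exists>V rl ord. slp_wf P \<Gamma> V rl ord \<and> \<Omega> \<subseteq> V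
     \<and> real (card V) \<le> poly (smult 2000 ([:2, 1:] ^ 3)) (real (fnorm P \<Gamma> \<Phi>) + log 2 (real (sol_length G P \<Gamma> \<Omega> \<sigma>)))
     \<and> (\<forall>X\<in>\<Omega>. \<forall>b. \<exists>w. slp_eval G V rl (X, b) w \<and> red G w = sig_hat G \<sigma> (X, b))"
    by (intro exI[of _ V] exI[of _ rl] exI[of _ ord] conjI)
qed

end
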